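(* The Riemann hypothesis is true if and only if $\Psi(t)\ge0$ for every $t\in\mathbb{R}$. Further, if the Riemann hypothesis is true, then $\Psi(t)>0$ for every $t\ne0$.
   Context: $\xi(s)=\frac12 s(s-1)\pi^{-s/2}\Gamma(s/2)\zeta(s)$; the Riemann hypothesis asserts all zeros of $\xi$ lie on $\Re(s)=1/2$. $\Lambda$ is the von Mangoldt function, $G$ is Catalan's constant, $C=\pi^2+8G$, $\Phi(z,s,a)=\sum_{n\ge0}(n+a)^{-s}z^n$. For $t\ge0$, \[\Psi(t):=4(e^{t/2}+e^{-t/2}-2)-\sum_{n\le e^t}\frac{\Lambda(n)}{\sqrt n}(t-\log n)+\frac t2\Big[\frac{\Gamma'}{\Gamma}\Big(\frac14\Big)-\log\pi\Big]+\frac14\Big(C-e^{-t/2}\Phi(e^{-2t},2,1/4)\Big),\] and $\Psi$ is extended to $\mathbb{R}$ as an even function. *)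

theory Defs
  imports
    "HOL-Complex_Analysis.Complex_Analysis"
    "HOL-Number_Theory.Prime_Powers"
begin

(* The analytic continuation of the Dirichlet series to the plane without its pole s = 1.
   As -{1} is open and connected, at most one function has these properties; the clause
   f 1 = 0 only fixes an arbitrary value at the pole, to make the description unique. *)
definition zeta :: "complex \<Rightarrow> complex" where
  "zeta = (THE f. f holomorphic_on (- {1}) \<and>
                  (\<forall>s. Re s > 1 \<longrightarrow> f s = (\<Sum>n. of_nat (Suc n) powr (- s))) \<and>
                  f 1 = 0)"

(* xi is entire.  The product has removable singularities at s = 1 (pole of zeta) and at
   s = 0, -2, -4, ... (poles of Gamma (s / 2)); since the library sets Gamma to 0 at its poles,
   the bare product would have spurious zeros there. *)
definition xi :: "complex \<Rightarrow> complex" where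
  "xi = remove_sings
     (\<lambda>s. 1/2 * s * (s - 1) * of_real pi powr (- s / 2) * Gamma (s / 2) * zeta s)"

definition riemann_hypothesis :: bool where
  "riemann_hypothesis \<longleftrightarrow> (\<forall>s. xi s = 0 \<longrightarrow> Re s = 1/2)"

definition catalan_G :: real where
  "catalan_G = (\<Sum>n. (-1) ^ n / real (2 * n + 1) ^ 2)"

definition const_C :: real where
  "const_C = pi ^ 2 + 8 * catalan_G"

definition lerch_Phi :: "'a \<Rightarrow> 'a \<Rightarrow> 'a \<Rightarrow> 'a :: {real_normed_field, banach, ln}" where
  "lerch_Phi z s a = (\<Sum>n. (of_nat n + a) powr (- s) * z ^ n)"

(* Gamma'/Gamma is the library's Digamma. *)
definition Psi_nonneg :: "real \<Rightarrow> real" where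
  "Psi_nonneg t =
     4 * (exp (t / 2) + exp (- t / 2) - 2)
     - (\<Sum>n | 1 \<le> n \<and> real n \<le> exp t. mangoldt n / sqrt (real n) * (t - ln (real n)))
     + t / 2 * (Digamma (1 / 4) - ln pi)
     + 1 / 4 * (const_C - exp (- t / 2) * lerch_Phi (exp (- 2 * t)) 2 (1 / 4))"

definition Psi :: "real \<Rightarrow> real" where
  "Psi t = Psi_nonneg \<bar>t\<bar>"

end

theory Submission
  imports Defs "HOL-Real_Asymp.Real_Asymp"
begin

text \<open>
  On \<open>s > 1/2\<close> the Laplace transform of \<open>\<Psi>\<close> is \<open>F(s) / s\<^sup>2\<close>, where \<open>F(s) = (\<xi>'/\<xi>)(1/2 + s)\<close>.
  If \<open>\<Psi> \<ge> 0\<close>, Landau's theorem on Laplace transforms of nonnegative functions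
  makes the transform holomorphic on \<open>Re s > 0\<close>, because \<open>F\<close> has no real singularity there;
  hence \<open>\<xi>\<close> has no zero to the right of the critical line.

  Conversely, under the Riemann hypothesis \<open>|\<xi>(1/2 + s - h)| \<le> |\<xi>(1/2 + s + h)|\<close> for
  \<open>Re s \<ge> 0\<close>: equality holds on \<open>Re s = 0\<close>, and Phragmen--Lindelof applies to the quotient, whose growth is
  controlled by Borel--Caratheodory. Letting \<open>h \<rightarrow> 0\<close> gives \<open>Re F \<ge> 0\<close>. Together with the Poisson
  formula this shows that \<open>F(a + s) / s\<^sup>2\<close>, for \<open>a > 0\<close>, is the Laplace transform of
  \<open>(1/\<pi>) \<integral> Re F(a + iy) (1 - cos (yt)) / y\<^sup>2 dy \<ge> 0\<close>, and nonnegativity passes to \<open>\<Psi>\<close> as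
  \<open>a \<rightarrow> 0\<close>. The kernel also yields \<open>\<Psi>(h) \<le> 2 \<Psi>(t + h) + 2 \<Psi>(t)\<close>. A zero of \<open>\<Psi>\<close> at \<open>t > 0\<close> would
  therefore force \<open>\<Psi>(h) = O(h)\<close>, whereas \<open>\<Psi>(h) / h \<rightarrow> \<infinity>\<close> as \<open>h \<rightarrow> 0\<close>.
\<close>

section \<open>Analytic continuation of the zeta function\<close>

text \<open>Positivity of \<open>Re (\<xi>'/\<xi>)\<close> is usually read off from the Hadamard
  product. Comparing \<open>\<xi>\<close> at \<open>1/2 + s - h\<close> and
  \<open>1/2 + s + h\<close> involves neither a product nor a count of zeros, but its equality case
  on \<open>Re s = 0\<close> rests on the functional equation. That equation is obtained on the real
  interval (-1, 0), where every integrand is nonnegative and each interchange is an instance of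
  Tonelli; the identity theorem carries it to the plane.

  Dividing by \<open>s\<^sup>2\<close> makes \<open>\<Psi>\<close> a second antiderivative of the
  explicit formula: formally, under the hypothesis, it is the sum of
  \<open>(1 - cos (\<gamma> t)) / \<gamma>\<^sup>2\<close> over the zeros
  \<open>1/2 + i \<gamma>\<close>. Shifting to the line \<open>Re s = a > 0\<close> avoids the zeros
  and replaces this sum by an integral against a density, where the inequalities hold pointwise in
  \<open>y\<close>. The limit \<open>a \<rightarrow> 0\<close> is taken only for transforms at real
  points, where \<open>F\<close> is continuous, so convergence of a sum over zeros never has to be
  discussed.\<close>

text \<open>
  \<open>zeta_num s\<close> is \<open>(s - 1) \<zeta>(s)\<close>: \<open>trapezoid k s\<close> is \<open>s - 1\<close> times the error of the trapezoidal rule for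
  \<open>x powr (-s)\<close> on \<open>[k + 1, k + 2]\<close>, so the series converges for \<open>Re s > -1\<close>.
\<close>

definition trapezoid :: "nat \<Rightarrow> complex \<Rightarrow> complex" where
  "trapezoid k s = (s - 1) / 2 * (of_nat (Suc k) powr (-s) + of_nat (Suc (Suc k)) powr (-s))
     + of_nat (Suc (Suc k)) powr (1 - s) - of_nat (Suc k) powr (1 - s)"

definition zeta_num :: "complex \<Rightarrow> complex" where
  "zeta_num s = 1 + (s - 1) / 2 + (\<Sum>k. trapezoid k s)"

text \<open>As a function \<open>g\<close> of the right end point \<open>u\<close>, the scaled
  trapezoidal error vanishes to second order at \<open>u = m\<close>. Its second derivative
  \<open>g2\<close> is at most \<open>B\<close>, and two applications of the mean value inequality
  on a segment of length 1 preserve that bound.\<close>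

lemma norm_trapezoid_le:
  assumes s: "Re s \<ge> -2"
  shows "norm (trapezoid k s) \<le> norm (s - 1) * norm s * norm (s + 1) * real (Suc k) powr (-Re s - 2)"
proof -
  define m where "m = real (Suc k)"
  have m: "m \<ge> 1" by (simp add: m_def)
  define S where "S = closed_segment (complex_of_real m) (of_real (m + 1))"
  define g where "g = (\<lambda>u. (s - 1) / 2 * (of_real m powr (-s) + u powr (-s)) * (u - of_real m) + u powr (1 - s) - of_real m powr (1 - s))"
  define g1 where "g1 = (\<lambda>u. (s - 1) / 2 * (of_real m powr (-s) - u powr (-s) - s * (u - of_real m) * u powr (-s-1)))"
  define g2 where "g2 = (\<lambda>u. (s - 1) * s * (s + 1) / 2 * (u - of_real m) * u powr (-s-2))"
  define B where "B = norm (s - 1) * norm s * norm (s + 1) * m powr (-Re s - 2)"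
  have B0: "B \<ge> 0" by (simp add: B_def)
  have S: "\<exists>u. z = of_real u \<and> m \<le> u \<and> u \<le> m + 1" if "z \<in> S" for z
  proof -
    from that have "z \<in> of_real ` closed_segment m (m+1)"
      unfolding S_def by (simp only: closed_segment_of_real)
    then show ?thesis by (auto simp: closed_segment_eq_real_ivl)
  qed
  have mS: "of_real m \<in> S" "of_real (m+1) \<in> S" by (simp_all add: S_def)
  have nz: "z \<noteq> 0" "z \<notin> \<real>\<^sub>\<le>\<^sub>0" "z powr (-s) = z powr (-s-1) * z" "z powr (-s-1) = z powr (-s-2) * z"
       "norm (z - of_real m) \<le> 1" "z powr (1-s) = z powr (-s-2) * z^3"
       "z powr (-2-s) = z powr (-s-2)" "z powr (-1-s) = z powr (-s-2) * z" if "z \<in> S" for z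
  proof -
    from S[OF that] obtain u where u: "z = of_real u" "m \<le> u" "u \<le> m + 1" by blast
    show nz: "z \<noteq> 0" using u m by simp
    show "z \<notin> \<real>\<^sub>\<le>\<^sub>0" using u m by simp
    have "-s = (-s-1) + 1" by simp
      then have "z powr (-s) = z powr ((-s-1) + 1)" by (simp only:)
    also have "\<dots> = z powr (-s-1) * z powr 1" by (rule powr_add)
    finally show "z powr (-s) = z powr (-s-1) * z" by simp
    have "-s-1 = (-s-2) + 1" by simp
    then have "z powr (-s-1) = z powr ((-s-2) + 1)" by (simp only:)
    also have "\<dots> = z powr (-s-2) * z powr 1" by (rule powr_add)
    finally show *: "z powr (-s-1) = z powr (-s-2) * z" by simp
    have "-2-s = -s-2" "-1-s = -s-1" by simp_all
    then show "z powr (-2-s) = z powr (-s-2)" "z powr (-1-s) = z powr (-s-2) * z" using * by (simp_all only:)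
    have "1-s = (-s-2) + of_nat 3" by simp
    then have "z powr (1-s) = z powr ((-s-2) + of_nat 3)" by (simp only:)
    also have "\<dots> = z powr (-s-2) * z powr (of_nat 3)" by (rule powr_add)
    also have "z powr (of_nat 3) = z ^ 3" using nz by (subst powr_nat) auto
    finally show "z powr (1-s) = z powr (-s-2) * z^3" by simp
    have "z - of_real m = of_real (u - m)" using u by simp
    then show "norm (z - of_real m) \<le> 1" using u by (simp only: norm_of_real)
  qed
  have g2b: "norm (g2 z) \<le> B" if "z \<in> S" for z
  proof -
    from S[OF that] obtain u where u: "z = of_real u" "m \<le> u" "u \<le> m + 1" by blast
    have "norm (z powr (-s-2)) = u powr (-Re s - 2)"
      using u m by (subst norm_powr_real_powr) auto
    also have "\<dots> \<le> m powr (-Re s - 2)" using u m s by (intro powr_mono2') auto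
    finally have 1: "norm (z powr (-s-2)) \<le> m powr (-Re s - 2)" .
    have "norm (g2 z) = norm (s - 1) * norm s * norm (s + 1) / 2 * (norm (z - of_real m) * norm (z powr (-s-2)))"
      by (simp add: g2_def norm_mult norm_divide)
    also have "\<dots> \<le> norm (s - 1) * norm s * norm (s + 1) / 1 * (1 * m powr (-Re s - 2))"
      using nz(5)[OF that] 1 by (intro mult_mono divide_left_mono mult_nonneg_nonneg) auto
    finally show ?thesis by (simp add: B_def)
  qed
  have d1: "(g1 has_field_derivative g2 z) (at z within S)" if "z \<in> S" for z
    unfolding g1_def g2_def
    apply (rule derivative_eq_intros refl nz[OF that] | simp add: nz[OF that])+
    using nz(1)[OF that] apply (simp add: nz[OF that] field_simps power2_eq_square)
    done
  have d0: "(g has_field_derivative g1 z) (at z within S)" if "z \<in> S" for z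
    unfolding g_def g1_def
    apply (rule derivative_eq_intros refl nz[OF that] | simp add: nz[OF that])+
    using nz(1)[OF that] apply (simp add: nz[OF that] field_simps power2_eq_square power3_eq_cube)
    done
  have cS: "convex S" by (simp add: S_def)
  have dist: "norm (z - of_real m) \<le> 1" if "z \<in> S" for z using nz(5)[OF that] .
  have g1b: "norm (g1 z) \<le> B" if "z \<in> S" for z
  proof -
    have "norm (g1 z - g1 (of_real m)) \<le> B * norm (z - of_real m)"
      by (rule field_differentiable_bound[OF cS d1 g2b that mS(1)])
    also have "\<dots> \<le> B * 1" using dist[OF that] B0 by (intro mult_left_mono) auto
    also have "g1 (of_real m) = 0" by (simp add: g1_def)
    finally show ?thesis by simp
  qed
  have "norm (g (of_real (m+1)) - g (of_real m)) \<le> B * norm (of_real (m+1) - complex_of_real m)"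
    by (rule field_differentiable_bound[OF cS d0 g1b mS(2,1)])
  also have "g (of_real m) = 0" by (simp add: g_def)
  also have "g (of_real (m+1)) = trapezoid k s"
    by (simp add: g_def trapezoid_def m_def add_ac)
  finally show ?thesis by (simp add: B_def m_def)
qed

lemma summable_Suc_powr: "a < -1 \<Longrightarrow> summable (\<lambda>k. real (Suc k) powr a)"
  using summable_real_powr_iff[of a] by (subst summable_Suc_iff) auto

lemma summable_trapezoid: "Re s > -1 \<Longrightarrow> summable (\<lambda>k. trapezoid k s)"
  by (rule summable_comparison_test'[OF summable_mult[OF summable_Suc_powr[of "-Re s - 2"]], where N = 0])
     (use norm_trapezoid_le[of s] in \<open>auto simp del: of_nat_Suc\<close>)

lemma holomorphic_trapezoid [holomorphic_intros]: "trapezoid k holomorphic_on A"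
  unfolding trapezoid_def by (intro holomorphic_intros) auto

lemma holomorphic_suminf:
  fixes f :: "nat \<Rightarrow> complex \<Rightarrow> complex"
  assumes A: "open A" and hol: "\<And>n. f n holomorphic_on A"
    and loc: "\<And>z. z \<in> A \<Longrightarrow> \<exists>d>0. \<exists>M. cball z d \<subseteq> A \<and> summable M \<and> (\<forall>n. \<forall>w\<in>cball z d. norm (f n w) \<le> M n)"
  shows "(\<lambda>z. \<Sum>n. f n z) holomorphic_on A"
proof (rule holomorphic_uniform_sequence[OF A])
  show "(\<lambda>z. \<Sum>n<N. f n z) holomorphic_on A" for N by (intro holomorphic_intros hol)
  fix z assume "z \<in> A"
  from loc[OF this] obtain d M where d: "d > 0" "cball z d \<subseteq> A" "summable M" "\<And>n w. w \<in> cball z d \<Longrightarrow> norm (f n w) \<le> M n"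
    by blast
  show "\<exists>d>0. cball z d \<subseteq> A \<and> uniform_limit (cball z d) (\<lambda>n x. \<Sum>k<n. f k x) (\<lambda>z. \<Sum>n. f n z) sequentially"
    using Weierstrass_m_test[of "cball z d" f M, OF d(4) d(3)] d(1,2) by (intro exI[of _ d] conjI) auto
qed

lemma holomorphic_zeta_num: "zeta_num holomorphic_on {s. Re s > -1}"
proof -
  have "(\<lambda>s. \<Sum>k. trapezoid k s) holomorphic_on {s. Re s > -1}"
  proof (rule holomorphic_suminf)
    show "open {s. Re s > -1}" by (rule open_halfspace_Re_gt)
    fix z assume z: "z \<in> {s. Re s > -1}"
    define d where "d = (Re z + 1) / 2"
    have d: "d > 0" using z by (simp add: d_def)
    define K where "K = norm z + d + 1"
    define M where "M = (\<lambda>k. K * K * K * real (Suc k) powr (-d - 1))"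
    have le: "d - 1 \<le> Re w" "norm (w - 1) \<le> K" "norm w \<le> K" "norm (w + 1) \<le> K" if "w \<in> cball z d" for w
    proof -
      have 1: "norm (w - z) \<le> d" using that by (simp add: dist_norm norm_minus_commute)
      have "norm w \<le> norm z + d" using 1 norm_triangle_sub[of w z] by linarith
      then show "norm (w - 1) \<le> K" "norm w \<le> K" "norm (w + 1) \<le> K"
        using norm_triangle_ineq4[of w 1] norm_triangle_ineq[of w 1] by (auto simp: K_def)
      have "\<bar>Re (w - z)\<bar> \<le> d" using 1 abs_Re_le_cmod order_trans by blast
      then have "Re z - d \<le> Re w" by (simp add: abs_le_iff)
      then show "d - 1 \<le> Re w" by (simp add: d_def field_simps)
    qed
    have "norm (trapezoid k w) \<le> M k" if "w \<in> cball z d" for w k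
    proof -
      have "norm (trapezoid k w) \<le> norm (w - 1) * norm w * norm (w + 1) * real (Suc k) powr (-Re w - 2)"
        using le[OF that] d by (intro norm_trapezoid_le) auto
      also have "\<dots> \<le> M k" unfolding M_def
        using le[OF that] d by (intro mult_mono powr_mono) (auto simp: K_def)
      finally show ?thesis .
    qed
    moreover have "cball z d \<subseteq> {s. Re s > -1}" using le(1) d by force
    moreover have "summable M" unfolding M_def using d by (intro summable_mult summable_Suc_powr) auto
    ultimately show "\<exists>d>0. \<exists>M. cball z d \<subseteq> {s. Re s > -1} \<and> summable M \<and> (\<forall>n. \<forall>w\<in>cball z d. norm (trapezoid n w) \<le> M n)"
      using d by blast
  qed (intro holomorphic_intros)
  then show ?thesis unfolding zeta_num_def[abs_def] by (intro holomorphic_intros) auto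
qed

text \<open>The cube comes from the three linear factors in \<open>norm_trapezoid_le\<close>.
  Polynomial growth up to the line \<open>Re s = 0\<close> is the a priori bound that feeds
  Borel--Caratheodory and Phragmen--Lindelof.\<close>

lemma norm_zeta_num_le: "\<exists>A>0. \<forall>s. Re s \<ge> 0 \<longrightarrow> norm (zeta_num s) \<le> A * (1 + norm s) ^ 3"
proof -
  define T where "T = (\<Sum>k. real (Suc k) powr (-2))"
  have sT: "summable (\<lambda>k. real (Suc k) powr (-2))" by (rule summable_Suc_powr) simp
  have T0: "T \<ge> 0" unfolding T_def by (rule suminf_nonneg[OF sT]) simp
  have "norm (zeta_num s) \<le> (T + 2) * (1 + norm s) ^ 3" if s: "Re s \<ge> 0" for s
  proof -
    let ?K = "(1 + norm s)"
    have b: "norm (trapezoid k s) \<le> ?K ^ 3 * real (Suc k) powr (-2)" for k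
    proof -
      have "norm (trapezoid k s) \<le> norm (s - 1) * norm s * norm (s + 1) * real (Suc k) powr (-Re s - 2)"
        using s by (intro norm_trapezoid_le) auto
      also have "\<dots> \<le> ?K * ?K * ?K * real (Suc k) powr (-2)"
        using s norm_triangle_ineq4[of s 1] norm_triangle_ineq[of s 1] by (intro mult_mono powr_mono) auto
      finally show ?thesis by (simp add: power3_eq_cube)
    qed
    have sb: "summable (\<lambda>k. ?K ^ 3 * real (Suc k) powr (-2))" by (intro summable_mult sT)
    have sn: "summable (\<lambda>k. norm (trapezoid k s))"
      by (rule summable_comparison_test'[OF sb, of 0]) (use b in auto)
    have "norm (\<Sum>k. trapezoid k s) \<le> (\<Sum>k. norm (trapezoid k s))" by (rule summable_norm[OF sn])
    also have "\<dots> \<le> (\<Sum>k. ?K ^ 3 * real (Suc k) powr (-2))" by (rule suminf_le[OF b sn sb])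
    also have "\<dots> = ?K ^ 3 * T" unfolding T_def by (rule suminf_mult[OF sT])
    finally have 1: "norm (\<Sum>k. trapezoid k s) \<le> ?K ^ 3 * T" .
    have "1 + (s - 1) / 2 = (s + 1) / 2" by (simp add: field_simps)
    then have "norm (1 + (s - 1) / 2) = norm (s + 1) / 2" by (simp only: norm_divide) simp
    also have "\<dots> \<le> 1 + norm s"
      using norm_triangle_ineq[of s 1] norm_ge_zero[of s] unfolding norm_one by linarith
    finally have "norm (1 + (s - 1) / 2) \<le> 1 + norm s" .
    also have "1 + norm s \<le> ?K ^ 3" using power_increasing[of 1 3 ?K] by simp
    finally have 2: "norm (1 + (s - 1) / 2) \<le> ?K ^ 3" .
    have 3: "?K ^ 3 \<ge> 0" by simp
    have "norm (zeta_num s) \<le> ?K ^ 3 + ?K ^ 3 * T"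
      unfolding zeta_num_def by (rule order_trans[OF norm_triangle_ineq add_mono[OF 2 1]])
    also have "\<dots> \<le> (T + 2) * ?K ^ 3" using 3 by (simp add: algebra_simps)
    finally show ?thesis .
  qed
  then show ?thesis using T0 by (intro exI[of _ "T + 2"]) auto
qed

section \<open>The Dirichlet series, and positivity on the real axis\<close>

definition dzeta :: "complex \<Rightarrow> complex" where
  "dzeta s = (\<Sum>n. of_nat (Suc n) powr (- s))"

lemma norm_Suc_powr: "norm (of_nat (Suc n) powr s :: complex) = real (Suc n) powr Re s"
  by (subst norm_powr_real_powr) (auto simp del: of_nat_Suc)

lemma summable_dzeta: "Re s > 1 \<Longrightarrow> summable (\<lambda>n. norm (of_nat (Suc n) powr (- s) :: complex))"
  unfolding norm_Suc_powr by (rule summable_Suc_powr) auto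

lemma sums_dzeta: "Re s > 1 \<Longrightarrow> (\<lambda>n. of_nat (Suc n) powr (- s)) sums dzeta s"
  unfolding dzeta_def by (intro summable_sums summable_norm_cancel[OF summable_dzeta])

lemma Suc_powr_tendsto_0: "Re s < 0 \<Longrightarrow> (\<lambda>n. of_nat (Suc n) powr s :: complex) \<longlonglongrightarrow> 0"
  by (rule tendsto_norm_zero_cancel, unfold norm_Suc_powr) real_asymp

text \<open>In the partial sums the powers with exponent \<open>1 - s\<close> telescope, and each
  interior point is shared by two trapezoids of weight 1/2. What remains in \<open>part\<close> are
  end corrections, and those at \<open>N\<close> vanish for \<open>Re s > 1\<close>.\<close>

lemma zeta_num_eq_dzeta:
  assumes s: "Re s > 1"
  shows "zeta_num s = (s - 1) * dzeta s"
proof -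
  let ?f = "\<lambda>n. of_nat (Suc n) powr (- s) :: complex"
  have part: "(\<Sum>k<N. trapezoid k s) = (s - 1) * ((\<Sum>k<N. ?f k) - 1/2 + ?f N / 2) + of_nat (Suc N) powr (1 - s) - 1" for N
  proof (induction N)
    case (Suc N)
    show ?case
      unfolding sum.lessThan_Suc Suc trapezoid_def[of N] by (simp add: field_simps del: of_nat_Suc)
  qed (simp add: field_simps)
  have "(\<lambda>N. \<Sum>k<N. trapezoid k s) \<longlonglongrightarrow> (s - 1) * (dzeta s - 1/2 + 0 / 2) + 0 - 1"
    unfolding part using s sums_dzeta[OF s]
    by (intro tendsto_intros Suc_powr_tendsto_0) (auto simp: sums_def)
  then have "(\<lambda>k. trapezoid k s) sums ((s - 1) * (dzeta s - 1/2) - 1)" by (simp add: sums_def)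
  from sums_unique[OF this] show ?thesis by (simp add: zeta_num_def algebra_simps)
qed

text \<open>Replacing the integral by the rectangle at the right end point, through the mean value
  theorem, leaves a lower bound that telescopes in \<open>k\<close>.\<close>

lemma trapezoid_of_real_bounds:
  fixes x :: real and k :: nat
  defines "t \<equiv> (x - 1) / 2 * (real (Suc k) powr (-x) + real (Suc (Suc k)) powr (-x))
     + real (Suc (Suc k)) powr (1 - x) - real (Suc k) powr (1 - x)"
  assumes x: "0 < x" "x < 1"
  shows "trapezoid k (of_real x) = of_real t"
  and "t \<ge> (x - 1) / 2 * (real (Suc k) powr (-x) - real (Suc (Suc k)) powr (-x))"
proof -
  have p: "complex_of_nat (Suc n) powr of_real a = of_real (real (Suc n) powr a)" for n a
    by (subst of_real_of_nat_eq[symmetric], subst powr_of_real) (auto simp del: of_nat_Suc)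
  show "trapezoid k (of_real x) = of_real t"
    unfolding trapezoid_def t_def using p[of k "-x"] p[of "Suc k" "-x"] p[of k "1-x"] p[of "Suc k" "1-x"]
    by (simp add: power2_eq_square del: of_nat_Suc)
  define m where "m = real (Suc k)"
  have m: "m > 0" "real (Suc (Suc k)) = m + 1" by (auto simp: m_def)
  have "\<exists>z>m. z < m + 1 \<and> (m + 1) powr (1 - x) - m powr (1 - x) = (m + 1 - m) * ((1 - x) * z powr (- x))"
    using m by (intro MVT2) (auto intro!: derivative_eq_intros)
  then obtain z where z: "z > m" "(m + 1) powr (1 - x) - m powr (1 - x) = (1 - x) * z powr (- x)" "z < m + 1" by auto
  have "(m+1) powr (-x) \<le> z powr (-x)" using z m x by (intro powr_mono2') auto
  then have "(m + 1) powr (1 - x) - m powr (1 - x) \<ge> (1 - x) * (m + 1) powr (- x)"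
    unfolding z(2) using x by (intro mult_left_mono) auto
  then show "t \<ge> (x - 1) / 2 * (real (Suc k) powr (-x) - real (Suc (Suc k)) powr (-x))"
    unfolding t_def m(2) m_def[symmetric] by (simp add: field_simps)
qed

text \<open>Excludes zeros of \<open>\<xi>\<close> on the positive real axis, where Landau's
  argument needs \<open>\<xi>'/\<xi>\<close> to be regular. For \<open>x < 1\<close> the telescoping
  bound sums to \<open>(x - 1) / 2\<close>, so the value is at least
  \<open>1 + (x - 1) = x\<close>.\<close>

lemma zeta_num_real_pos:
  assumes x: "x > 0"
  shows "\<exists>v>0. zeta_num (of_real x) = of_real v"
proof -
  consider "x < 1" | "x = 1" | "x > 1" by linarith
  then show ?thesis
  proof cases
    case 1
    define t where "t = (\<lambda>k. (x - 1) / 2 * (real (Suc k) powr (-x) + real (Suc (Suc k)) powr (-x))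
     + real (Suc (Suc k)) powr (1 - x) - real (Suc k) powr (1 - x))"
    define u where "u = (\<lambda>k. (x - 1) / 2 * (real (Suc k) powr (-x) - real (Suc (Suc k)) powr (-x)))"
    have t: "trapezoid k (of_real x) = of_real (t k)" "t k \<ge> u k" for k
      using trapezoid_of_real_bounds[OF x 1, of k] unfolding t_def u_def by (auto simp del: of_nat_Suc)
    have st: "(\<lambda>k. complex_of_real (t k)) sums (\<Sum>k. trapezoid k (of_real x))"
      using summable_sums[OF summable_trapezoid[of "of_real x"]] x by (simp add: t)
    have "summable (\<lambda>k. complex_of_real (t k))" using st by (simp add: sums_iff)
    then have st': "summable t" by (simp add: summable_of_real_iff)
    have "(\<lambda>k. real (Suc k) powr (-x) - real (Suc (Suc k)) powr (-x)) sums (real (Suc 0) powr (-x) - 0)"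
    proof (rule telescope_sums')
      show "(\<lambda>k. real (Suc k) powr (-x)) \<longlonglongrightarrow> 0" using x by real_asymp
    qed
    from sums_mult[OF this, of "(x-1)/2"] have su: "u sums ((x - 1) / 2)" by (simp add: u_def)
    have "(x - 1) / 2 \<le> suminf t"
      using suminf_le[of u t] su st' t(2) by (auto simp: sums_iff)
    then have "1 + (x - 1) / 2 + suminf t \<ge> 1 + (x - 1) / 2 + (x - 1) / 2" by (rule add_left_mono)
    then have "1 + (x - 1) / 2 + suminf t > 0" using x by (simp add: field_simps)
    moreover have "(\<Sum>k. trapezoid k (of_real x)) = of_real (suminf t)"
      using sums_of_real[OF summable_sums[OF st'], where 'a = complex] st sums_unique2 by blast
    ultimately show ?thesis using x 1
      by (intro exI[of _ "1 + (x - 1) / 2 + suminf t"]) (auto simp: zeta_num_def)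
  next
    case 2
    have "trapezoid k 1 = 0" for k by (simp add: trapezoid_def del: of_nat_Suc)
    then show ?thesis using 2 by (intro exI[of _ 1]) (auto simp: zeta_num_def)
  next
    case 3
    have p: "complex_of_nat (Suc n) powr of_real a = of_real (real (Suc n) powr a)" for n a
      by (subst of_real_of_nat_eq[symmetric], subst powr_of_real) (auto simp del: of_nat_Suc)
    have s: "summable (\<lambda>n. real (Suc n) powr (-x))" using 3 by (intro summable_Suc_powr) auto
    have "dzeta (of_real x) = of_real (\<Sum>n. real (Suc n) powr (-x))"
      unfolding dzeta_def using p[of _ "-x"] by (simp add: suminf_of_real[OF s] del: of_nat_Suc)
    moreover have "(\<Sum>n. real (Suc n) powr (-x)) > 0" by (rule suminf_pos[OF s]) auto
    ultimately show ?thesis using 3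
      by (intro exI[of _ "(x - 1) * (\<Sum>n. real (Suc n) powr (-x))"]) (auto simp: zeta_num_eq_dzeta)
  qed
qed

lemma cnj_of_nat_powr: "cnj (of_nat n powr s) = of_nat n powr (cnj s)"
  by (cases "n = 0") (auto simp: cnj_powr)

lemma cnj_zeta_num: "Re s > -1 \<Longrightarrow> zeta_num (cnj s) = cnj (zeta_num s)"
proof -
  assume s: "Re s > -1"
  have "cnj (trapezoid k s) = trapezoid k (cnj s)" for k
    by (simp add: trapezoid_def cnj_of_nat_powr del: of_nat_Suc)
  then have "(\<lambda>k. trapezoid k (cnj s)) sums cnj (\<Sum>k. trapezoid k s)"
    using summable_sums[OF summable_trapezoid[OF s]] sums_cnj[of "\<lambda>k. trapezoid k s"] by simp
  from sums_unique[OF this] show ?thesis by (simp add: zeta_num_def)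
qed

section \<open>The functional equation\<close>

text \<open>Logarithmic differentiation of the reflection formula gives \<open>pi cot (pi z)\<close>
  as a difference of Digamma values, and the Digamma series turns it into partial fractions. Passing
  from \<open>z\<close> to \<open>z + 1\<close> splits off the pole at 0 and pairs
  \<open>k + 1\<close> with \<open>- (k + 1)\<close>.\<close>

lemma Digamma_reflection_sums:
  fixes z :: complex
  assumes z: "z \<notin> \<int>"
  shows "(\<lambda>k. - 2 * z / ((of_nat k + 1)\<^sup>2 - z\<^sup>2)) sums (of_real pi * cos (of_real pi * z) / sin (of_real pi * z) - 1 / z)"
proof -
  have nz: "z \<notin> \<int>\<^sub>\<le>\<^sub>0" "1 - z \<notin> \<int>\<^sub>\<le>\<^sub>0" "z + 1 \<notin> \<int>\<^sub>\<le>\<^sub>0" "z \<noteq> 0"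
  proof -
    show "z \<notin> \<int>\<^sub>\<le>\<^sub>0" "z \<noteq> 0" using z by auto
    show "1 - z \<notin> \<int>\<^sub>\<le>\<^sub>0" using z by (metis Ints_1 Ints_diff diff_diff_eq2 add_diff_cancel_left' nonpos_Ints_Int)
    show "z + 1 \<notin> \<int>\<^sub>\<le>\<^sub>0" using z by (metis Ints_1 Ints_diff add_diff_cancel_right' nonpos_Ints_Int)
  qed
  have sin0: "sin (of_real pi * z) \<noteq> 0"
    using rGamma_reflection_complex[of z] nz by (auto simp: rGamma_eq_zero_iff)
  have d1: "((\<lambda>z. rGamma z * rGamma (1 - z)) has_field_derivative
      (rGamma z * rGamma (1 - z) * (Digamma (1 - z) - Digamma z))) (at z)"
    by (rule derivative_eq_intros refl nz | simp add: algebra_simps)+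
  have d2: "((\<lambda>z. sin (of_real pi * z) / of_real pi) has_field_derivative cos (of_real pi * z)) (at z)"
    by (auto intro!: derivative_eq_intros)
  have "rGamma z * rGamma (1 - z) * (Digamma (1 - z) - Digamma z) = cos (of_real pi * z)"
    using DERIV_unique[OF d1] d2 unfolding rGamma_reflection_complex by blast
  then have D: "Digamma (1 - z) - Digamma z = of_real pi * cos (of_real pi * z) / sin (of_real pi * z)"
    unfolding rGamma_reflection_complex using sin0 by (simp add: field_simps)
  have s1: "(\<lambda>k. inverse (of_nat (Suc k)) - inverse (w + of_nat k)) sums (Digamma w + euler_mascheroni)"
    if "w \<noteq> 0" for w :: complex
    using summable_Digamma[OF that] by (simp add: Digamma_def summable_sums)
  have D2: "Digamma (z + 1) = Digamma z + 1 / z" by (rule Digamma_plus1[OF nz(4)])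
  have "1 - z \<noteq> 0" "z + 1 \<noteq> 0" using nz by auto
  from sums_diff[OF s1[OF this(1)] s1[OF this(2)]]
  have 1: "(\<lambda>k. inverse (z + 1 + of_nat k) - inverse (1 - z + of_nat k)) sums (Digamma (1 - z) - Digamma (z + 1))"
    by simp
  have 2: "inverse (z + 1 + of_nat k) - inverse (1 - z + of_nat k) = - 2 * z / ((of_nat k + 1)\<^sup>2 - z\<^sup>2)" for k
  proof -
    have "z + 1 + of_nat k \<noteq> 0"
    proof
      assume "z + 1 + of_nat k = 0"
      then have "z = - of_nat (Suc k)" by (simp add: algebra_simps eq_neg_iff_add_eq_0)
      then show False using z by (simp del: of_nat_Suc)
    qed
    moreover have "1 - z + of_nat k \<noteq> 0"
    proof
      assume "1 - z + of_nat k = 0"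
      then have "z = of_nat (Suc k)" by (simp add: algebra_simps)
      then show False using z by (simp del: of_nat_Suc)
    qed
    moreover have "(of_nat k + 1)\<^sup>2 - z\<^sup>2 = (z + 1 + of_nat k) * (1 - z + of_nat k)"
      by (simp add: power2_eq_square algebra_simps)
    ultimately show ?thesis by (simp add: divide_simps)
  qed
  show ?thesis using 1 unfolding 2 D2 D[symmetric] by (simp only: diff_diff_eq)
qed

text \<open>The cotangent expansion on the imaginary axis, at \<open>z = \<i> * y\<close>. Writing
  the result with \<open>exp (-(2 * pi * y))\<close> lets it be recognised later as a geometric
  series.\<close>

lemma coth_sums:
  fixes y :: real
  assumes y: "y > 0"
  shows "(\<lambda>k. 2 * y / ((real k + 1)\<^sup>2 + y\<^sup>2)) sums (pi * (1 + exp (-(2 * pi * y))) / (1 - exp (-(2 * pi * y))) - 1 / y)"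
proof -
  define z where "z = \<i> * of_real y"
  have z: "z \<notin> \<int>" using y by (auto simp: z_def Ints_def complex_eq_iff)
  have e: "exp (-(2 * pi * y)) \<noteq> 1" "exp (-(2 * pi * y)) = exp (-(pi * y)) * exp (-(pi*y))"
    "exp (-(pi*y)) * exp (pi * y) = 1"
    using y by (auto simp: exp_add[symmetric])
  define C where "C = (exp (-(pi*y)) + exp (pi * y)) / 2"
  define S where "S = (exp (pi*y) - exp (-(pi * y))) / 2"
  have S0: "S \<noteq> 0" using y by (auto simp: S_def)
  have cs: "cos (of_real pi * z) = of_real C" "sin (of_real pi * z) = \<i> * of_real S"
    unfolding cos_exp_eq sin_exp_eq z_def C_def S_def by (simp_all add: exp_of_real[symmetric] field_simps)
  have "of_real pi * cos (of_real pi * z) / sin (of_real pi * z) = - \<i> * of_real (pi * (C / S))"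
    unfolding cs using S0 by (simp add: divide_simps)
  also have "C / S = (exp (-(pi*y)) + exp (pi * y)) / (exp (pi*y) - exp (-(pi * y)))"
    using S0 by (simp add: C_def S_def divide_simps) (simp add: algebra_simps)
  finally have "of_real pi * cos (of_real pi * z) / sin (of_real pi * z)
     = - \<i> * of_real (pi * ((exp (-(pi*y)) + exp (pi * y)) / (exp (pi*y) - exp (-(pi * y)))))" .
  also have "(exp (-(pi*y)) + exp (pi * y)) / (exp (pi*y) - exp (-(pi * y))) = (1 + exp (-(2 * pi * y))) / (1 - exp (-(2 * pi * y)))"
  proof -
    have "exp (pi*y) - exp (-(pi * y)) \<noteq> 0" using y by auto
    moreover have "1 - exp (-(2 * pi * y)) \<noteq> 0" using e by auto
    ultimately show ?thesis
      unfolding e(2) using e(3) by (simp add: divide_simps) (simp add: algebra_simps)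
  qed
  finally have c: "of_real pi * cos (of_real pi * z) / sin (of_real pi * z) =
     - \<i> * of_real (pi * ((1 + exp (-(2 * pi * y))) / (1 - exp (-(2 * pi * y)))))" .
  have t: "- 2 * z / ((of_nat k + 1)\<^sup>2 - z\<^sup>2) = - \<i> * of_real (2 * y / ((real k + 1)\<^sup>2 + y\<^sup>2))" for k
    by (simp add: z_def power_mult_distrib)
  have "1 / z = - \<i> * of_real (1 / y)" using y by (simp add: z_def divide_simps)
  with Digamma_reflection_sums[OF z, unfolded c t] have
    "(\<lambda>k. - \<i> * of_real (2 * y / ((real k + 1)\<^sup>2 + y\<^sup>2))) sums
      (- \<i> * of_real (pi * ((1 + exp (-(2 * pi * y))) / (1 - exp (-(2 * pi * y)))) - 1 / y))"
    by (simp add: algebra_simps)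
  from sums_mult[OF this, of "\<i>"] have
    "(\<lambda>k. complex_of_real (2 * y / ((real k + 1)\<^sup>2 + y\<^sup>2))) sums
      (of_real (pi * ((1 + exp (-(2 * pi * y))) / (1 - exp (-(2 * pi * y)))) - 1 / y))"
    by (simp only: mult.assoc[symmetric]) simp
  then show ?thesis by (simp only: sums_of_real_iff) simp
qed

text \<open>Divided by \<open>1 - exp (-x)\<close>, the Laplace transform of \<open>u (1 - u)\<close> on \<open>[0, 1]\<close> is that of its 1-periodic extension,
  whose partial fractions come from the expansion of \<open>coth\<close>.\<close>

lemma periodic_laplace_sums:
  fixes x :: real
  assumes x: "x > 0"
  shows "(\<lambda>k. 4 / (x * (x\<^sup>2 + (2 * pi * (real k + 1))\<^sup>2))) sums
     ((x * (1 + exp (-x)) - 2 * (1 - exp (-x))) / x ^ 3 / (1 - exp (-x)))"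
proof -
  define y where "y = x / (2 * pi)"
  have y: "y > 0" "x = 2 * pi * y" using x by (auto simp: y_def)
  have e: "1 - exp (-x) \<noteq> 0" using x by auto
  have "4 / (x * (x\<^sup>2 + (2 * pi * (real k + 1))\<^sup>2)) = 1 / (pi * x^2) * (2 * y / ((real k + 1)\<^sup>2 + y\<^sup>2))" for k
  proof -
    have "(real k + 1)\<^sup>2 + y\<^sup>2 > 0" using y by (simp add: add_pos_pos)
    moreover have "x\<^sup>2 + (2 * pi * (real k + 1))\<^sup>2 = (2 * pi)\<^sup>2 * ((real k + 1)\<^sup>2 + y\<^sup>2)"
      unfolding y(2) by (simp only: power_mult_distrib) (simp add: algebra_simps)
    ultimately show ?thesis using x unfolding y_def
      by (simp add: divide_simps) (simp add: algebra_simps power2_eq_square)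
  qed
  moreover have "1 / (pi * x^2) * (pi * (1 + exp (-(2 * pi * y))) / (1 - exp (-(2 * pi * y))) - 1 / y) =
     (x * (1 + exp (-x)) - 2 * (1 - exp (-x))) / x ^ 3 / (1 - exp (-x))"
    unfolding y(2)[symmetric] y_def using e x by (simp add: divide_simps) (simp add: algebra_simps power2_eq_square power3_eq_cube)
  ultimately show ?thesis using sums_mult[OF coth_sums[OF y(1)], of "1 / (pi * x^2)"] by simp
qed

section \<open>Integrals of Gamma type and the trapezoidal error for negative exponents\<close>

lemma nn_integral_powr_exp:
  fixes a u :: real
  assumes a: "a > 0" and u: "u > 0"
  shows "(\<integral>\<^sup>+x. ennreal (indicator {0<..} x * x powr (a - 1) * exp (-(u * x))) \<partial>lborel) = ennreal (Gamma a * u powr (-a))"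
proof -
  have "ennreal (Gamma a) = (\<integral>\<^sup>+t. ennreal (indicator {0..} t * t powr (a - 1) / exp t) \<partial>lborel)"
    by (rule Gamma_conv_nn_integral_real[OF a])
  also have "\<dots> = ennreal \<bar>u\<bar> * (\<integral>\<^sup>+x. ennreal (indicator {0..} (0 + u * x) * (0 + u * x) powr (a - 1) / exp (0 + u * x)) \<partial>lborel)"
    using u by (intro nn_integral_real_affine) auto
  also have "\<dots> = (\<integral>\<^sup>+x. ennreal (u powr a) * ennreal (indicator {0<..} x * x powr (a - 1) * exp (-(u * x))) \<partial>lborel)"
  proof (subst nn_integral_cmult[symmetric])
    show "(\<integral>\<^sup>+x. ennreal \<bar>u\<bar> * ennreal (indicator {0..} (0 + u * x) * (0 + u * x) powr (a - 1) / exp (0 + u * x)) \<partial>lborel)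
      = (\<integral>\<^sup>+x. ennreal (u powr a) * ennreal (indicator {0<..} x * x powr (a - 1) * exp (-(u * x))) \<partial>lborel)"
    proof (intro nn_integral_cong)
      fix x :: real
      have *: "u * u powr (a - 1) = u powr a" using u powr_mult_base[of u "a - 1"] by simp
      show "ennreal \<bar>u\<bar> * ennreal (indicator {0..} (0 + u * x) * (0 + u * x) powr (a - 1) / exp (0 + u * x)) =
          ennreal (u powr a) * ennreal (indicator {0<..} x * x powr (a - 1) * exp (-(u * x)))"
      proof (cases "x > 0")
        case True
        then show ?thesis using u
          by (subst (1 2) ennreal_mult[symmetric]) (auto simp: powr_mult exp_minus field_simps *[symmetric])
      next
        case False
        then have "x = 0 \<or> u * x < 0" using u by (auto simp: mult_less_0_iff)
        then show ?thesis using False by (auto simp: indicator_def)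
      qed
    qed
  qed auto
  also have "\<dots> = ennreal (u powr a) * (\<integral>\<^sup>+x. ennreal (indicator {0<..} x * x powr (a - 1) * exp (-(u * x))) \<partial>lborel)"
    by (rule nn_integral_cmult) auto
  finally have *: "ennreal (Gamma a) = ennreal (u powr a) * (\<integral>\<^sup>+x. ennreal (indicator {0<..} x * x powr (a - 1) * exp (-(u * x))) \<partial>lborel)" (is "_ = _ * ?I") .
  have "ennreal (Gamma a * u powr (-a)) = ennreal (u powr (-a)) * ennreal (Gamma a)"
    using a by (subst ennreal_mult'[symmetric]) (auto simp: mult_ac)
  also have "\<dots> = ennreal (u powr (-a) * u powr a) * ?I"
    unfolding * by (simp add: ennreal_mult' mult.assoc)
  also have "u powr (-a) * u powr a = 1" using u by (simp add: powr_add[symmetric])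
  finally show ?thesis by simp
qed

lemma nn_integral_parabola_exp:
  fixes x :: real
  assumes x: "x > 0"
  shows "(\<integral>\<^sup>+u. ennreal ((u - n) * (n + 1 - u) * exp (-(u * x))) * indicator {n..n+1} u \<partial>lborel)
    = ennreal (exp (-(n * x)) * ((x * (1 + exp (-x)) - 2 * (1 - exp (-x))) / x ^ 3))"
proof -
  \<comment> \<open>Repeated integration by parts: for a quadratic \<open>p\<close>, an
    antiderivative of \<open>p(u) exp (-(u * x))\<close> is \<open>- exp (-(u * x))\<close> times
    \<open>p/x + p'/x^2 + p''/x^3\<close>.\<close>
  define F where "F = (\<lambda>u. exp (-(u * x)) * (((u - n)\<^sup>2 - (u - n)) / x + (2 * (u - n) - 1) / x\<^sup>2 + 2 / x ^ 3))"
  have "(\<integral>\<^sup>+u. ennreal ((u - n) * (n + 1 - u) * exp (-(u * x))) * indicator {n..n+1} u \<partial>lborel) = ennreal (F (n+1) - F n)"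
  proof (rule nn_integral_FTC_Icc)
    fix u assume "u \<in> {n..n+1}"
    then show "0 \<le> (u - n) * (n + 1 - u) * exp (-(u * x))" by simp
    show "(F has_real_derivative (u - n) * (n + 1 - u) * exp (-(u * x))) (at u)"
      unfolding F_def using x
      apply (auto intro!: derivative_eq_intros)
      apply (simp add: field_simps eval_nat_numeral)
      done
  qed auto
  also have "F (n+1) - F n = exp (-(n * x)) * ((x * (1 + exp (-x)) - 2 * (1 - exp (-x))) / x ^ 3)"
  proof -
    have "exp (-((n + 1) * x)) = exp (-(n * x)) * exp (-x)" by (simp add: exp_add[symmetric] algebra_simps)
    then show ?thesis unfolding F_def using x
      by (simp only:) (simp add: field_simps power2_eq_square power3_eq_cube)
  qed
  finally show ?thesis .
qed

text \<open>\<open>parab s n\<close> is the integral of \<open>(u - n) (n + 1 - u) u powr (-s - 2)\<close> over \<open>[n, n + 1]\<close>, the Peano form of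
  the trapezoidal error; for \<open>-1 < s < 0\<close> it also makes sense at \<open>n = 0\<close>.\<close>

definition parab :: "real \<Rightarrow> nat \<Rightarrow> real" where
  "parab s n = (let F = (\<lambda>u. - (u powr (1 - s) / (1 - s)) - real (2 * n + 1) * u powr (-s) / s + real (n * (n + 1)) * u powr (-s-1) / (s+1))
     in F (real n + 1) - F (real n))"

lemma
  fixes s :: real
  assumes s: "-1 < s" "s < 0"
  shows nn_integral_parabola_powr: "(\<integral>\<^sup>+u. ennreal ((u - real n) * (real n + 1 - u) * u powr (-s-2)) * indicator {real n..real n+1} u \<partial>lborel)
    = ennreal (parab s n)"
   and parab_nonneg: "parab s n \<ge> 0"
proof -
  define F where "F = (\<lambda>u. - (u powr (1 - s) / (1 - s)) - real (2 * n + 1) * u powr (-s) / s + real (n * (n + 1)) * u powr (-s-1) / (s+1))"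
  have c1: "continuous_on {0..} (\<lambda>u::real. u powr (1 - s))" using s
    by (intro continuous_on_powr' continuous_intros) auto
  have c2: "continuous_on {0..} (\<lambda>u::real. u powr (-s))" using s
    by (intro continuous_on_powr' continuous_intros) auto
  \<comment> \<open>At \<open>n = 0\<close> the coefficient \<open>n * (n + 1)\<close> removes the
    power with the negative exponent \<open>-s - 1\<close>, the only one that is discontinuous at
    0.\<close>
  have cont: "continuous_on {real n..real n+1} F"
  proof (cases "n = 0")
    case True
    show ?thesis unfolding F_def True
      using s by (auto intro!: continuous_intros continuous_on_subset[OF c1] continuous_on_subset[OF c2])
  next
    case False
    show ?thesis unfolding F_def using s False by (auto intro!: continuous_intros)
  qed
  \<comment> \<open>The integrand may be unbounded near 0, so the fundamental theorem is used with
    derivatives in the open interval only.\<close>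
  have I: "((\<lambda>u. (u - real n) * (real n + 1 - u) * u powr (-s-2)) has_integral F (real n + 1) - F (real n)) {real n..real n+1}"
  proof (rule fundamental_theorem_of_calculus_interior[OF _ cont])
    fix u assume u: "u \<in> {real n<..<real n+1}"
    then have u0: "u > 0" by auto
    have p: "u powr (-s) = u powr (-s-2) * u\<^sup>2" "u powr (-s-1) = u powr (-s-2) * u"
    proof -
      have "-s = (-s-2) + 2" "-s-1 = (-s-2) + 1" by simp_all
      then have "u powr (-s) = u powr (-s-2) * u powr 2" "u powr (-s-1) = u powr (-s-2) * u powr 1"
        using powr_add[of u "-s-2" 2] powr_add[of u "-s-2" 1] by (simp_all only:)
      then show "u powr (-s) = u powr (-s-2) * u\<^sup>2" "u powr (-s-1) = u powr (-s-2) * u"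
        using u0 by (simp_all only: powr_numeral powr_one)
    qed
    have "(F has_real_derivative (- ((1 - s) * u powr (-s) / (1 - s)) - real (2 * n + 1) * (-s * u powr (-s-1)) / s
         + real (n * (n+1)) * ((-s-1) * u powr (-s-2)) / (s+1))) (at u)"
    proof -
      have d: "((\<lambda>u. u powr (1-s)) has_real_derivative (1 - s) * u powr (-s)) (at u)"
        "((\<lambda>u. u powr (-s)) has_real_derivative (-s) * u powr (-s-1)) (at u)"
        "((\<lambda>u. u powr (-s-1)) has_real_derivative (-s-1) * u powr (-s-2)) (at u)"
      proof -
        have e: "1-s-1 = -s" "-s-1-1 = -s-2" by simp_all
        show "((\<lambda>u. u powr (1-s)) has_real_derivative (1 - s) * u powr (-s)) (at u)"
          using has_real_derivative_powr[OF u0, of "1-s"] unfolding e .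
        show "((\<lambda>u. u powr (-s)) has_real_derivative (-s) * u powr (-s-1)) (at u)"
          by (rule has_real_derivative_powr[OF u0])
        show "((\<lambda>u. u powr (-s-1)) has_real_derivative (-s-1) * u powr (-s-2)) (at u)"
          using has_real_derivative_powr[OF u0, of "-s-1"] unfolding e .
      qed
      show ?thesis unfolding F_def
        by (intro DERIV_add DERIV_diff DERIV_minus DERIV_cdivide DERIV_cmult d)
    qed
    also have "(- ((1 - s) * u powr (-s) / (1 - s)) - real (2 * n + 1) * (-s * u powr (-s-1)) / s
         + real (n * (n+1)) * ((-s-1) * u powr (-s-2)) / (s+1)) = (- (u powr (-s)) + real (2 * n + 1) * u powr (-s-1)
         - real (n * (n+1)) * u powr (-s-2))"
    proof -
      have "(-s-1) / (s + 1) = -1" using s by (simp add: field_simps)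
      then have "real (n * (n+1)) * ((-s-1) * u powr (-s-2)) / (s+1) = - (real (n * (n+1)) * u powr (-s-2))"
        using s by (simp add: field_simps)
      then show ?thesis using s by simp
    qed
    also have "\<dots> = (u - real n) * (real n + 1 - u) * u powr (-s-2)"
      unfolding p by (simp add: algebra_simps power2_eq_square)
    finally show "(F has_vector_derivative (u - real n) * (real n + 1 - u) * u powr (-s-2)) (at u)"
      by (simp add: has_real_derivative_iff_has_vector_derivative)
  qed auto
  have P: "parab s n = F (real n + 1) - F (real n)" by (simp add: parab_def F_def)
  have nn: "0 \<le> (u - real n) * (real n + 1 - u) * u powr (-s-2)" if "u \<in> {real n..real n + 1}" for u
    using that by auto
  show "(\<integral>\<^sup>+u. ennreal ((u - real n) * (real n + 1 - u) * u powr (-s-2)) * indicator {real n..real n+1} u \<partial>lborel)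
    = ennreal (parab s n)"
    unfolding P by (rule nn_integral_has_integral_lebesgue'[OF nn I])
  show "parab s n \<ge> 0" unfolding P by (rule has_integral_nonneg[OF I nn])
qed

text \<open>The substitution \<open>y = x^2\<close> leads to \<open>nn_integral_powr_exp\<close>. It
  is made on \<open>{0..real n}\<close>, and monotone convergence extends both sides to the half
  line.\<close>

lemma nn_integral_powr_gauss:
  fixes s v :: real
  assumes s: "-1 < s" and v: "v > 0"
  shows "(\<integral>\<^sup>+x. ennreal (indicator {0<..} x * x powr s * exp (-(v * x\<^sup>2))) \<partial>lborel) = ennreal (Gamma ((s+1)/2) / 2 * v powr (-((s+1)/2)))"
proof -
  let ?a = "(s+1)/2"
  let ?f = "\<lambda>y. y powr (?a - 1) * exp (-(v * y)) / 2"
  have "(\<integral>\<^sup>+x. ennreal (indicator {0<..} x * x powr s * exp (-(v * x\<^sup>2))) \<partial>lborel)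
     = (\<integral>\<^sup>+x. (SUP n::nat. ennreal (?f (x\<^sup>2) * (2 * x)) * indicator {0..real n} x) \<partial>lborel)"
  proof (intro nn_integral_cong)
    fix x :: real
    show "ennreal (indicator {0<..} x * x powr s * exp (-(v * x\<^sup>2))) = (SUP n::nat. ennreal (?f (x\<^sup>2) * (2 * x)) * indicator {0..real n} x)"
    proof (cases "x > 0")
      case True
      have "x powr s = (x\<^sup>2) powr (?a - 1) * x"
      proof -
        have "x\<^sup>2 = x powr 2" using True by (simp add: powr_numeral)
        then have "(x\<^sup>2) powr (?a - 1) = x powr (2 * (?a - 1))" by (simp only: powr_powr)
        also have "2 * (?a - 1) = s - 1" by (simp add: field_simps)
        finally have "(x\<^sup>2) powr (?a - 1) * x = x powr (s - 1) * x powr 1"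
          using True by simp
        also have "\<dots> = x powr s" by (simp only: powr_add[symmetric]) simp
        finally show ?thesis ..
      qed
      then have eq: "ennreal (indicator {0<..} x * x powr s * exp (-(v * x\<^sup>2))) = ennreal (?f (x\<^sup>2) * (2 * x))"
        using True by simp
      obtain n :: nat where n: "x \<le> real n" using real_arch_simple by blast
      show ?thesis unfolding eq
      proof (rule antisym)
        show "ennreal (?f (x\<^sup>2) * (2 * x)) \<le> (SUP n::nat. ennreal (?f (x\<^sup>2) * (2 * x)) * indicator {0..real n} x)"
          by (rule SUP_upper2[of n]) (use n True in auto)
        show "(SUP n::nat. ennreal (?f (x\<^sup>2) * (2 * x)) * indicator {0..real n} x) \<le> ennreal (?f (x\<^sup>2) * (2 * x))"
          by (rule SUP_least) (auto simp: indicator_def)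
      qed
    next
      case False
      then have z: "ennreal (?f (x\<^sup>2) * (2 * x)) * indicator {0..real n} x = 0" for n
        by (auto simp: indicator_def)
      show ?thesis unfolding z using False by simp
    qed
  qed
  also have "\<dots> = (SUP n::nat. (\<integral>\<^sup>+x. ennreal (?f (x\<^sup>2) * (2 * x)) * indicator {0..real n} x \<partial>lborel))"
  proof (rule nn_integral_monotone_convergence_SUP)
    show "incseq (\<lambda>n x. ennreal (?f (x\<^sup>2) * (2 * x)) * indicator {0..real n} x)"
      by (auto simp: incseq_def le_fun_def indicator_def)
  qed auto
  also have "(\<lambda>n::nat. (\<integral>\<^sup>+x. ennreal (?f (x\<^sup>2) * (2 * x)) * indicator {0..real n} x \<partial>lborel))
      = (\<lambda>n. (\<integral>\<^sup>+y. ennreal (?f y) * indicator {0..(real n)\<^sup>2} y \<partial>lborel))"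
  proof
    fix n :: nat
    have "(\<integral>\<^sup>+y. ennreal (?f y * indicator {0\<^sup>2..(real n)\<^sup>2} y) \<partial>lborel) = (\<integral>\<^sup>+x. ennreal (?f (x\<^sup>2) * (2 * x) * indicator {0..real n} x) \<partial>lborel)"
      by (rule nn_integral_substitution[where g = "\<lambda>x. x\<^sup>2" and g' = "\<lambda>x. 2 * x"])
         (auto intro!: derivative_eq_intros continuous_intros simp: set_borel_measurable_def)
    moreover have e: "ennreal (a * indicator A y) = ennreal a * indicator A y" for a and A :: "real set" and y
      by (auto simp: indicator_def)
    ultimately show "(\<integral>\<^sup>+x. ennreal (?f (x\<^sup>2) * (2 * x)) * indicator {0..real n} x \<partial>lborel) = (\<integral>\<^sup>+y. ennreal (?f y) * indicator {0..(real n)\<^sup>2} y \<partial>lborel)"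
      by (simp only: e zero_power2)
  qed
  also have "(SUP n::nat. (\<integral>\<^sup>+y. ennreal (?f y) * indicator {0..(real n)\<^sup>2} y \<partial>lborel)) = (\<integral>\<^sup>+y. (SUP n::nat. ennreal (?f y) * indicator {0..(real n)\<^sup>2} y) \<partial>lborel)"
  proof (rule nn_integral_monotone_convergence_SUP[symmetric])
    have "(real m)\<^sup>2 \<le> (real n)\<^sup>2" if "m \<le> n" for m n using that by (intro power_mono) auto
    then show "incseq (\<lambda>n x. ennreal (?f x) * indicator {0..(real n)\<^sup>2} x)"
      by (auto simp: incseq_def le_fun_def indicator_def intro: order_trans)
  qed auto
  also have "\<dots> = (\<integral>\<^sup>+y. ennreal (1/2) * ennreal (indicator {0<..} y * y powr (?a - 1) * exp (-(v * y))) \<partial>lborel)"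
  proof (intro nn_integral_cong)
    fix y :: real
    show "(SUP n::nat. ennreal (?f y) * indicator {0..(real n)\<^sup>2} y) = ennreal (1/2) * ennreal (indicator {0<..} y * y powr (?a - 1) * exp (-(v * y)))"
    proof (cases "y > 0")
      case True
      have eq: "ennreal (1/2) * ennreal (indicator {0<..} y * y powr (?a - 1) * exp (-(v * y))) = ennreal (?f y)"
        using True by (subst ennreal_mult'[symmetric]) auto
      obtain n :: nat where n: "y \<le> real n" using real_arch_simple by blast
      then have "1 \<le> real n" using True by (cases n) auto
      then have n2: "y \<le> (real n)\<^sup>2" using n mult_mono[of 1 "real n" y "real n"] True by (simp add: power2_eq_square)
      show ?thesis unfolding eq
      proof (rule antisym)
        show "ennreal (?f y) \<le> (SUP n::nat. ennreal (?f y) * indicator {0..(real n)\<^sup>2} y)"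
          by (rule SUP_upper2[of n]) (use n2 True in auto)
        show "(SUP n::nat. ennreal (?f y) * indicator {0..(real n)\<^sup>2} y) \<le> ennreal (?f y)"
          by (rule SUP_least) (auto simp: indicator_def)
      qed
    next
      case False
      then have z: "ennreal (?f y) * indicator {0..(real n)\<^sup>2} y = 0" for n
        by (auto simp: indicator_def)
      show ?thesis unfolding z using False by simp
    qed
  qed
  also have "\<dots> = ennreal (1/2) * (\<integral>\<^sup>+y. ennreal (indicator {0<..} y * y powr (?a - 1) * exp (-(v * y))) \<partial>lborel)"
    by (rule nn_integral_cmult) auto
  also have "\<dots> = ennreal (1/2) * ennreal (Gamma ?a * v powr (-?a))"
    using s v by (subst nn_integral_powr_exp) auto
  also have "\<dots> = ennreal (1/2 * (Gamma ?a * v powr (-?a)))" by (rule ennreal_mult'[symmetric]) simp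
  also have "1/2 * (Gamma ?a * v powr (-?a)) = Gamma ?a / 2 * v powr (-?a)" by simp
  finally show ?thesis .
qed

text \<open>Write \<open>1 / (x^2 + a^2)\<close> as the integral of
  \<open>exp (-((x^2 + a^2) * v))\<close> over \<open>v > 0\<close> and integrate over
  \<open>x\<close> first: the Gaussian integral gives one Gamma factor, the remaining integral over
  \<open>v\<close> the other.\<close>

lemma nn_integral_powr_Cauchy:
  fixes s a :: real
  assumes s: "-1 < s" "s < 1" and a: "a > 0"
  shows "(\<integral>\<^sup>+x. ennreal (indicator {0<..} x * (x powr s / (x\<^sup>2 + a\<^sup>2))) \<partial>lborel)
     = ennreal (Gamma ((s+1)/2) * Gamma ((1-s)/2) / 2 * a powr (s - 1))"
proof -
  have "(\<integral>\<^sup>+x. ennreal (indicator {0<..} x * (x powr s / (x\<^sup>2 + a\<^sup>2))) \<partial>lborel)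
    = (\<integral>\<^sup>+x. (\<integral>\<^sup>+v. ennreal (indicator {0<..} x * x powr s * (indicator {0<..} v * exp (-((x\<^sup>2 + a\<^sup>2) * v)))) \<partial>lborel) \<partial>lborel)"
  proof (intro nn_integral_cong)
    fix x :: real
    have u: "x\<^sup>2 + a\<^sup>2 > 0" using a by (simp add: add_nonneg_pos)
    have "(\<integral>\<^sup>+v. ennreal (indicator {0<..} x * x powr s * (indicator {0<..} v * exp (-((x\<^sup>2 + a\<^sup>2) * v)))) \<partial>lborel)
      = (\<integral>\<^sup>+v. ennreal (indicator {0<..} x * x powr s) * ennreal (indicator {0<..} v * v powr (1 - 1) * exp (-((x\<^sup>2 + a\<^sup>2) * v))) \<partial>lborel)"
      by (intro nn_integral_cong, subst ennreal_mult'[symmetric]) (auto simp: indicator_def)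
    also have "\<dots> = ennreal (indicator {0<..} x * x powr s) * ennreal (Gamma 1 * (x\<^sup>2 + a\<^sup>2) powr (-1))"
      by (subst nn_integral_cmult, measurable) (simp only: nn_integral_powr_exp[OF zero_less_one u])
    also have "\<dots> = ennreal (indicator {0<..} x * (x powr s / (x\<^sup>2 + a\<^sup>2)))"
      using u by (subst ennreal_mult'[symmetric]) (auto simp: powr_minus_divide)
    finally show "ennreal (indicator {0<..} x * (x powr s / (x\<^sup>2 + a\<^sup>2))) =
       (\<integral>\<^sup>+v. ennreal (indicator {0<..} x * x powr s * (indicator {0<..} v * exp (-((x\<^sup>2 + a\<^sup>2) * v)))) \<partial>lborel)" ..
  qed
  also have "\<dots> = (\<integral>\<^sup>+v. (\<integral>\<^sup>+x. ennreal (indicator {0<..} x * x powr s * (indicator {0<..} v * exp (-((x\<^sup>2 + a\<^sup>2) * v)))) \<partial>lborel) \<partial>lborel)"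
    by (rule lborel_pair.Fubini') measurable
  also have "\<dots> = (\<integral>\<^sup>+v. ennreal (Gamma ((s+1)/2) / 2) * ennreal (indicator {0<..} v * v powr ((1-s)/2 - 1) * exp (-(a\<^sup>2 * v))) \<partial>lborel)"
  proof (intro nn_integral_cong)
    fix v :: real
    show "(\<integral>\<^sup>+x. ennreal (indicator {0<..} x * x powr s * (indicator {0<..} v * exp (-((x\<^sup>2 + a\<^sup>2) * v)))) \<partial>lborel)
      = ennreal (Gamma ((s+1)/2) / 2) * ennreal (indicator {0<..} v * v powr ((1-s)/2 - 1) * exp (-(a\<^sup>2 * v)))"
    proof (cases "v > 0")
      case True
      have "(\<integral>\<^sup>+x. ennreal (indicator {0<..} x * x powr s * (indicator {0<..} v * exp (-((x\<^sup>2 + a\<^sup>2) * v)))) \<partial>lborel)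
        = (\<integral>\<^sup>+x. ennreal (exp (-(a\<^sup>2 * v))) * ennreal (indicator {0<..} x * x powr s * exp (-(v * x\<^sup>2))) \<partial>lborel)"
        using True by (intro nn_integral_cong, subst ennreal_mult'[symmetric]) (auto simp: exp_add[symmetric] algebra_simps)
      also have "\<dots> = ennreal (exp (-(a\<^sup>2 * v))) * ennreal (Gamma ((s+1)/2) / 2 * v powr (-((s+1)/2)))"
        using True s by (subst nn_integral_cmult) (auto simp: nn_integral_powr_gauss)
      also have "-((s+1)/2) = (1-s)/2 - 1" by (simp add: field_simps)
      finally show ?thesis using True s
        by (simp add: ennreal_mult'[symmetric] mult_ac)
    qed auto
  qed
  also have "\<dots> = ennreal (Gamma ((s+1)/2) / 2) * ennreal (Gamma ((1-s)/2) * (a\<^sup>2) powr (-((1-s)/2)))"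
    using s a by (subst nn_integral_cmult) (auto simp: nn_integral_powr_exp)
  also have "(a\<^sup>2) powr (-((1-s)/2)) = a powr (s - 1)"
  proof -
    have "a\<^sup>2 = a powr 2" using a by (simp add: powr_numeral)
    then have "(a\<^sup>2) powr (-((1-s)/2)) = a powr (2 * (-((1-s)/2)))" by (simp only: powr_powr)
    also have "2 * (-((1-s)/2)) = s - 1" by (simp add: field_simps)
    finally show ?thesis .
  qed
  finally show ?thesis using s by (simp add: ennreal_mult'[symmetric])
qed

text \<open>Write \<open>\<Gamma>(s + 2) u powr (-s - 2)\<close> as a Laplace integral, sum over \<open>n\<close>, and expand the resulting periodic transform
  into partial fractions. The right-hand side contains \<open>\<zeta>(1 - s)\<close>.\<close>

lemma parab_sums:
  fixes s :: real
  assumes s: "-1 < s" "s < 0"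
  shows "(\<lambda>n. Gamma (s + 2) * parab s n) sums
     (2 * Gamma ((s+1)/2) * Gamma ((1-s)/2) * (2 * pi) powr (s - 1) * (\<Sum>m. real (Suc m) powr (s - 1)))"
proof -
  define Q where "Q = (\<lambda>x::real. (x * (1 + exp (-x)) - 2 * (1 - exp (-x))) / x ^ 3)"
  define g where "g = (\<lambda>m. 2 * Gamma ((s+1)/2) * Gamma ((1-s)/2) * (2 * pi) powr (s - 1) * real (Suc m) powr (s - 1))"
  have G0: "Gamma (s+2) > 0" "Gamma ((s+1)/2) > 0" "Gamma ((1-s)/2) > 0" using s by (auto intro!: Gamma_real_pos)
  have Qs: "(\<lambda>k. 4 / (x * (x\<^sup>2 + (2 * pi * (real k + 1))\<^sup>2))) sums (Q x / (1 - exp (-x)))" if "x > 0" for x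
    using periodic_laplace_sums[OF that] by (simp add: Q_def)
  \<comment> \<open>The sign of \<open>Q\<close> is read off from its partial fractions, all of
    whose terms are positive.\<close>
  have Q0: "Q x \<ge> 0" if x: "x > 0" for x
  proof -
    have "0 \<le> Q x / (1 - exp (-x))"
      by (rule sums_le[OF _ sums_zero Qs[OF x]]) (use x in auto)
    then show ?thesis using x by (simp add: zero_le_divide_iff)
  qed
  have 1: "ennreal (Gamma (s+2) * parab s n) = (\<integral>\<^sup>+x. ennreal (indicator {0<..} x * x powr (s+1) * (exp (-(real n * x)) * Q x)) \<partial>lborel)" for n
  proof -
    have "ennreal (Gamma (s+2) * parab s n) = (\<integral>\<^sup>+u. ennreal (Gamma (s+2)) * (ennreal ((u - real n) * (real n + 1 - u) * u powr (-s-2)) * indicator {real n..real n+1} u) \<partial>lborel)"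
      using nn_integral_parabola_powr[OF s] G0 by (subst nn_integral_cmult) (auto simp: ennreal_mult')
    also have "\<dots> = (\<integral>\<^sup>+u. (\<integral>\<^sup>+x. ennreal (indicator {0<..} x * x powr (s+1) * exp (-(u * x))) * (ennreal ((u - real n) * (real n + 1 - u)) * indicator {real n..real n+1} u) \<partial>lborel) \<partial>lborel)"
    \<comment> \<open>The Gamma integral is available only for \<open>u > 0\<close>; the point
      \<open>u = 0\<close>, which occurs for \<open>n = 0\<close>, is put aside as a null
      set.\<close>
    proof (intro nn_integral_cong_AE AE_I[of _ _ "{0}"])
      have "ennreal (Gamma (s+2)) * (ennreal ((u - real n) * (real n + 1 - u) * u powr (-s-2)) * indicator {real n..real n+1} u)
        = (\<integral>\<^sup>+x. ennreal (indicator {0<..} x * x powr (s+1) * exp (-(u * x))) * (ennreal ((u - real n) * (real n + 1 - u)) * indicator {real n..real n+1} u) \<partial>lborel)"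
        if u: "u \<noteq> 0" for u
      proof (cases "u \<in> {real n..real n+1}")
        case True
        then have u0: "u > 0" using u by auto
        have e: "s + 2 - 1 = s + 1" "-(s+2) = -s-2" by simp_all
        have "(\<integral>\<^sup>+x. ennreal (indicator {0<..} x * x powr (s+1) * exp (-(u * x))) * (ennreal ((u - real n) * (real n + 1 - u)) * indicator {real n..real n+1} u) \<partial>lborel)
          = (\<integral>\<^sup>+x. ennreal (indicator {0<..} x * x powr (s+1) * exp (-(u * x))) \<partial>lborel) * (ennreal ((u - real n) * (real n + 1 - u)) * indicator {real n..real n+1} u)"
          by (rule nn_integral_multc) auto
        also have "\<dots> = ennreal (Gamma (s+2) * u powr (-s-2)) * (ennreal ((u - real n) * (real n + 1 - u)) * indicator {real n..real n+1} u)"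
          using nn_integral_powr_exp[of "s+2" u] u0 s unfolding e by simp
        also have "\<dots> = ennreal (Gamma (s+2)) * (ennreal ((u - real n) * (real n + 1 - u) * u powr (-s-2)) * indicator {real n..real n+1} u)"
          using True G0 by (simp add: ennreal_mult'[symmetric] mult_ac)
        finally show ?thesis ..
      qed auto
      then show "{u \<in> space lborel. ennreal (Gamma (s+2)) * (ennreal ((u - real n) * (real n + 1 - u) * u powr (-s-2)) * indicator {real n..real n+1} u)
        \<noteq> (\<integral>\<^sup>+x. ennreal (indicator {0<..} x * x powr (s+1) * exp (-(u * x))) * (ennreal ((u - real n) * (real n + 1 - u)) * indicator {real n..real n+1} u) \<partial>lborel)} \<subseteq> {0}"
        by blast
    qed auto
    also have "\<dots> = (\<integral>\<^sup>+x. (\<integral>\<^sup>+u. ennreal (indicator {0<..} x * x powr (s+1) * exp (-(u * x))) * (ennreal ((u - real n) * (real n + 1 - u)) * indicator {real n..real n+1} u) \<partial>lborel) \<partial>lborel)"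
      by (rule lborel_pair.Fubini') measurable
    also have "\<dots> = (\<integral>\<^sup>+x. ennreal (indicator {0<..} x * x powr (s+1) * (exp (-(real n * x)) * Q x)) \<partial>lborel)"
    proof (intro nn_integral_cong)
      fix x :: real
      show "(\<integral>\<^sup>+u. ennreal (indicator {0<..} x * x powr (s+1) * exp (-(u * x))) * (ennreal ((u - real n) * (real n + 1 - u)) * indicator {real n..real n+1} u) \<partial>lborel)
        = ennreal (indicator {0<..} x * x powr (s+1) * (exp (-(real n * x)) * Q x))"
      proof (cases "x > 0")
        case True
        have "(\<integral>\<^sup>+u. ennreal (indicator {0<..} x * x powr (s+1) * exp (-(u * x))) * (ennreal ((u - real n) * (real n + 1 - u)) * indicator {real n..real n+1} u) \<partial>lborel)
          = (\<integral>\<^sup>+u. ennreal (x powr (s+1)) * (ennreal ((u - real n) * (real n + 1 - u) * exp (-(u * x))) * indicator {real n..real n+1} u) \<partial>lborel)"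
          using True by (intro nn_integral_cong) (auto simp: indicator_def ennreal_mult'[symmetric] mult_ac)
        also have "\<dots> = ennreal (x powr (s+1)) * ennreal (exp (-(real n * x)) * Q x)"
          using nn_integral_parabola_exp[OF True, of "real n"] by (subst nn_integral_cmult) (auto simp: Q_def)
        finally show ?thesis using True by (simp add: ennreal_mult'[symmetric])
      qed auto
    qed
    finally show ?thesis .
  qed
  have "(\<Sum>n. ennreal (Gamma (s+2) * parab s n)) = (\<integral>\<^sup>+x. (\<Sum>n. ennreal (indicator {0<..} x * x powr (s+1) * (exp (-(real n * x)) * Q x))) \<partial>lborel)"
    unfolding 1 by (rule nn_integral_suminf[symmetric]) (auto simp: Q_def)
  also have "\<dots> = (\<integral>\<^sup>+x. (\<Sum>m. ennreal 4 * ennreal (indicator {0<..} x * (x powr s / (x\<^sup>2 + (2 * pi * (real m + 1))\<^sup>2)))) \<partial>lborel)"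
  proof (intro nn_integral_cong)
    fix x :: real
    show "(\<Sum>n. ennreal (indicator {0<..} x * x powr (s+1) * (exp (-(real n * x)) * Q x))) = (\<Sum>m. ennreal 4 * ennreal (indicator {0<..} x * (x powr s / (x\<^sup>2 + (2 * pi * (real m + 1))\<^sup>2))))"
    proof (cases "x > 0")
      case True
      have "(\<lambda>n. exp (-x) ^ n) sums (1 / (1 - exp (-x)))" using True by (intro geometric_sums) auto
      then have "(\<lambda>n. (x powr (s+1) * Q x) * exp (-(real n * x))) sums ((x powr (s+1) * Q x) * (1 / (1 - exp (-x))))"
        by (intro sums_mult) (simp add: exp_of_nat_mult[symmetric])
      then have A: "(\<Sum>n. ennreal ((x powr (s+1) * Q x) * exp (-(real n * x)))) = ennreal ((x powr (s+1) * Q x) * (1 / (1 - exp (-x))))"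
        using Q0[OF True] by (subst suminf_ennreal2) (auto simp: sums_iff)
      have "(\<lambda>m. x powr (s+1) * (4 / (x * (x\<^sup>2 + (2 * pi * (real m + 1))\<^sup>2)))) sums (x powr (s+1) * (Q x / (1 - exp (-x))))"
        by (intro sums_mult Qs True)
      then have B: "(\<Sum>m. ennreal (x powr (s+1) * (4 / (x * (x\<^sup>2 + (2 * pi * (real m + 1))\<^sup>2))))) = ennreal (x powr (s+1) * (Q x / (1 - exp (-x))))"
        using True by (subst suminf_ennreal2) (auto simp: sums_iff)
      have C: "x powr (s+1) * (4 / (x * (x\<^sup>2 + (2 * pi * (real m + 1))\<^sup>2))) = 4 * (x powr s / (x\<^sup>2 + (2 * pi * (real m + 1))\<^sup>2))" for m
      proof -
        have "x powr (s + 1) = x powr s * x" using True by (simp add: powr_add)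
        then show ?thesis using True by simp
      qed
      have D: "ennreal 4 * ennreal (indicator {0<..} x * (x powr s / (x\<^sup>2 + (2 * pi * (real m + 1))\<^sup>2))) = ennreal (x powr (s+1) * (4 / (x * (x\<^sup>2 + (2 * pi * (real m + 1))\<^sup>2))))" for m
        unfolding C using True by (subst ennreal_mult'[symmetric]) auto
      have E: "ennreal (indicator {0<..} x * x powr (s+1) * (exp (-(real n * x)) * Q x)) = ennreal ((x powr (s+1) * Q x) * exp (-(real n * x)))" for n
        using True by (simp add: mult_ac)
      show ?thesis unfolding D E A B by simp
    qed auto
  qed
  also have "\<dots> = (\<Sum>m. \<integral>\<^sup>+x. ennreal 4 * ennreal (indicator {0<..} x * (x powr s / (x\<^sup>2 + (2 * pi * (real m + 1))\<^sup>2))) \<partial>lborel)"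
    by (rule nn_integral_suminf) auto
  also have "\<dots> = (\<Sum>m. ennreal (g m))"
  proof (intro suminf_cong)
    fix m :: nat
    have p: "2 * pi * (real m + 1) > 0" by (simp add: add_nonneg_pos)
    have "(\<integral>\<^sup>+x. ennreal 4 * ennreal (indicator {0<..} x * (x powr s / (x\<^sup>2 + (2 * pi * (real m + 1))\<^sup>2))) \<partial>lborel)
       = ennreal 4 * ennreal (Gamma ((s+1)/2) * Gamma ((1-s)/2) / 2 * (2 * pi * (real m + 1)) powr (s - 1))"
      using nn_integral_powr_Cauchy[of s, OF s(1) _ p] s by (subst nn_integral_cmult) auto
    also have "\<dots> = ennreal (4 * (Gamma ((s+1)/2) * Gamma ((1-s)/2) / 2 * (2 * pi * (real m + 1)) powr (s - 1)))"
      by (rule ennreal_mult'[symmetric]) simp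
    also have "(2 * pi * (real m + 1)) powr (s - 1) = (2 * pi) powr (s - 1) * (real m + 1) powr (s - 1)"
      by (rule powr_mult)
    also have "4 * (Gamma ((s+1)/2) * Gamma ((1-s)/2) / 2 * ((2 * pi) powr (s - 1) * (real m + 1) powr (s - 1))) = g m"
      by (simp add: g_def add_ac)
    finally show "(\<integral>\<^sup>+x. ennreal 4 * ennreal (indicator {0<..} x * (x powr s / (x\<^sup>2 + (2 * pi * (real m + 1))\<^sup>2))) \<partial>lborel) = ennreal (g m)" .
  qed
  finally have eq: "(\<Sum>n. ennreal (Gamma (s+2) * parab s n)) = (\<Sum>m. ennreal (g m))" .
  have sg: "summable g" unfolding g_def using s by (intro summable_mult summable_Suc_powr) auto
  have g0: "g m \<ge> 0" for m using G0 by (simp add: g_def)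
  have fin: "(\<Sum>m. ennreal (g m)) = ennreal (suminf g)" by (rule suminf_ennreal2[OF g0 sg])
  have p0: "Gamma (s+2) * parab s n \<ge> 0" for n using G0 parab_nonneg[OF s] by simp
  have sp: "summable (\<lambda>n. Gamma (s+2) * parab s n)"
    by (rule summable_suminf_not_top[OF p0]) (simp add: eq fin)
  have "ennreal (\<Sum>n. Gamma (s+2) * parab s n) = ennreal (suminf g)"
    using suminf_ennreal2[OF p0 sp] eq fin by simp
  then have "(\<Sum>n. Gamma (s+2) * parab s n) = suminf g"
    using suminf_nonneg[OF sp p0] suminf_nonneg[OF sg g0] by simp
  moreover have "suminf g = 2 * Gamma ((s+1)/2) * Gamma ((1-s)/2) * (2 * pi) powr (s - 1) * (\<Sum>m. real (Suc m) powr (s - 1))"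
    unfolding g_def using s by (intro suminf_mult summable_Suc_powr) auto
  ultimately show ?thesis using sp by (simp add: sums_iff)
qed

section \<open>The functional equation on the interval (-1, 0) and its continuation\<close>

lemma trapezoid_eq_parab:
  fixes s :: real
  assumes s: "-1 < s" "s < 0"
  shows "trapezoid k (of_real s) = of_real ((s - 1) * s * (s + 1) / 2 * parab s (Suc k))"
proof -
  define m where "m = real (Suc k)"
  have m: "m > 0" "real (Suc (Suc k)) = m + 1" by (auto simp: m_def)
  have p: "complex_of_nat (Suc n) powr of_real a = of_real (real (Suc n) powr a)" for n a
    by (subst of_real_of_nat_eq[symmetric], subst powr_of_real) (auto simp del: of_nat_Suc)
  have tr: "trapezoid k (of_real s) = of_real ((s - 1) / 2 * (m powr (-s) + (m+1) powr (-s)) + (m+1) powr (1-s) - m powr (1-s))"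
    unfolding trapezoid_def m(2)[symmetric] unfolding m_def using p[of k "-s"] p[of "Suc k" "-s"] p[of k "1-s"] p[of "Suc k" "1-s"]
    by (simp add: power2_eq_square del: of_nat_Suc)
  have e: "u powr (-s) = u powr (-s-1) * u" "u powr (1-s) = u powr (-s-1) * u^2" if "u > 0" for u :: real
  proof -
    have "-s = (-s-1) + 1" "1-s = (-s-1) + 2" by simp_all
    then have "u powr (-s) = u powr (-s-1) * u powr 1" "u powr (1-s) = u powr (-s-1) * u powr 2"
      using powr_add[of u "-s-1" 1] powr_add[of u "-s-1" 2] by (simp_all only:)
    then show "u powr (-s) = u powr (-s-1) * u" "u powr (1-s) = u powr (-s-1) * u^2"
      using that by (simp_all only: powr_numeral powr_one)
  qed
  \<comment> \<open>With \<open>A\<close> and \<open>B\<close> as the only remaining powers, the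
    claim becomes a polynomial identity in \<open>m\<close> and \<open>s\<close>, linear in
    \<open>A\<close> and \<open>B\<close>.\<close>
  define A where "A = m powr (-s-1)"
  define B where "B = (m+1) powr (-s-1)"
  have nz: "s \<noteq> 0" "s + 1 \<noteq> 0" "1 - s \<noteq> 0" using s by auto
  have m1: "m + 1 > 0" using m by simp
  define F where "F = (\<lambda>u X. - (X * u\<^sup>2 / (1 - s)) - (2 * m + 1) * (X * u) / s + m * (m + 1) * X / (s+1))"
  have P: "parab s (Suc k) = F (m+1) B - F m A"
    unfolding parab_def Let_def F_def m_def[symmetric] e[OF m(1)] e[OF m1] A_def[symmetric] B_def[symmetric]
    using m by (simp add: m_def del: of_nat_Suc) (simp add: algebra_simps)?
  have F: "(s - 1) * s * (s + 1) / 2 * F u X = X * (s * (s+1) * u\<^sup>2 - (2*m+1) * u * (s - 1) * (s + 1) + m * (m+1) * s * (s-1)) / 2" for u X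
    unfolding F_def using nz by (simp add: divide_simps) (simp add: algebra_simps power2_eq_square)
  have "(s - 1) * s * (s + 1) / 2 * parab s (Suc k) = (s - 1) * s * (s + 1) / 2 * F (m+1) B - (s - 1) * s * (s + 1) / 2 * F m A"
    unfolding P by (rule right_diff_distrib)
  also have "\<dots> = (s - 1) / 2 * (A * m + B * (m+1)) + B * (m+1)^2 - A * m^2"
    unfolding F by (simp add: field_simps power2_eq_square)
  also have "\<dots> = (s - 1) / 2 * (m powr (-s) + (m+1) powr (-s)) + (m+1) powr (1-s) - m powr (1-s)"
    unfolding e[OF m(1)] e[OF m1] A_def B_def ..
  finally show ?thesis unfolding tr by simp
qed

text \<open>For negative \<open>s\<close> the interval \<open>[0, 1]\<close> contributes exactly the
  constant in front of the series in \<open>zeta_num\<close>, so \<open>zeta_num s\<close> is the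
  complete sum over \<open>n \<ge> 0\<close> that \<open>parab_sums\<close> evaluates.\<close>

lemma parab_0:
  fixes s :: real
  assumes s: "-1 < s" "s < 0"
  shows "(s - 1) * s * (s + 1) / 2 * parab s 0 = 1 + (s - 1) / 2"
  using s by (simp add: parab_def divide_simps) (simp add: algebra_simps)

lemma zeta_num_real_reflect:
  fixes s :: real
  assumes s: "-1 < s" "s < 0"
  defines "Z \<equiv> (\<Sum>m. real (Suc m) powr (s - 1))"
  shows "zeta_num (of_real s) = of_real ((s - 1) * s * (s + 1) * Gamma ((s+1)/2) * Gamma ((1-s)/2) * (2 * pi) powr (s - 1) * Z / Gamma (s+2))"
    and "zeta_num (1 - of_real s) = of_real (-s * Z)"
proof -
  have G: "Gamma (s+2) > 0" using s by (intro Gamma_real_pos) auto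
  define c where "c = (s - 1) * s * (s + 1) / 2"
  define V where "V = 2 * Gamma ((s+1)/2) * Gamma ((1-s)/2) * (2 * pi) powr (s - 1) * Z"
  have "(\<lambda>n. Gamma (s+2) * parab s n) sums V" unfolding V_def Z_def by (rule parab_sums[OF s])
  from sums_mult[OF this, of "c / Gamma (s+2)"] G
  have 1: "(\<lambda>n. c * parab s n) sums (c * V / Gamma (s+2))" by simp
  then have "(\<lambda>n. c * parab s (Suc n)) sums (c * V / Gamma (s+2) - c * parab s 0)"
    using sums_Suc_iff[of "\<lambda>n. c * parab s n" "c * V / Gamma (s+2) - c * parab s 0"] by simp
  then have "(\<lambda>n. complex_of_real (c * parab s (Suc n))) sums of_real (c * V / Gamma (s+2) - c * parab s 0)"
    by (rule sums_of_real)
  then have "(\<lambda>n. trapezoid n (of_real s)) sums of_real (c * V / Gamma (s+2) - (1 + (s - 1) / 2))"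
    unfolding trapezoid_eq_parab[OF s] c_def parab_0[OF s] .
  from sums_unique[OF this, symmetric] have "zeta_num (of_real s) = of_real (c * V / Gamma (s+2))"
    unfolding zeta_num_def by (simp only:) simp
  then show "zeta_num (of_real s) = of_real ((s - 1) * s * (s + 1) * Gamma ((s+1)/2) * Gamma ((1-s)/2) * (2 * pi) powr (s - 1) * Z / Gamma (s+2))"
    by (simp add: c_def V_def mult_ac)
  have p: "complex_of_nat (Suc n) powr of_real a = of_real (real (Suc n) powr a)" for n a
    by (subst of_real_of_nat_eq[symmetric], subst powr_of_real) (auto simp del: of_nat_Suc)
  have sm: "summable (\<lambda>m. real (Suc m) powr (s - 1))" using s by (intro summable_Suc_powr) auto
  have "dzeta (1 - of_real s) = of_real Z"
    unfolding dzeta_def Z_def suminf_of_real[OF sm] using p[of _ "s-1"] by (simp del: of_nat_Suc)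
  then show "zeta_num (1 - of_real s) = of_real (-s * Z)"
    using zeta_num_eq_dzeta[of "1 - of_real s"] s by simp
qed

text \<open>The defining product of \<open>\<xi>\<close> with \<open>s / 2 * Gamma (s / 2)\<close>
  merged into \<open>Gamma (s / 2 + 1)\<close> and \<open>(s - 1) \<zeta>(s)\<close> into
  \<open>zeta_num\<close>; no removable singularity is left in \<open>Re s > -1\<close>.\<close>

definition xi_right :: "complex \<Rightarrow> complex" where
  "xi_right s = of_real pi powr (- s / 2) * Gamma (s / 2 + 1) * zeta_num s"

text \<open>Legendre's duplication formula at \<open>(s + 1) / 2\<close> trades
  \<open>Gamma ((s + 1) / 2) * Gamma (s / 2 + 1)\<close> for \<open>Gamma (s + 1)\<close>, which
  cancels against \<open>Gamma (s + 2)\<close>; the powers of 2 and \<open>pi\<close> then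
  balance.\<close>

lemma xi_right_reflect_real:
  fixes s :: real
  assumes s: "-1 < s" "s < 0"
  shows "xi_right (of_real s) = xi_right (1 - of_real s)"
proof -
  define Z where "Z = (\<Sum>m. real (Suc m) powr (s - 1))"
  define a where "a = Gamma ((s+1)/2)"
  define b where "b = Gamma (s/2+1)"
  define c where "c = Gamma ((1-s)/2)"
  have G: "Gamma (s+1) > 0" using s by (intro Gamma_real_pos) auto
  have pos: "x \<notin> \<int>\<^sub>\<le>\<^sub>0" if "x > 0" for x :: real using that by (auto simp: nonpos_Ints_def)
  have g: "Gamma (s+2) = (s+1) * Gamma (s+1)"
    using Gamma_plus1[of "s+1", OF pos] s by (simp add: add_ac)
  have nn: "complex_of_real x \<notin> \<int>\<^sub>\<le>\<^sub>0" if "x > 0" for x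
    using that by (auto simp: nonpos_Ints_def complex_eq_iff)
  have dup: "a * b = 2 powr (-s) * sqrt pi * Gamma (s+1)"
  proof -
    have h: "complex_of_real ((s+1)/2) + 1/2 = of_real (s/2+1)" "2 * complex_of_real ((s+1)/2) = of_real (s+1)"
      by (simp_all add: field_simps)
    have "Gamma (complex_of_real ((s+1)/2)) * Gamma (complex_of_real ((s+1)/2) + 1/2) =
       exp ((1 - 2 * complex_of_real ((s+1)/2)) * of_real (ln 2)) * of_real (sqrt pi) * Gamma (2 * complex_of_real ((s+1)/2))"
      by (rule Gamma_legendre_duplication, rule nn, use s in simp, unfold h, rule nn, use s in simp)
    then have "complex_of_real (a * b) = of_real (exp ((1 - (s+1)) * ln 2) * sqrt pi * Gamma (s+1))"
      unfolding h Gamma_complex_of_real a_def b_def by (simp add: exp_of_real[symmetric])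
    then have "a * b = exp ((1 - (s+1)) * ln 2) * sqrt pi * Gamma (s+1)" by (simp only: of_real_eq_iff)
    then show ?thesis by (simp add: powr_def)
  qed
  have c1: "Gamma ((1 - s)/2 + 1) = (1 - s)/2 * c"
    using Gamma_plus1[of "(1-s)/2", OF pos] s unfolding c_def by simp
  have cp: "complex_of_real pi powr of_real x = of_real (pi powr x)" for x
    by (subst powr_of_real) auto
  have L: "xi_right (of_real s) = of_real (pi powr (-s/2) * b * ((s - 1) * s * (s + 1) * a * c * (2 * pi) powr (s - 1) * Z / Gamma (s+2)))"
    unfolding xi_right_def zeta_num_real_reflect(1)[OF s] a_def b_def c_def Z_def
    using cp[of "-s/2"] Gamma_complex_of_real[of "s/2+1"] by simp
  have R: "xi_right (1 - of_real s) = of_real (pi powr (-(1-s)/2) * ((1-s)/2 * c) * (-s * Z))"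
    unfolding xi_right_def zeta_num_real_reflect(2)[OF s] c1[symmetric] Z_def
    using cp[of "-(1-s)/2"] Gamma_complex_of_real[of "(1-s)/2+1"] by simp
  have pp: "pi powr (-s/2) * (2 * pi) powr (s - 1) * (2 powr (-s) * sqrt pi) = pi powr (-(1-s)/2) / 2"
  proof -
    have "pi powr (-s/2) * (2 * pi) powr (s - 1) * (2 powr (-s) * sqrt pi)
       = (2 powr (s - 1) * 2 powr (-s)) * (pi powr (-s/2) * pi powr (s - 1) * pi powr (1/2))"
      by (simp add: powr_mult powr_half_sqrt mult_ac)
    also have "2 powr (s - 1) * 2 powr (-s) = (2::real) powr (-1)" by (simp only: powr_add[symmetric]) simp
    also have "pi powr (-s/2) * pi powr (s - 1) * pi powr (1/2) = pi powr (-(1-s)/2)"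
      by (simp only: powr_add[symmetric]) (simp add: field_simps)
    finally show ?thesis by (simp add: powr_minus_divide)
  qed
  have "pi powr (-s/2) * b * ((s - 1) * s * (s + 1) * a * c * (2 * pi) powr (s - 1) * Z / Gamma (s+2))
     = pi powr (-s/2) * (2 * pi) powr (s - 1) * (a * b) * ((s - 1) * s * c * Z) * ((s + 1) / Gamma (s+2))"
    by simp
  also have "\<dots> = pi powr (-s/2) * (2 * pi) powr (s - 1) * (2 powr (-s) * sqrt pi) * ((s - 1) * s * c * Z) * (Gamma (s+1) * ((s + 1) / Gamma (s+2)))"
    unfolding dup by (simp add: mult_ac)
  also have "Gamma (s+1) * ((s + 1) / Gamma (s+2)) = 1" unfolding g using G s by (simp add: less_imp_neq[symmetric])
  finally have "pi powr (-s/2) * b * ((s - 1) * s * (s + 1) * a * c * (2 * pi) powr (s - 1) * Z / Gamma (s+2))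
    = pi powr (-(1-s)/2) * ((1-s)/2 * c) * (-s * Z)" unfolding pp by (simp add: field_simps)
  then show ?thesis unfolding L R by (simp only:)
qed

lemma holomorphic_xi_right: "xi_right holomorphic_on {s. Re s > -1}"
proof -
  have "s / 2 + 1 \<notin> \<int>\<^sub>\<le>\<^sub>0" if "Re s > -1" for s :: complex
    using that by (auto simp: nonpos_Ints_def complex_eq_iff)
  then show ?thesis unfolding xi_right_def
    by (intro holomorphic_intros holomorphic_zeta_num) auto
qed

text \<open>The strip is symmetric under \<open>s \<mapsto> 1 - s\<close> and both sides are
  holomorphic on it. The identity theorem applies because the real interval (-1, 0) accumulates at
  its midpoint.\<close>

lemma xi_right_reflect:
  assumes s: "-1 < Re s" "Re s < 2"
  shows "xi_right s = xi_right (1 - s)"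
proof -
  define S where "S = {s. -1 < Re s \<and> Re s < 2}"
  define U where "U = complex_of_real ` {-1<..<0}"
  have "S = {s. Re s > -1} \<inter> {s. Re s < 2}" by (auto simp: S_def)
  then have S: "open S" "connected S"
    by (auto intro!: open_halfspace_Re_gt open_halfspace_Re_lt convex_connected convex_Int convex_halfspace_Re_gt convex_halfspace_Re_lt)
  have "xi_right s - xi_right (1 - s) = 0"
  proof (rule analytic_continuation[of "\<lambda>s. xi_right s - xi_right (1 - s)" S U "- 1/2"])
    have "(\<lambda>s. xi_right (1 - s)) holomorphic_on S"
    proof -
      have a: "(\<lambda>s. 1 - s) holomorphic_on S" by (intro holomorphic_intros)
      have b: "(\<lambda>s. 1 - s) ` S \<subseteq> {s. Re s > -1}" by (auto simp: S_def)
      from holomorphic_on_compose_gen[OF a holomorphic_xi_right b] show ?thesis by (simp add: o_def)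
    qed
    moreover have "xi_right holomorphic_on S"
      by (rule holomorphic_on_subset[OF holomorphic_xi_right]) (auto simp: S_def)
    ultimately show "(\<lambda>s. xi_right s - xi_right (1 - s)) holomorphic_on S" by (intro holomorphic_intros)
    have "(-1/2::real) islimpt {-1<..<0}"
      by (rule interior_limit_point) (auto simp: interior_open)
    then have "complex_of_real (-1/2) islimpt U"
      unfolding U_def islimpt_sequential
      apply (elim exE conjE)
      subgoal for f
        by (intro exI[of _ "\<lambda>n. complex_of_real (f n)"]) (auto intro!: tendsto_of_real simp del: of_real_divide of_real_minus simp: image_iff)
      done
    then show "(-1/2) islimpt U" by simp
    show "xi_right z - xi_right (1 - z) = 0" if "z \<in> U" for z
      using that xi_right_reflect_real by (auto simp: U_def)
  qed (use S s in \<open>auto simp: S_def U_def\<close>)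
  then show ?thesis by simp
qed

section \<open>The xi function\<close>

text \<open>The branches agree on the strip \<open>-1 < Re s < 2\<close> by
  \<open>xi_right_reflect\<close>, and the half planes \<open>Re s > -1\<close> and
  \<open>Re s < 2\<close> cover the plane; this makes the function entire.\<close>

definition xi_fun :: "complex \<Rightarrow> complex" where
  "xi_fun s = (if Re s > -1 then xi_right s else xi_right (1 - s))"

lemma xi_fun_eq_right: "Re s > -1 \<Longrightarrow> xi_fun s = xi_right s"
  by (simp add: xi_fun_def)

lemma xi_fun_reflect: "xi_fun (1 - s) = xi_fun s"
  using xi_right_reflect[of s] by (auto simp: xi_fun_def)

lemma holomorphic_xi_fun: "xi_fun holomorphic_on A"
proof -
  have 1: "xi_fun holomorphic_on {s. Re s > -1}"
    using holomorphic_xi_right by (rule holomorphic_transform) (simp add: xi_fun_def)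
  have 2: "xi_fun holomorphic_on {s. Re s < 2}"
  proof -
    have a: "(\<lambda>s. 1 - s) holomorphic_on {s. Re s < 2}" by (intro holomorphic_intros)
    have b: "(\<lambda>s. 1 - s) ` {s. Re s < 2} \<subseteq> {s. Re s > -1}" by auto
    from holomorphic_on_compose_gen[OF a 1 b] show ?thesis by (simp add: o_def xi_fun_reflect)
  qed
  have "xi_fun holomorphic_on ({s. Re s > -1} \<union> {s. Re s < 2})"
    by (rule holomorphic_on_Un[OF 1 2 open_halfspace_Re_gt open_halfspace_Re_lt])
  then show ?thesis by (rule holomorphic_on_subset) auto
qed

text \<open>Dividing \<open>xi_fun\<close> by its Gamma factor needs no case distinction at the trivial zeros, as \<open>rGamma\<close> is entire.\<close>

definition zeta_fun :: "complex \<Rightarrow> complex" where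
  "zeta_fun s = (if s = 1 then 0 else of_real pi powr (s/2) * rGamma (s/2 + 1) * xi_fun s / (s - 1))"

lemma zeta_fun_eq:
  assumes "Re s > -1" "s \<noteq> 1"
  shows "zeta_fun s = zeta_num s / (s - 1)"
proof -
  have "s / 2 + 1 \<notin> \<int>\<^sub>\<le>\<^sub>0" using assms by (auto simp: nonpos_Ints_def complex_eq_iff)
  then have "rGamma (s/2+1) * Gamma (s/2+1) = 1"
    by (simp add: rGamma_inverse_Gamma Gamma_eq_zero_iff)
  moreover have "of_real pi powr (s/2) * of_real pi powr (-s/2) = (1::complex)"
    by (simp add: powr_add[symmetric])
  moreover have "zeta_fun s = (of_real pi powr (s/2) * of_real pi powr (-s/2)) * (rGamma (s/2+1) * Gamma (s/2+1)) * zeta_num s / (s - 1)"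
    using assms by (simp add: zeta_fun_def xi_fun_eq_right xi_right_def)
  ultimately show ?thesis by simp
qed

lemma holomorphic_zeta_fun: "zeta_fun holomorphic_on - {1}"
proof -
  have "(\<lambda>s. of_real pi powr (s/2) * rGamma (s/2 + 1) * xi_fun s / (s - 1)) holomorphic_on - {1}"
    by (intro holomorphic_intros holomorphic_xi_fun) auto
  then show ?thesis by (rule holomorphic_transform) (auto simp: zeta_fun_def)
qed

lemma zeta_eq: "zeta = zeta_fun"
  unfolding zeta_def
proof (rule the_equality, intro conjI allI impI)
  show "zeta_fun holomorphic_on - {1}" by (rule holomorphic_zeta_fun)
  show "zeta_fun 1 = 0" by (simp add: zeta_fun_def)
  show "zeta_fun s = (\<Sum>n. of_nat (Suc n) powr - s)" if "Re s > 1" for s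
    using that by (subst zeta_fun_eq) (auto simp: zeta_num_eq_dzeta dzeta_def)
next
  fix f :: "complex \<Rightarrow> complex"
  assume f: "f holomorphic_on - {1} \<and> (\<forall>s. 1 < Re s \<longrightarrow> f s = (\<Sum>n. of_nat (Suc n) powr - s)) \<and> f 1 = 0"
  show "f = zeta_fun"
  proof
    fix s
    show "f s = zeta_fun s"
    proof (cases "s = 1")
      case False
      show ?thesis
      proof (rule analytic_continuation_open[of "{s. Re s > 1}" "- {1}" f zeta_fun])
        show "{s. 1 < Re s} \<noteq> {}" by (auto intro!: exI[of _ 2])
        show "connected (- {1::complex})" by (rule connected_punctured_universe) simp
        show "f z = zeta_fun z" if "z \<in> {s. 1 < Re s}" for z
          using that f by (subst zeta_fun_eq) (auto simp: zeta_num_eq_dzeta dzeta_def)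
      qed (use f False in \<open>auto simp: open_halfspace_Re_gt holomorphic_zeta_fun\<close>)
    qed (use f in \<open>auto simp: zeta_fun_def\<close>)
  qed
qed

text \<open>\<open>remove_sings\<close> takes limits, so it suffices that the product agrees with
  the continuous \<open>xi_fun\<close> off the discrete set of poles. Near a given \<open>z\<close>
  the other poles are avoided because a set of integers is closed.\<close>

lemma xi_eq: "xi = xi_fun"
proof
  fix z
  let ?g = "\<lambda>s. 1/2 * s * (s - 1) * of_real pi powr (- s / 2) * Gamma (s / 2) * zeta s"
  have eq: "?g s = xi_fun s" if s: "s \<noteq> 1" "s / 2 \<notin> \<int>\<^sub>\<le>\<^sub>0" for s
  proof -
    have s1: "s / 2 + 1 \<notin> \<int>\<^sub>\<le>\<^sub>0"
      using s(2) plus_one_in_nonpos_Ints_imp by blast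
    have G: "s / 2 * Gamma (s / 2) = Gamma (s / 2 + 1)" by (rule Gamma_plus1[OF s(2), symmetric])
    have nz: "(s - 1) / (s - 1) = 1" using s by simp
    have alg: "1/2 * s * (s - 1) * P * G * (Q * R * X / (s - 1)) = (s / 2 * G) * ((s - 1) / (s - 1)) * R * (P * Q) * X"
      for P G Q R X using s by (simp add: mult_ac)
    have z: "zeta s = of_real pi powr (s / 2) * rGamma (s/2+1) * xi_fun s / (s - 1)"
      using s by (simp add: zeta_eq zeta_fun_def)
    have "?g s = Gamma (s/2 + 1) * 1 * rGamma (s/2+1) * (of_real pi powr (- s / 2) * of_real pi powr (s / 2)) * xi_fun s"
      unfolding z alg nz G ..
    moreover have "Gamma (s/2 + 1) * rGamma (s/2+1) = 1"
      using s1 by (simp add: rGamma_inverse_Gamma Gamma_eq_zero_iff)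
    moreover have "of_real pi powr (- s / 2) * of_real pi powr (s / 2) = (1::complex)"
      by (simp add: powr_add[symmetric])
    ultimately show ?thesis by (simp only:) simp
  qed
  have "remove_sings ?g z = xi_fun z"
  proof (rule remove_sings_eqI)
    have fin: "eventually (\<lambda>s. s \<noteq> 1 \<and> s / 2 \<notin> \<int>\<^sub>\<le>\<^sub>0) (at z)"
    proof -
      have "eventually (\<lambda>s. s / 2 \<notin> \<int>\<^sub>\<le>\<^sub>0) (at z)"
      proof -
        have "closed (\<int>\<^sub>\<le>\<^sub>0 - {z/2})"
          by (rule closed_subset_Ints) (auto dest: nonpos_Ints_Int)
        then have "open (- (\<int>\<^sub>\<le>\<^sub>0 - {z/2}))" by (rule open_Compl)
        then have o: "open ((\<lambda>s. s / 2) -` (- (\<int>\<^sub>\<le>\<^sub>0 - {z/2})))"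
          by (rule open_vimage) (intro continuous_intros; simp)
        have "eventually (\<lambda>s. s \<in> (\<lambda>s. s / 2) -` (- (\<int>\<^sub>\<le>\<^sub>0 - {z/2}))) (at z)"
          by (rule eventually_at_in_open'[OF o]) simp
        moreover have "eventually (\<lambda>s. s \<noteq> z) (at z)" by (rule eventually_neq_at_within)
        ultimately show ?thesis by eventually_elim auto
      qed
      moreover have "eventually (\<lambda>s. s \<noteq> 1) (at z)" by (rule eventually_neq_at_within)
      ultimately show ?thesis by eventually_elim auto
    qed
    have ev: "eventually (\<lambda>s. xi_fun s = ?g s) (at z)"
      using fin by eventually_elim (use eq in auto)
    have "isCont xi_fun z"
      using holomorphic_on_imp_continuous_on[OF holomorphic_xi_fun[of UNIV]] by (simp add: continuous_on_eq_continuous_at)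
    then have "xi_fun \<midarrow>z\<rightarrow> xi_fun z" by (simp add: isCont_def)
    then show "?g \<midarrow>z\<rightarrow> xi_fun z" by (rule Lim_transform_eventually[OF _ ev])
  qed
  then show "xi z = xi_fun z" by (simp add: xi_def)
qed

lemma cnj_xi_right: "Re s > -1 \<Longrightarrow> xi_right (cnj s) = cnj (xi_right s)"
  by (simp add: xi_right_def cnj_zeta_num cnj_powr cnj_Gamma)

lemma xi_fun_nonzero_real:
  assumes "x > 0" shows "xi_fun (of_real x) \<noteq> 0"
proof -
  have "Gamma (of_real x / 2 + 1 :: complex) = of_real (Gamma (x / 2 + 1))"
    using Gamma_complex_of_real[of "x/2+1"] by simp
  moreover have "Gamma (x / 2 + 1) \<noteq> 0" using assms by (intro less_imp_neq[symmetric] Gamma_real_pos) auto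
  moreover obtain v where "v > 0" "zeta_num (of_real x) = of_real v" using zeta_num_real_pos[OF assms] by blast
  ultimately show ?thesis using assms by (simp add: xi_fun_def xi_right_def)
qed

lemma suminf_ennreal_sums:
  assumes "\<And>n. f n \<ge> 0" "f sums v"
  shows "(\<Sum>n. ennreal (f n)) = ennreal v"
  using suminf_ennreal2[OF assms(1) sums_summable[OF assms(2)]] sums_unique[OF assms(2)] by metis

section \<open>Laplace transforms\<close>

text \<open>Absolute integrability is part of the notion, so a value is never the default of a
  divergent integral.\<close>

definition has_laplace :: "(real \<Rightarrow> real) \<Rightarrow> real \<Rightarrow> real \<Rightarrow> bool" where
  "has_laplace f s v \<longleftrightarrow> has_bochner_integral lborel (\<lambda>t. indicator {0..} t * (exp (-(s * t)) * f t)) v"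

lemma has_laplace_cong: "(\<And>t. t \<ge> 0 \<Longrightarrow> f t = g t) \<Longrightarrow> has_laplace f s v \<longleftrightarrow> has_laplace g s v"
  unfolding has_laplace_def by (intro has_bochner_integral_cong) (auto simp: indicator_def)

lemma has_laplace_add: "has_laplace f s v \<Longrightarrow> has_laplace g s w \<Longrightarrow> has_laplace (\<lambda>t. f t + g t) s (v + w)"
  unfolding has_laplace_def by (drule (1) has_bochner_integral_add) (simp add: algebra_simps)

lemma has_laplace_diff: "has_laplace f s v \<Longrightarrow> has_laplace g s w \<Longrightarrow> has_laplace (\<lambda>t. f t - g t) s (v - w)"
  unfolding has_laplace_def by (drule (1) has_bochner_integral_diff) (simp add: algebra_simps)

lemma has_laplace_cmult: "has_laplace f s v \<Longrightarrow> has_laplace (\<lambda>t. c * f t) s (c * v)"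
  unfolding has_laplace_def
  using has_bochner_integral_mult_right[of c lborel "\<lambda>t. indicator {0..} t * (exp (-(s * t)) * f t)" v]
  by (simp add: mult_ac)

text \<open>\<open>f\<close> may have a kink at \<open>a\<close>, as \<open>max 0 (t - a)\<close>
  does; the derivative condition is therefore put on a \<open>g\<close> that agrees with
  \<open>f\<close> from \<open>a\<close> on. As the integrand is nonnegative, a limit of
  \<open>F\<close> at infinity already yields integrability.\<close>

lemma has_laplaceI_antideriv:
  fixes f F :: "real \<Rightarrow> real"
  assumes [measurable]: "f \<in> borel_measurable borel"
    and a: "a \<ge> 0" and nonneg: "\<And>t. t \<ge> a \<Longrightarrow> f t \<ge> 0" and zero: "\<And>t. 0 \<le> t \<Longrightarrow> t < a \<Longrightarrow> f t = 0"
    and F: "\<And>t. t \<ge> a \<Longrightarrow> (F has_real_derivative exp (-(s * t)) * g t) (at t)"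
    and g: "\<And>t. t \<ge> a \<Longrightarrow> f t = g t" and [measurable]: "g \<in> borel_measurable borel"
    and lim: "(F \<longlongrightarrow> T) at_top"
  shows "has_laplace f s (T - F a)"
proof -
  have nn: "0 \<le> exp (-(s * t)) * g t" if "t \<ge> a" for t using nonneg[OF that] g[OF that] by simp
  have 1: "(\<integral>\<^sup>+t. ennreal (exp (-(s * t)) * g t) * indicator {a..} t \<partial>lborel) = ennreal (T - F a)"
    by (rule nn_integral_FTC_atLeast[OF _ F nn lim]) auto
  have eq: "ennreal (exp (-(s * t)) * g t) * indicator {a..} t = ennreal (indicator {0..} t * (exp (-(s * t)) * f t))" for t
    using a zero[of t] g[of t] by (auto simp: indicator_def)
  have FT: "F a \<le> T"
  proof (rule tendsto_lowerbound[OF lim])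
    show "eventually (\<lambda>t. F a \<le> F t) at_top"
      using eventually_ge_at_top[of a]
    proof eventually_elim
      case (elim t)
      then show ?case using F nn by (intro DERIV_nonneg_imp_nondecreasing[of a t F]) blast+
    qed
  qed simp
  show ?thesis unfolding has_laplace_def
  proof (rule has_bochner_integral_nn_integral)
    show "AE t in lborel. 0 \<le> indicator {0..} t * (exp (-(s * t)) * f t)"
      using a nonneg zero by (intro AE_I2) (auto simp: indicator_def not_le intro!: mult_nonneg_nonneg, metis linorder_le_less_linear order_refl)
  qed (use 1 FT in \<open>auto simp: eq\<close>)
qed

lemma has_laplace_exp:
  assumes "c < s" shows "has_laplace (\<lambda>t. exp (c * t)) s (1 / (s - c))"
proof -
  define d where "d = s - c"
  have d: "d > 0" using assms by (simp add: d_def)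
  define F where "F = (\<lambda>t. - (exp (-(d * t)) / d))"
  have "has_laplace (\<lambda>t. exp (c * t)) s (0 - F 0)"
  proof (rule has_laplaceI_antideriv[where g = "\<lambda>t. exp (c * t)" and a = 0 and F = F and T = 0])
    show "(F has_real_derivative exp (-(s * t)) * exp (c * t)) (at t)" for t
    proof -
      have "exp (-(s * t)) * exp (c * t) = exp (-(d * t))"
        by (simp add: exp_add[symmetric] d_def algebra_simps)
      moreover have "(F has_real_derivative exp (-(d * t))) (at t)"
        unfolding F_def using d by (auto intro!: derivative_eq_intros)
      ultimately show ?thesis by simp
    qed
    show "(F \<longlongrightarrow> 0) at_top" unfolding F_def using d by real_asymp
  qed auto
  then show ?thesis by (simp add: F_def d_def)
qed

lemma has_laplace_1: "s > 0 \<Longrightarrow> has_laplace (\<lambda>t. 1) s (1 / s)"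
  using has_laplace_exp[of 0 s] by simp

lemma has_laplace_shift:
  assumes s: "s > 0" and a: "a \<ge> 0"
  shows "has_laplace (\<lambda>t. max 0 (t - a)) s (exp (-(s * a)) / s\<^sup>2)"
proof -
  define p q where "p = 1 / s" and "q = 1 / s\<^sup>2"
  have pq: "p * s = 1" "q * s = p" "p > 0" "q > 0" using s by (auto simp: p_def q_def power2_eq_square)
  define F where "F = (\<lambda>t. - (exp (-(s * t)) * ((t - a) * p + q)))"
  have "has_laplace (\<lambda>t. max 0 (t - a)) s (0 - F a)"
  proof (rule has_laplaceI_antideriv[where g = "\<lambda>t. t - a" and a = a and F = F and T = 0])
    show "(F has_real_derivative exp (-(s * t)) * (t - a)) (at t)" for t
    proof -
      have "(F has_real_derivative - ((exp (-(s * t)) * (- s)) * ((t - a) * p + q) + exp (-(s * t)) * p)) (at t)"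
        unfolding F_def by (auto intro!: derivative_eq_intros)
      also have "- ((exp (-(s * t)) * (- s)) * ((t - a) * p + q) + exp (-(s * t)) * p) = exp (-(s * t)) * ((t - a) * (p * s) + (q * s - p))"
        by (simp add: algebra_simps)
      finally show ?thesis unfolding pq by simp
    qed
    show "(F \<longlongrightarrow> 0) at_top" unfolding F_def using s pq by real_asymp
  qed (use a in auto)
  then show ?thesis by (simp add: F_def q_def)
qed

lemma has_laplace_t: "s > 0 \<Longrightarrow> has_laplace (\<lambda>t. t) s (1 / s\<^sup>2)"
  using has_laplace_shift[of s 0] by (subst has_laplace_cong[where g = "\<lambda>t. max 0 (t - 0)"]) auto

lemma has_laplace_suminf:
  fixes f :: "nat \<Rightarrow> real \<Rightarrow> real"
  assumes f: "\<And>n. has_laplace (f n) s (v n)"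
    and meas: "\<And>n. f n \<in> borel_measurable borel"
    and nonneg: "\<And>n t. t \<ge> 0 \<Longrightarrow> f n t \<ge> 0"
    and sums: "\<And>t. t \<ge> 0 \<Longrightarrow> (\<lambda>n. f n t) sums g t"
    and v: "v sums V"
  shows "has_laplace g s V"
proof -
  note [measurable] = meas
  have v0: "v n \<ge> 0" for n
  proof -
    have "v n = (\<integral>t. indicator {0..} t * (exp (-(s * t)) * f n t) \<partial>lborel)"
      using f[of n] unfolding has_laplace_def has_bochner_integral_iff by simp
    also have "\<dots> \<ge> 0" using nonneg by (intro integral_nonneg_AE AE_I2) (auto simp: indicator_def)
    finally show ?thesis .
  qed
  have nnf: "(\<integral>\<^sup>+t. ennreal (indicator {0..} t * (exp (-(s * t)) * f n t)) \<partial>lborel) = ennreal (v n)" for n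
  proof -
    have "integrable lborel (\<lambda>t. indicator {0..} t * (exp (-(s * t)) * f n t))" "integral\<^sup>L lborel (\<lambda>t. indicator {0..} t * (exp (-(s * t)) * f n t)) = v n"
      using f[of n] by (auto simp: has_laplace_def has_bochner_integral_iff)
    then show ?thesis using nn_integral_eq_integral[of lborel "\<lambda>t. indicator {0..} t * (exp (-(s * t)) * f n t)"] nonneg
      by (auto simp: indicator_def)
  qed
  have g': "(\<Sum>n. f n t) = g t" if "t \<ge> 0" for t using sums[OF that] by (simp add: sums_iff)
  have "(\<integral>\<^sup>+t. ennreal (indicator {0..} t * (exp (-(s * t)) * (\<Sum>n. f n t))) \<partial>lborel)
     = (\<integral>\<^sup>+t. (\<Sum>n. ennreal (indicator {0..} t * (exp (-(s * t)) * f n t))) \<partial>lborel)"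
  proof (intro nn_integral_cong)
    fix t :: real
    show "ennreal (indicator {0..} t * (exp (-(s * t)) * (\<Sum>n. f n t))) = (\<Sum>n. ennreal (indicator {0..} t * (exp (-(s * t)) * f n t)))"
    proof (cases "t \<ge> 0")
      case True
      have "(\<lambda>n. exp (-(s * t)) * f n t) sums (exp (-(s * t)) * (\<Sum>n. f n t))"
        by (rule sums_mult[OF summable_sums[OF sums_summable[OF sums[OF True]]]])
      then have "(\<Sum>n. ennreal (exp (-(s * t)) * f n t)) = ennreal (exp (-(s * t)) * (\<Sum>n. f n t))"
        using nonneg[OF True] by (intro suminf_ennreal_sums) auto
      then show ?thesis using True by simp
    qed auto
  qed
  also have "\<dots> = (\<Sum>n. ennreal (v n))" by (subst nn_integral_suminf) (auto simp: nnf)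
  also have "\<dots> = ennreal V" by (rule suminf_ennreal_sums[OF v0 v])
  finally have I: "(\<integral>\<^sup>+t. ennreal (indicator {0..} t * (exp (-(s * t)) * (\<Sum>n. f n t))) \<partial>lborel) = ennreal V" .
  have V0: "V \<ge> 0" using sums_le[OF v0 sums_zero v] .
  have "has_laplace (\<lambda>t. \<Sum>n. f n t) s V"
    unfolding has_laplace_def
  proof (rule has_bochner_integral_nn_integral[OF _ _ V0 I])
    have "0 \<le> (\<Sum>n. f n t)" if "t \<ge> 0" for t
      by (intro suminf_nonneg nonneg that sums_summable[OF sums[OF that]])
    then show "AE t in lborel. 0 \<le> indicator {0..} t * (exp (-(s * t)) * (\<Sum>n. f n t))"
      by (intro AE_I2) (auto simp: indicator_def)
  qed auto
  then show ?thesis by (subst has_laplace_cong[where g = "\<lambda>t. \<Sum>n. f n t"]) (use g' in auto)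
qed

section \<open>The Laplace transform of Psi\<close>

text \<open>This is \<open>- \<zeta>' = (- \<zeta>'/\<zeta>) \<zeta>\<close> on the level of
  coefficients. The terms \<open>f d n\<close> with \<open>d dvd n\<close> are summed by rows, which
  gives the product, and by columns, where the sum of \<open>mangoldt\<close> over the divisors of
  \<open>n\<close> is \<open>ln n\<close>. Nonnegativity allows the interchange.\<close>

lemma mangoldt_convolution:
  fixes x :: real
  assumes x: "x > 1"
  defines "Z \<equiv> (\<Sum>m. real (Suc m) powr (-x))"
  shows "summable (\<lambda>n. mangoldt n * real n powr (-x))"
    and "(\<lambda>n. ln (real n) * real n powr (-x)) sums ((\<Sum>n. mangoldt n * real n powr (-x)) * Z)"
proof -
  have sZ: "summable (\<lambda>m. real (Suc m) powr (-x))" using x by (intro summable_Suc_powr) auto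
  have sL: "summable (\<lambda>n. ln (real n) * real n powr (-x))"
  proof (rule summable_comparison_test')
    \<comment> \<open>Half of the room above exponent 1 is spent on absorbing the logarithm into
      \<open>n powr e / e\<close>.\<close>
    define e where "e = (x - 1) / 2"
    have e: "e > 0" "-x + e < -1" using x by (auto simp: e_def field_simps)
    show "summable (\<lambda>n. 1 / e * real n powr (-x + e))" using e by (intro summable_mult) (simp add: summable_real_powr_iff)
    show "norm (ln (real n) * real n powr (-x)) \<le> 1 / e * real n powr (-x + e)" if n: "n \<ge> 1" for n
    proof -
      have "ln (real n) * real n powr (-x) \<le> real n powr e / e * real n powr (-x)"
        using n e by (intro mult_right_mono ln_powr_bound) auto
      also have "\<dots> = 1 / e * real n powr (-x + e)" by (simp only: powr_add) simp
      finally show ?thesis using n by simp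
    qed
  qed
  have bd: "norm (mangoldt n * real n powr (-x)) \<le> ln (real n) * real n powr (-x)" if "n \<ge> 1" for n
    using mangoldt_le[of n] that mangoldt_nonneg[of n] by (auto simp: intro!: mult_right_mono)
  show sM: "summable (\<lambda>n. mangoldt n * real n powr (-x))"
    by (rule summable_comparison_test'[OF sL, of 1]) (use bd in auto)
  define f where "f = (\<lambda>d n. if n > 0 \<and> d dvd n then mangoldt d * real n powr (-x) else 0)"
  have f0: "f d n \<ge> 0" for d n by (simp add: f_def mangoldt_nonneg)
  have row: "(\<Sum>n. ennreal (f d n)) = ennreal (mangoldt d * real d powr (-x) * Z)" for d
  proof (cases "d = 0")
    case False
    have g: "strict_mono (\<lambda>m. d * Suc m)" using False by (intro strict_monoI) auto
    have "(\<lambda>m. f d (d * Suc m)) sums (mangoldt d * real d powr (-x) * Z)"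
    proof -
      have "f d (d * Suc m) = mangoldt d * real d powr (-x) * real (Suc m) powr (-x)" for m
      proof -
        have "real (d * Suc m) powr (-x) = real d powr (-x) * real (Suc m) powr (-x)"
          by (simp only: of_nat_mult powr_mult)
        then show ?thesis using False by (simp only: f_def) simp
      qed
      then show ?thesis using summable_sums[OF sZ] unfolding Z_def by (simp only:) (rule sums_mult)
    qed
    moreover have "f d n = 0" if "n \<notin> range (\<lambda>m. d * Suc m)" for n
    proof (rule ccontr)
      assume "f d n \<noteq> 0"
      then have "n > 0" "d dvd n" by (auto simp: f_def split: if_splits)
      then obtain k where "n = d * k" "k > 0" by (auto simp: dvd_def)
      then have "n = d * Suc (k - 1)" by simp
      then show False using that by blast
    qed
    ultimately have "(\<lambda>n. f d n) sums (mangoldt d * real d powr (-x) * Z)"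
      using sums_mono_reindex[OF g, of "f d"] by blast
    then show ?thesis by (rule suminf_ennreal_sums[OF f0])
  next
    case True
    have "f 0 n = 0" for n by (simp add: f_def)
    then show ?thesis using True by simp
  qed
  have col: "(\<Sum>d. ennreal (f d n)) = ennreal (ln (real n) * real n powr (-x))" for n
  proof (cases "n = 0")
    case False
    have "(\<lambda>d. f d n) sums (\<Sum>d | d dvd n. f d n)"
      using False by (intro sums_finite) (auto simp: f_def)
    also have "(\<Sum>d | d dvd n. f d n) = (\<Sum>d | d dvd n. mangoldt d) * real n powr (-x)"
      using False by (simp add: f_def sum_distrib_right)
    also have "(\<Sum>d | d dvd n. mangoldt d) = ln (real n)" using mangoldt_sum[of n, where 'a = real] False by simp
    finally show ?thesis by (rule suminf_ennreal_sums[OF f0])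
  next
    case True
    have "f d 0 = 0" for d by (simp add: f_def)
    then show ?thesis using True by simp
  qed
  have "(\<Sum>d. \<Sum>n. ennreal (f d n)) = (\<Sum>d. \<integral>\<^sup>+n. ennreal (f d n) \<partial>count_space UNIV)"
    by (simp add: nn_integral_count_space_nat)
  also have "\<dots> = (\<integral>\<^sup>+n. (\<Sum>d. ennreal (f d n)) \<partial>count_space UNIV)"
    by (rule nn_integral_suminf[symmetric]) auto
  also have "\<dots> = (\<Sum>n. \<Sum>d. ennreal (f d n))" by (simp add: nn_integral_count_space_nat)
  finally have eq: "(\<Sum>d. ennreal (mangoldt d * real d powr (-x) * Z)) = (\<Sum>n. ennreal (ln (real n) * real n powr (-x)))"
    unfolding row col .
  have Z0: "Z \<ge> 0" unfolding Z_def by (rule suminf_nonneg[OF sZ]) auto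
  have l0: "ln (real n) * real n powr (-x) \<ge> 0" for n by (cases "n = 0") auto
  have sMZ: "summable (\<lambda>d. mangoldt d * real d powr (-x) * Z)" by (rule summable_mult2[OF sM])
  have MZ0: "mangoldt d * real d powr (-x) * Z \<ge> 0" for d using Z0 by (simp add: mangoldt_nonneg)
  have "ennreal (\<Sum>d. mangoldt d * real d powr (-x) * Z) = ennreal (\<Sum>n. ln (real n) * real n powr (-x))"
    using eq suminf_ennreal2[OF MZ0 sMZ] suminf_ennreal2[OF l0 sL] by metis
  then have "(\<Sum>d. mangoldt d * real d powr (-x) * Z) = (\<Sum>n. ln (real n) * real n powr (-x))"
    by (rule ennreal_inj[THEN iffD1, rotated -1]) (intro suminf_nonneg sMZ sL MZ0 l0)+
  then show "(\<lambda>n. ln (real n) * real n powr (-x)) sums ((\<Sum>n. mangoldt n * real n powr (-x)) * Z)"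
    using summable_sums[OF sL] suminf_mult2[OF sM, of Z] by simp
qed

lemma dzeta_has_derivative:
  fixes s :: complex
  assumes s: "Re s > 1"
  shows "(dzeta has_field_derivative (\<Sum>n. - of_real (ln (real (Suc n))) * of_nat (Suc n) powr (-s))) (at s)"
proof -
  define d where "d = (Re s - 1) / 2"
  have d: "d > 0" "1 + d < Re s" using s by (auto simp: d_def field_simps)
  define S where "S = {w. Re w \<ge> 1 + d}"
  let ?f = "\<lambda>n s. of_nat (Suc n) powr (- s) :: complex"
  let ?f' = "\<lambda>n s. - of_real (ln (real (Suc n))) * of_nat (Suc n) powr (-s) :: complex"
  have der: "(?f n has_field_derivative ?f' n w) (at w within S)" for n w
  proof -
    have "of_nat (Suc n) \<noteq> (0::complex)" by (simp del: of_nat_Suc)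
    moreover have "Ln (of_nat (Suc n)) = of_real (ln (real (Suc n)))"
      using Ln_of_real[of "real (Suc n)"] by (simp del: of_nat_Suc)
    ultimately have "((\<lambda>s. of_nat (Suc n) powr (-s)) has_field_derivative (of_real (ln (real (Suc n))) * of_nat (Suc n) powr (-w)) * (-1)) (at w within S)"
      using has_field_derivative_powr_right[of "of_nat (Suc n)" "-w"]
      by (intro DERIV_chain2[where f = "\<lambda>s. of_nat (Suc n) powr s" and g = uminus]) (auto intro!: derivative_eq_intros simp del: of_nat_Suc)
    then show ?thesis by simp
  qed
  have sL: "summable (\<lambda>n. ln (real (Suc n)) * real (Suc n) powr (-(1+d)))"
    using mangoldt_convolution(2)[of "1 + d"] d by (subst summable_Suc_iff) (auto simp: sums_iff)
  have b: "norm (?f' n w) \<le> ln (real (Suc n)) * real (Suc n) powr (-(1+d))" if "w \<in> S" for n w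
    using that by (auto simp: norm_mult norm_Suc_powr S_def simp del: of_nat_Suc intro!: mult_left_mono powr_mono)
  have un: "uniformly_convergent_on S (\<lambda>n w. \<Sum>i<n. ?f' i w)"
    using Weierstrass_m_test[of S ?f', OF b sL] by (auto simp: uniformly_convergent_on_def)
  have cS: "convex S" unfolding S_def by (rule convex_halfspace_Re_ge)
  have "{w. Re w > 1 + d} \<subseteq> interior S" unfolding S_def by (rule interior_maximal) (auto intro: open_halfspace_Re_gt)
  then have si: "s \<in> interior S" using d by auto
  have ss: "summable (\<lambda>n. ?f n s)" using sums_dzeta[OF s] by (simp add: sums_iff)
  have "((\<lambda>w. \<Sum>n. ?f n w) has_field_derivative (\<Sum>n. ?f' n s)) (at s)"
    by (rule has_field_derivative_series'(2)[OF cS der un _ ss si]) (use si interior_subset in blast)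
  then show ?thesis by (simp add: dzeta_def[abs_def])
qed

lemma dzeta_real:
  fixes x :: real
  assumes x: "x > 1"
  shows "dzeta (of_real x) = of_real (\<Sum>m. real (Suc m) powr (-x))" and "(\<Sum>m. real (Suc m) powr (-x)) > 0"
proof -
  have p: "complex_of_nat (Suc n) powr of_real a = of_real (real (Suc n) powr a)" for n a
    by (subst of_real_of_nat_eq[symmetric], subst powr_of_real) (auto simp del: of_nat_Suc)
  have s: "summable (\<lambda>n. real (Suc n) powr (-x))" using x by (intro summable_Suc_powr) auto
  show "dzeta (of_real x) = of_real (\<Sum>n. real (Suc n) powr (-x))"
    unfolding dzeta_def using p[of _ "-x"] by (simp add: suminf_of_real[OF s] del: of_nat_Suc)
  show "(\<Sum>m. real (Suc m) powr (-x)) > 0" by (rule suminf_pos[OF s]) auto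
qed

lemma deriv_dzeta_real:
  fixes x :: real
  assumes x: "x > 1"
  shows "(dzeta has_field_derivative - of_real (\<Sum>n. mangoldt n * real n powr (-x)) * dzeta (of_real x)) (at (of_real x))"
proof -
  have p: "complex_of_nat (Suc n) powr of_real a = of_real (real (Suc n) powr a)" for n a
    by (subst of_real_of_nat_eq[symmetric], subst powr_of_real) (auto simp del: of_nat_Suc)
  let ?V = "(\<Sum>n. mangoldt n * real n powr (-x)) * (\<Sum>m. real (Suc m) powr (-x))"
  have "(\<lambda>n. ln (real (Suc n)) * real (Suc n) powr (-x)) sums ?V"
    using mangoldt_convolution(2)[OF x] by (subst sums_Suc_iff) simp
  then have "(\<lambda>n. - complex_of_real (ln (real (Suc n)) * real (Suc n) powr (-x))) sums (- of_real ?V)"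
    by (intro sums_minus sums_of_real)
  then have "(\<lambda>n. - of_real (ln (real (Suc n))) * of_nat (Suc n) powr (- complex_of_real x)) sums (- of_real ?V)"
    using p[of _ "-x"] by (simp del: of_nat_Suc)
  from sums_unique[OF this] show ?thesis
    using dzeta_has_derivative[of "of_real x"] x dzeta_real(1)[OF x] by simp
qed

section \<open>The series behind the constants of Psi\<close>

lemma inverse_odd_squares_sums: "(\<lambda>m. 1 / (2 * real m + 1)\<^sup>2) sums (pi\<^sup>2 / 8)"
proof -
  define f where "f = (\<lambda>n. 1 / (real n + 1)\<^sup>2)"
  \<comment> \<open>Index \<open>n\<close> stands for the integer \<open>n + 1\<close>, so the odd
    indices collected in \<open>h\<close> carry the even squares, a quarter of the total.\<close>
  have f: "f sums (pi\<^sup>2 / 6)" using inverse_squares_sums by (simp add: f_def add_ac)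
  have m: "strict_mono (\<lambda>m::nat. 2 * m + 1)" "strict_mono (\<lambda>m::nat. 2 * m)" by (auto simp: strict_mono_def)
  have r1: "n \<notin> range (\<lambda>m::nat. 2 * m + 1) \<Longrightarrow> even n" for n using oddE by fastforce
  have r2: "n \<notin> range (\<lambda>m::nat. 2 * m) \<Longrightarrow> odd n" for n using evenE by blast
  define h where "h = (\<lambda>n. if odd n then f n else 0)"
  have "(\<lambda>m. 1/4 * f m) sums (1/4 * (pi\<^sup>2 / 6))" by (rule sums_mult[OF f])
  moreover have "1/4 * f m = h (2 * m + 1)" for m
    by (simp add: f_def h_def field_simps power2_eq_square)
  ultimately have "(\<lambda>m. h (2 * m + 1)) sums (1/4 * (pi\<^sup>2 / 6))" by (simp only:)
  then have "h sums (1/4 * (pi\<^sup>2 / 6))"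
    by (subst (asm) sums_mono_reindex[OF m(1)]) (use r1 in \<open>auto simp: h_def\<close>)
  from sums_diff[OF f this] have "(\<lambda>n. f n - h n) sums (pi\<^sup>2 / 8)" by simp
  then have "(\<lambda>m. f (2 * m) - h (2 * m)) sums (pi\<^sup>2 / 8)"
    by (subst sums_mono_reindex[OF m(2)]) (use r2 in \<open>auto simp: h_def\<close>)
  then show ?thesis by (simp add: f_def h_def)
qed

text \<open>Identifies \<open>const_C\<close> with the Lerch series at \<open>t = 0\<close>. Adding
  Catalan's alternating series to the odd squares cancels the odd indices and doubles the even ones,
  where \<open>2 * (2 * k) + 1 = 4 * (k + 1/4)\<close>; the factor 8 turns \<open>2 / 16\<close>
  into 1.\<close>

lemma const_C_sums: "(\<lambda>n. 1 / (real n + 1/4)\<^sup>2) sums const_C"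
proof -
  have m: "strict_mono (\<lambda>m::nat. 2 * m)" by (auto simp: strict_mono_def)
  have r: "n \<notin> range (\<lambda>m::nat. 2 * m) \<Longrightarrow> odd n" for n using evenE by blast
  have "summable (\<lambda>n. (-1) ^ n / real (2 * n + 1) ^ 2)"
  proof (rule summable_comparison_test')
    show "summable (\<lambda>m. 1 / (2 * real m + 1)\<^sup>2)" using inverse_odd_squares_sums by (rule sums_summable)
    show "norm ((-1) ^ n / real (2 * n + 1) ^ 2) \<le> 1 / (2 * real n + 1)\<^sup>2" if "n \<ge> 0" for n
      by (simp add: norm_divide norm_power power_abs add_ac)
  qed
  then have "(\<lambda>n. (-1) ^ n / real (2 * n + 1) ^ 2) sums catalan_G"
    unfolding catalan_G_def by (rule summable_sums)
  from sums_add[OF inverse_odd_squares_sums this]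
  have s: "(\<lambda>n. 1 / (2 * real n + 1)\<^sup>2 + (-1) ^ n / real (2 * n + 1) ^ 2) sums (pi\<^sup>2 / 8 + catalan_G)" .
  have "(\<lambda>k. 1 / (2 * real (2 * k) + 1)\<^sup>2 + (-1) ^ (2 * k) / real (2 * (2 * k) + 1) ^ 2) sums (pi\<^sup>2 / 8 + catalan_G)"
    by (subst sums_mono_reindex[OF m, of "\<lambda>n. 1 / (2 * real n + 1)\<^sup>2 + (-1) ^ n / real (2 * n + 1) ^ 2"])
       (use r s in \<open>auto simp: add_ac\<close>)
  from sums_mult[OF this, of 8] have
    "(\<lambda>k. 8 * (1 / (2 * real (2 * k) + 1)\<^sup>2 + (-1) ^ (2 * k) / real (2 * (2 * k) + 1) ^ 2)) sums const_C"
    by (simp add: const_C_def)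
  moreover have "8 * (1 / (2 * real (2 * k) + 1)\<^sup>2 + (-1) ^ (2 * k) / real (2 * (2 * k) + 1) ^ 2) = 1 / (real k + 1/4)\<^sup>2" for k
  proof -
    have "real (2 * (2 * k) + 1) = 4 * (real k + 1/4)" "2 * real (2 * k) + 1 = 4 * (real k + 1/4)" by simp_all
    then show ?thesis by (simp only: power_mult_distrib) (simp add: field_simps)
  qed
  ultimately show ?thesis by (simp only:)
qed

lemma lerch_Phi_sums:
  assumes t: "t \<ge> 0"
  shows "(\<lambda>n. exp (-(2 * (real n + 1/4) * t)) / (real n + 1/4)\<^sup>2) sums (exp (- t / 2) * lerch_Phi (exp (- 2 * t)) 2 (1/4))"
proof -
  let ?g = "\<lambda>n. (of_nat n + 1/4) powr (- 2) * exp (- 2 * t) ^ n :: real"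
  have p: "(real n + 1/4) powr (-2) = 1 / (real n + 1/4)\<^sup>2" for n
    by (simp add: powr_minus powr_numeral divide_simps)
  have e: "exp (-t/2) * ?g n = exp (-(2 * (real n + 1/4) * t)) / (real n + 1/4)\<^sup>2" for n
  proof -
    have "exp (-t/2) * exp (- 2 * t) ^ n = exp (-(2 * (real n + 1/4) * t))"
      by (simp add: exp_of_nat_mult[symmetric] exp_add[symmetric] algebra_simps)
    then show ?thesis unfolding p by (simp add: field_simps)
  qed
  have "summable ?g"
  proof (rule summable_comparison_test')
    show "summable (\<lambda>n. 1 / (real n + 1/4)\<^sup>2)" using const_C_sums by (rule sums_summable)
    show "norm (?g n) \<le> 1 / (real n + 1/4)\<^sup>2" if "n \<ge> 0" for n
      using t unfolding p by (simp add: abs_mult power_le_one divide_right_mono)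
  qed
  then have "?g sums lerch_Phi (exp (- 2 * t)) 2 (1/4)" unfolding lerch_Phi_def by (simp add: summable_sums)
  from sums_mult[OF this, of "exp (-t/2)"] show ?thesis unfolding e .
qed

lemma Psi_lerch_sums:
  assumes t: "t \<ge> 0"
  shows "(\<lambda>n. (1 - exp (-(2 * (real n + 1/4) * t))) / (real n + 1/4)\<^sup>2) sums (const_C - exp (- t / 2) * lerch_Phi (exp (- 2 * t)) 2 (1/4))"
  using sums_diff[OF const_C_sums lerch_Phi_sums[OF t]] by (simp add: diff_divide_distrib)

text \<open>Positive parts replace the summation range that depends on \<open>t\<close>, so that the
  transform can be taken term by term.\<close>

lemma Psi_mangoldt_sums:
  assumes t: "t \<ge> 0"
  shows "(\<lambda>n. mangoldt n / sqrt (real n) * max 0 (t - ln (real n))) sums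
    (\<Sum>n | 1 \<le> n \<and> real n \<le> exp t. mangoldt n / sqrt (real n) * (t - ln (real n)))"
proof -
  let ?A = "{n::nat. 1 \<le> n \<and> real n \<le> exp t}"
  have fin: "finite ?A" by (rule finite_subset[of _ "{..nat \<lfloor>exp t\<rfloor>}"]) (auto simp: le_nat_floor)
  have le: "real n \<le> exp t \<longleftrightarrow> ln (real n) \<le> t" if "n \<ge> 1" for n
    using that by (metis exp_le_cancel_iff exp_ln of_nat_0_less_iff less_le_trans zero_less_one)
  have "(\<lambda>n. mangoldt n / sqrt (real n) * max 0 (t - ln (real n))) sums (\<Sum>n\<in>?A. mangoldt n / sqrt (real n) * max 0 (t - ln (real n)))"
  proof (rule sums_finite[OF fin])
    fix n :: nat assume "n \<notin> ?A"
    then have "n = 0 \<or> t < ln (real n)" using le[of n] by (cases "n = 0") auto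
    then show "mangoldt n / sqrt (real n) * max 0 (t - ln (real n)) = 0" by auto
  qed
  also have "(\<Sum>n\<in>?A. mangoldt n / sqrt (real n) * max 0 (t - ln (real n))) = (\<Sum>n\<in>?A. mangoldt n / sqrt (real n) * (t - ln (real n)))"
    by (intro sum.cong refl) (auto simp: le)
  finally show ?thesis .
qed

text \<open>This is \<open>(\<xi>'/\<xi>)(1/2 + s)\<close>, expanded over the factors of \<open>\<xi>\<close>; see \<open>xi_fun_has_derivative_real\<close>.\<close>

definition psi_transform :: "real \<Rightarrow> real" where
  "psi_transform s = 1 / (s - 1/2) + 1 / (s + 1/2) - (\<Sum>n. mangoldt n * real n powr (-(s + 1/2)))
     + (Digamma (1/4 + s/2) - ln pi) / 2"

text \<open>Dividing by \<open>s^2\<close> means integrating twice from 0, and the terms of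
  \<open>\<Psi>\<close> are such integrals. The factor 4 is \<open>1 / c^2\<close> for the exponents
  \<open>c = 1/2\<close> and \<open>c = -1/2\<close>; a prime power gives the ramp starting at
  \<open>ln n\<close>; and the Lerch part transforms into
  \<open>Digamma (1/4 + s/2) - Digamma (1/4)\<close>, to which the linear term adds the value at
  1/4.\<close>

lemma has_laplace_Psi:
  assumes s: "s > 1/2"
  shows "has_laplace Psi s (psi_transform s / s\<^sup>2)"
proof -
  define M where "M = (\<Sum>n. mangoldt n * real n powr (-(s + 1/2)))"
  define K where "K = Digamma (1/4) - ln pi"
  define Sm where "Sm = (\<lambda>t. \<Sum>n | 1 \<le> n \<and> real n \<le> exp t. mangoldt n / sqrt (real n) * (t - ln (real n)))"
  define R where "R = (\<lambda>t. const_C - exp (- t / 2) * lerch_Phi (exp (- 2 * t)) 2 (1/4))"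
  have s0: "s > 0" using s by simp
  have A: "has_laplace (\<lambda>t. 4 * (exp (1/2 * t) + exp (-1/2 * t) - 2 * 1)) s (4 * (1 / (s - 1/2) + 1 / (s - (-1/2)) - 2 * (1 / s)))"
    using s by (intro has_laplace_cmult has_laplace_diff has_laplace_add has_laplace_exp has_laplace_1) auto
  have B: "has_laplace Sm s (M / s\<^sup>2)"
  proof (rule has_laplace_suminf)
    show "has_laplace (\<lambda>t. mangoldt n / sqrt (real n) * max 0 (t - ln (real n))) s (mangoldt n / sqrt (real n) * (exp (-(s * ln (real n))) / s\<^sup>2))" for n
    proof (cases "n = 0")
      case True
      then show ?thesis using has_laplace_cmult[OF has_laplace_1[OF s0], of 0] by simp
    next
      case False
      then show ?thesis using s0 by (intro has_laplace_cmult has_laplace_shift) auto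
    qed
    show "(\<lambda>n. mangoldt n / sqrt (real n) * max 0 (t - ln (real n))) sums Sm t" if "t \<ge> 0" for t
      unfolding Sm_def by (rule Psi_mangoldt_sums[OF that])
    have "(\<lambda>n. mangoldt n * real n powr (-(s + 1/2)) / s\<^sup>2) sums (M / s\<^sup>2)"
      unfolding M_def using mangoldt_convolution(1)[of "s + 1/2"] s by (intro sums_divide summable_sums) auto
    moreover have "mangoldt n * real n powr (-(s + 1/2)) / s\<^sup>2 = mangoldt n / sqrt (real n) * (exp (-(s * ln (real n))) / s\<^sup>2)" for n
    proof (cases "n = 0")
      case False
      have "real n powr (-(s + 1/2)) = real n powr (-s) * real n powr (-(1/2))" by (simp only: powr_add[symmetric]) simp
      also have "real n powr (-(1/2)) = 1 / sqrt (real n)" by (simp add: powr_minus powr_half_sqrt divide_simps)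
      also have "real n powr (-s) = exp (-(s * ln (real n)))" using False by (simp add: powr_def)
      finally show ?thesis by simp
    qed auto
    ultimately show "(\<lambda>n. mangoldt n / sqrt (real n) * (exp (-(s * ln (real n))) / s\<^sup>2)) sums (M / s\<^sup>2)" by (simp only:)
  qed (auto simp: mangoldt_nonneg)
  have C: "has_laplace R s (2 / s\<^sup>2 * (Digamma (1/4 + s/2) - Digamma (1/4)))"
  proof (rule has_laplace_suminf)
    show "has_laplace (\<lambda>t. (1 / (real n + 1/4)\<^sup>2) * (1 - exp ((-(2 * (real n + 1/4))) * t))) s
       ((1 / (real n + 1/4)\<^sup>2) * (1 / s - 1 / (s - (-(2 * (real n + 1/4))))))" for n
      using s0 by (intro has_laplace_cmult has_laplace_diff has_laplace_1 has_laplace_exp) auto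
    show "(\<lambda>n. 1 / (real n + 1/4)\<^sup>2 * (1 - exp ((-(2 * (real n + 1/4))) * t))) sums R t" if "t \<ge> 0" for t
    proof -
      have "1 / (real n + 1/4)\<^sup>2 * (1 - exp ((-(2 * (real n + 1/4))) * t)) = (1 - exp (-(2 * (real n + 1/4) * t))) / (real n + 1/4)\<^sup>2" for n
        by (simp only: mult_minus_left) simp
      then show ?thesis using Psi_lerch_sums[OF that] by (simp only: R_def)
    qed
    show "0 \<le> 1 / (real n + 1/4)\<^sup>2 * (1 - exp ((-(2 * (real n + 1/4))) * t))" if "t \<ge> 0" for n t
      using that by (intro mult_nonneg_nonneg) (auto intro!: mult_nonpos_nonneg)
    have d: "(\<lambda>k. inverse (of_nat (Suc k)) - inverse (w + of_nat k)) sums (Digamma w + euler_mascheroni)"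
      if "w \<noteq> 0" for w :: real
      using summable_Digamma[OF that] by (simp add: Digamma_def summable_sums)
    have "1/4 + s/2 \<noteq> 0" using s by simp
    from sums_mult[OF sums_diff[OF d[OF this] d[of "1/4"]], of "2 / s\<^sup>2"]
    have "(\<lambda>n. 2 / s\<^sup>2 * (inverse (1/4 + real n) - inverse (1/4 + s/2 + real n))) sums (2 / s\<^sup>2 * (Digamma (1/4 + s/2) - Digamma (1/4)))"
      by simp
    moreover have "2 / s\<^sup>2 * (inverse (1/4 + real n) - inverse (1/4 + s/2 + real n)) = (1 / (real n + 1/4)\<^sup>2) * (1 / s - 1 / (s - (-(2 * (real n + 1/4)))))" for n
    proof -
      define a where "a = real n + 1/4"
      have a: "a > 0" "a + s / 2 > 0" "s + 2 * a > 0" using s by (auto simp: a_def)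
      have "2 / s\<^sup>2 * (inverse a - inverse (a + s/2)) = 1 / a\<^sup>2 * (1 / s - 1 / (s + 2 * a))"
        using a s0 by (simp add: divide_simps) (simp add: algebra_simps power2_eq_square)
      moreover have "1/4 + real n = a" "1/4 + s/2 + real n = a + s/2" "s - (-(2 * (real n + 1/4))) = s + 2 * a" by (auto simp: a_def)
      ultimately show ?thesis by (simp only: a_def[symmetric])
    qed
    ultimately show "(\<lambda>n. (1 / (real n + 1/4)\<^sup>2) * (1 / s - 1 / (s - (-(2 * (real n + 1/4)))))) sums (2 / s\<^sup>2 * (Digamma (1/4 + s/2) - Digamma (1/4)))"
      by (simp only:)
  qed auto
  have "has_laplace (\<lambda>t. 4 * (exp (1/2 * t) + exp (-1/2 * t) - 2 * 1) - Sm t + K / 2 * t + 1/4 * R t) s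
    (4 * (1 / (s - 1/2) + 1 / (s - (-1/2)) - 2 * (1 / s)) - M / s\<^sup>2 + K / 2 * (1 / s\<^sup>2) + 1/4 * (2 / s\<^sup>2 * (Digamma (1/4 + s/2) - Digamma (1/4))))"
    by (intro has_laplace_add has_laplace_diff A B C has_laplace_cmult has_laplace_t s0)
  also have "(4 * (1 / (s - 1/2) + 1 / (s - (-1/2)) - 2 * (1 / s)) - M / s\<^sup>2 + K / 2 * (1 / s\<^sup>2) + 1/4 * (2 / s\<^sup>2 * (Digamma (1/4 + s/2) - Digamma (1/4))))
    = psi_transform s / s\<^sup>2"
  proof -
    have nz: "s - 1/2 \<noteq> 0" "s + 1/2 \<noteq> 0" "s \<noteq> 0" using s by auto
    have "4 * (1 / (s - 1/2) + 1 / (s - (-1/2)) - 2 * (1 / s)) = (1 / (s - 1/2) + 1 / (s + 1/2)) / s\<^sup>2"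
      using nz by (simp add: divide_simps) (simp add: algebra_simps power2_eq_square)
    then show ?thesis by (simp add: psi_transform_def M_def K_def add_divide_distrib diff_divide_distrib)
  qed
  finally show ?thesis
    by (subst has_laplace_cong) (auto simp: Psi_def Psi_nonneg_def Sm_def K_def R_def)
qed

lemma xi_fun_has_derivative_real:
  assumes s: "s > 1/2"
  shows "(xi_fun has_field_derivative of_real (psi_transform s) * xi_fun (1/2 + of_real s)) (at (1/2 + of_real s))"
proof -
  define x where "x = s + 1/2"
  have x: "x > 1" "1/2 + complex_of_real s = of_real x" using s by (auto simp: x_def)
  define M where "M = (\<Sum>n. mangoldt n * real n powr (-x))"
  define h where "h = (\<lambda>z. of_real pi powr (- z / 2) * Gamma (z / 2 + 1) * ((z - 1) * dzeta z))"
  have nn: "of_real x / 2 + 1 \<notin> (\<int>\<^sub>\<le>\<^sub>0 :: complex set)" using x by (auto simp: nonpos_Ints_def complex_eq_iff)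
  have Lnpi: "Ln (of_real pi) = of_real (ln pi)" by (rule Ln_of_real) simp
  define P where "P = of_real pi powr (- complex_of_real x / 2)"
  define G where "G = Gamma (complex_of_real x / 2 + 1)"
  define D where "D = dzeta (of_real x)"
  have d1: "((\<lambda>z. of_real pi powr (- z / 2)) has_field_derivative (of_real (ln pi) * P) * (-1/2)) (at (of_real x))"
    unfolding P_def using has_field_derivative_powr_right[of "of_real pi" "- complex_of_real x / 2"] Lnpi
    by (intro DERIV_chain2[where f = "\<lambda>s. of_real pi powr s" and g = "\<lambda>z. -z/2"]) (auto intro!: derivative_eq_intros)
  have d2: "((\<lambda>z. Gamma (z / 2 + 1)) has_field_derivative (G * Digamma (of_real x / 2 + 1)) * (1/2)) (at (of_real x))"
    unfolding G_def using nn
    by (intro DERIV_chain2[where f = Gamma and g = "\<lambda>z. z/2+1"]) (auto intro!: derivative_eq_intros)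
  have d3: "((\<lambda>z. (z - 1) * dzeta z) has_field_derivative D + (of_real x - 1) * (- of_real M * D)) (at (of_real x))"
    unfolding D_def M_def by (rule derivative_eq_intros refl deriv_dzeta_real[OF x(1)] | simp)+
  have dh: "(h has_field_derivative ((of_real (ln pi) * P) * (-1/2) * G + (G * Digamma (of_real x / 2 + 1)) * (1/2) * P) * ((of_real x - 1) * D)
     + (D + (of_real x - 1) * (- of_real M * D)) * (P * G)) (at (of_real x))"
    unfolding h_def P_def G_def D_def by (rule DERIV_mult[OF DERIV_mult[OF d1[unfolded P_def] d2[unfolded G_def]] d3[unfolded D_def]])
  have Dg: "Digamma (complex_of_real x / 2 + 1) = of_real (Digamma (1/4 + s/2) + 1 / x * 2)"
  proof -
    have "Digamma (complex_of_real x / 2 + 1) = Digamma (of_real (x/2+1))" by simp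
    also have "\<dots> = of_real (Digamma (x/2+1))" by (rule Polygamma_of_real) (use x in auto)
    \<comment> \<open>Half of the extra term is \<open>1 / x\<close>, the summand
      \<open>1 / (s + 1/2)\<close> of \<open>psi_transform\<close>.\<close>
    also have "Digamma (x/2+1) = Digamma (x/2) + 1 / (x/2)" by (rule Digamma_plus1) (use x in auto)
    also have "x / 2 = 1/4 + s/2" by (simp add: x_def field_simps)
    finally show ?thesis by (simp add: x_def field_simps)
  qed
  have xn: "complex_of_real x - 1 \<noteq> 0" using x by auto
  have pt: "psi_transform s = 1 / (x - 1) + 1 / x - M + (Digamma (1/4 + s/2) - ln pi) / 2"
    by (simp add: psi_transform_def x_def M_def algebra_simps)
  have val: "((of_real (ln pi) * P) * (-1/2) * G + (G * Digamma (of_real x / 2 + 1)) * (1/2) * P) * ((of_real x - 1) * D)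
     + (D + (of_real x - 1) * (- of_real M * D)) * (P * G) = of_real (psi_transform s) * h (of_real x)"
    unfolding Dg pt h_def P_def[symmetric] G_def[symmetric] D_def[symmetric] using xn x
    by (simp add: field_simps)
  have eq: "h z = xi_fun z" if "z \<in> {z. Re z > 1}" for z
    using that by (simp add: h_def xi_fun_def xi_right_def zeta_num_eq_dzeta)
  have "(xi_fun has_field_derivative of_real (psi_transform s) * h (of_real x)) (at (of_real x))"
    by (rule has_field_derivative_transform_within_open[OF dh[unfolded val] open_halfspace_Re_gt[of 1]]) (use x eq in auto)
  then show ?thesis unfolding x(2) using eq[of "of_real x"] x by simp
qed

section \<open>Landau's theorem\<close>

definition lap_kernel :: "(real \<Rightarrow> real) \<Rightarrow> real \<Rightarrow> real" where
  "lap_kernel f t = indicator {0..} t * f t"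

definition laplace :: "(real \<Rightarrow> real) \<Rightarrow> complex \<Rightarrow> complex" where
  "laplace f s = (\<integral>t. exp (-(s * of_real t)) * of_real (lap_kernel f t) \<partial>lborel)"

definition lap_integrable :: "(real \<Rightarrow> real) \<Rightarrow> real \<Rightarrow> bool" where
  "lap_integrable f \<sigma> \<longleftrightarrow> integrable lborel (\<lambda>t. exp (-(\<sigma> * t)) * lap_kernel f t)"

text \<open>The \<open>k\<close>-th Taylor coefficient of \<open>laplace f\<close> at
  \<open>s\<close>, by differentiation under the integral; see
  \<open>laplace_power_series\<close>.\<close>

definition laplace_coeff :: "(real \<Rightarrow> real) \<Rightarrow> complex \<Rightarrow> nat \<Rightarrow> complex" where
  "laplace_coeff f s k = (\<integral>t. exp (-(s * of_real t)) * ((- of_real t) ^ k / fact k) * of_real (lap_kernel f t) \<partial>lborel)"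

lemma has_laplace_imp_integrable: "has_laplace f s v \<Longrightarrow> lap_integrable f s"
  by (simp add: has_laplace_def lap_integrable_def lap_kernel_def has_bochner_integral_iff mult_ac)

lemma has_laplace_imp_laplace:
  assumes "has_laplace f s v" shows "laplace f (of_real s) = of_real v"
proof -
  have "laplace f (of_real s) = (\<integral>t. of_real (indicator {0..} t * (exp (-(s * t)) * f t)) \<partial>lborel)"
    unfolding laplace_def lap_kernel_def by (intro Bochner_Integration.integral_cong) (auto simp: exp_of_real[symmetric] indicator_def)
  also have "\<dots> = of_real (\<integral>t. indicator {0..} t * (exp (-(s * t)) * f t) \<partial>lborel)"
    by (rule integral_complex_of_real)
  finally show ?thesis using assms by (simp add: has_laplace_def has_bochner_integral_iff)
qed

context
  fixes f :: "real \<Rightarrow> real"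
  assumes meas [measurable]: "f \<in> borel_measurable borel"
    and nonneg: "\<And>t. t \<ge> 0 \<Longrightarrow> f t \<ge> 0"
begin

lemma lap_kernel_nonneg: "lap_kernel f t \<ge> 0"
  using nonneg by (auto simp: lap_kernel_def indicator_def)

lemma lap_kernel_measurable [measurable]: "lap_kernel f \<in> borel_measurable borel"
  unfolding lap_kernel_def[abs_def] by measurable

lemma lap_kernel_neg: "t < 0 \<Longrightarrow> lap_kernel f t = 0"
  by (simp add: lap_kernel_def)

lemma lap_integrable_mono:
  assumes "lap_integrable f \<sigma>" "\<sigma> \<le> \<tau>" shows "lap_integrable f \<tau>"
  unfolding lap_integrable_def
proof (rule Bochner_Integration.integrable_bound[OF assms(1)[unfolded lap_integrable_def]])
  show "AE t in lborel. norm (exp (-(\<tau> * t)) * lap_kernel f t) \<le> norm (exp (-(\<sigma> * t)) * lap_kernel f t)"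
  proof (intro AE_I2)
    fix t :: real
    show "norm (exp (-(\<tau> * t)) * lap_kernel f t) \<le> norm (exp (-(\<sigma> * t)) * lap_kernel f t)"
    proof (cases "t \<ge> 0")
      case True
      then show ?thesis using lap_kernel_nonneg[of t] assms(2)
        by (auto simp: abs_mult intro!: mult_right_mono)
    qed (auto simp: lap_kernel_neg)
  qed
qed measurable

lemma laplace_term_bound:
  assumes "norm d \<le> \<rho>" "\<rho> \<le> Re s - \<sigma>"
  shows "norm (exp (-(s * of_real t)) * ((- of_real t) ^ k / fact k) * of_real (lap_kernel f t) * d ^ k)
     \<le> exp (-(Re s * t)) * ((\<rho> * t) ^ k / fact k) * lap_kernel f t"
proof (cases "t \<ge> 0")
  case True
  have "norm d ^ k \<le> \<rho> ^ k" using assms by (intro power_mono) auto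
  then have "exp (-(Re s * t)) * (t ^ k / fact k) * lap_kernel f t * norm d ^ k \<le> exp (-(Re s * t)) * (t ^ k / fact k) * lap_kernel f t * \<rho> ^ k"
    using True lap_kernel_nonneg[of t] by (intro mult_left_mono) auto
  then show ?thesis using True lap_kernel_nonneg[of t]
    by (simp add: norm_mult norm_divide norm_power power_mult_distrib mult_ac)
qed (auto simp: lap_kernel_neg)

lemma laplace_partial_bound:
  assumes "0 \<le> \<rho>" "\<rho> \<le> x - \<sigma>"
  shows "(\<Sum>k<n. exp (-(x * t)) * ((\<rho> * t) ^ k / fact k) * lap_kernel f t) \<le> exp (-(\<sigma> * t)) * lap_kernel f t"
proof (cases "t \<ge> 0")
  case True
  have s: "(\<lambda>k. (\<rho> * t) ^ k / fact k) sums exp (\<rho> * t)"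
    using exp_converges[of "\<rho> * t"] by (simp add: field_simps)
  have "(\<Sum>k<n. (\<rho> * t) ^ k / fact k) \<le> exp (\<rho> * t)"
    using sum_le_suminf[of "\<lambda>k. (\<rho> * t) ^ k / fact k" "{..<n}"] s assms True by (auto simp: sums_iff)
  then have "exp (-(x * t)) * (\<Sum>k<n. (\<rho> * t) ^ k / fact k) * lap_kernel f t \<le> exp (-(x * t)) * exp (\<rho> * t) * lap_kernel f t"
    using lap_kernel_nonneg[of t] by (intro mult_right_mono mult_left_mono) auto
  also have "\<dots> \<le> exp (-(\<sigma> * t)) * lap_kernel f t"
  proof (intro mult_right_mono lap_kernel_nonneg)
    have "\<rho> * t \<le> (x - \<sigma>) * t" using assms True by (intro mult_right_mono) auto
    then show "exp (-(x * t)) * exp (\<rho> * t) \<le> exp (-(\<sigma> * t))" by (simp add: exp_add[symmetric] algebra_simps)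
  qed
  finally show ?thesis by (simp add: sum_distrib_left sum_distrib_right)
qed (auto simp: lap_kernel_neg)

text \<open>Expand \<open>exp (-((z - s) * t))\<close> and integrate termwise. The absolute values
  sum to at most \<open>exp (\<rho> * t)\<close>, which for
  \<open>\<rho> \<le> Re s - \<sigma>\<close> lifts the weight at \<open>Re s\<close> to at most the
  weight at \<open>\<sigma>\<close>, integrable by assumption.\<close>

lemma laplace_power_series:
  assumes int: "lap_integrable f \<sigma>" and d: "norm (z - s) \<le> Re s - \<sigma>"
  shows "(\<lambda>k. laplace_coeff f s k * (z - s) ^ k) sums laplace f z"
proof -
  define \<rho> where "\<rho> = norm (z - s)"
  have \<rho>: "0 \<le> \<rho>" "norm (z - s) \<le> \<rho>" "\<rho> \<le> Re s - \<sigma>" using d by (auto simp: \<rho>_def)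
  let ?g = "\<lambda>k t. exp (-(s * of_real t)) * ((- of_real t) ^ k / fact k) * of_real (lap_kernel f t) * (z - s) ^ k"
  let ?b = "\<lambda>k t. exp (-(Re s * t)) * ((\<rho> * t) ^ k / fact k) * lap_kernel f t"
  note I = int[unfolded lap_integrable_def]
  have b0: "?b k t \<ge> 0" for k t
    using \<rho>(1) lap_kernel_nonneg[of t] by (cases "t \<ge> 0") (auto simp: lap_kernel_neg)
  have bnd: "norm (?g k t) \<le> ?b k t" for k t by (rule laplace_term_bound[OF \<rho>(2,3)])
  have part: "(\<Sum>k<n. ?b k t) \<le> exp (-(\<sigma> * t)) * lap_kernel f t" for n t by (rule laplace_partial_bound[OF \<rho>(1,3)])
  have single: "?b k t \<le> exp (-(\<sigma> * t)) * lap_kernel f t" for k t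
  proof -
    have "?b k t \<le> (\<Sum>j<Suc k. ?b j t)" using b0 by (intro member_le_sum[of k "{..<Suc k}" "\<lambda>j. ?b j t"]) auto
    then show ?thesis using part[of t "Suc k"] by (rule order_trans)
  qed
  have ib: "integrable lborel (?b k)" for k
  proof (rule Bochner_Integration.integrable_bound[OF I])
    show "AE t in lborel. norm (?b k t) \<le> norm (exp (-(\<sigma> * t)) * lap_kernel f t)"
    proof (intro AE_I2)
      fix t
      have "norm (?b k t) = ?b k t" unfolding real_norm_def by (rule abs_of_nonneg[OF b0])
      also have "\<dots> \<le> exp (-(\<sigma> * t)) * lap_kernel f t" by (rule single)
      also have "\<dots> \<le> norm (exp (-(\<sigma> * t)) * lap_kernel f t)" by simp
      finally show "norm (?b k t) \<le> norm (exp (-(\<sigma> * t)) * lap_kernel f t)" .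
    qed
  qed measurable
  have ig: "integrable lborel (?g k)" for k
  proof (rule Bochner_Integration.integrable_bound[OF ib[of k]])
    show "AE t in lborel. norm (?g k t) \<le> norm (?b k t)"
      using bnd b0 by (intro AE_I2) (metis abs_of_nonneg real_norm_def)
  qed measurable
  have sb: "summable (\<lambda>k. norm (?g k t))" for t
  proof (rule summableI_nonneg_bounded)
    show "(\<Sum>k<n. norm (?g k t)) \<le> exp (-(\<sigma> * t)) * lap_kernel f t" for n
      by (rule order_trans[OF sum_mono part]) (rule bnd)
  qed simp
  have sI: "summable (\<lambda>k. \<integral>t. norm (?g k t) \<partial>lborel)"
  proof (rule summableI_nonneg_bounded)
    fix n
    have "(\<Sum>k<n. \<integral>t. norm (?g k t) \<partial>lborel) = (\<integral>t. (\<Sum>k<n. norm (?g k t)) \<partial>lborel)"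
      by (rule Bochner_Integration.integral_sum[symmetric]) (intro integrable_norm ig)
    also have "\<dots> \<le> (\<integral>t. exp (-(\<sigma> * t)) * lap_kernel f t \<partial>lborel)"
    proof (rule integral_mono)
      show "integrable lborel (\<lambda>t. \<Sum>k<n. norm (?g k t))" by (intro Bochner_Integration.integrable_sum integrable_norm ig)
      show "(\<Sum>k<n. norm (?g k t)) \<le> exp (-(\<sigma> * t)) * lap_kernel f t" for t
        by (rule order_trans[OF sum_mono part]) (rule bnd)
    qed (rule I)
    finally show "(\<Sum>k<n. \<integral>t. norm (?g k t) \<partial>lborel) \<le> (\<integral>t. exp (-(\<sigma> * t)) * lap_kernel f t \<partial>lborel)" .
  qed simp
  have "(\<lambda>k. integral\<^sup>L lborel (?g k)) sums (\<integral>t. (\<Sum>k. ?g k t) \<partial>lborel)"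
    by (rule sums_integral[OF ig _ sI]) (use sb in auto)
  moreover have "integral\<^sup>L lborel (?g k) = laplace_coeff f s k * (z - s) ^ k" for k
    unfolding laplace_coeff_def by (rule integral_mult_left_zero)
  moreover have "(\<Sum>k. ?g k t) = exp (-(z * of_real t)) * of_real (lap_kernel f t)" for t
  proof -
    have "(\<lambda>k. (-((z - s) * of_real t)) ^ k /\<^sub>R fact k) sums exp (-((z - s) * of_real t))"
      by (rule exp_converges)
    then have "(\<lambda>k. exp (-(s * of_real t)) * ((-((z - s) * of_real t)) ^ k /\<^sub>R fact k) * of_real (lap_kernel f t)) sums
       (exp (-(s * of_real t)) * exp (-((z - s) * of_real t)) * of_real (lap_kernel f t))"
      by (intro sums_mult sums_mult2)
    moreover have "exp (-(s * of_real t)) * ((-((z - s) * of_real t)) ^ k /\<^sub>R fact k) * of_real (lap_kernel f t) = ?g k t" for k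
      by (simp add: scaleR_conv_of_real power_mult_distrib power_minus[of "_ * _"] power_minus[of "of_real t"] divide_inverse of_real_inverse mult_ac)
    moreover have "exp (-(s * of_real t)) * exp (-((z - s) * of_real t)) = exp (-(z * of_real t))"
      by (simp add: exp_add[symmetric] algebra_simps)
    ultimately show ?thesis by (simp add: sums_iff)
  qed
  ultimately show ?thesis by (simp add: laplace_def)
qed

lemma holomorphic_laplace:
  assumes "lap_integrable f \<sigma>"
  shows "laplace f holomorphic_on {s. Re s > \<sigma>}"
proof -
  have "laplace f analytic_on ball s (Re s - \<sigma>)" for s
    by (rule power_series_analytic[where a = "laplace_coeff f s"], rule laplace_power_series[OF assms])
       (auto simp: dist_norm norm_minus_commute)
  then have "laplace f analytic_on {s}" if "Re s > \<sigma>" for s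
    using that analytic_on_subset[of "laplace f" "ball s (Re s - \<sigma>)" "{s}"] by auto
  then have "laplace f analytic_on {s. Re s > \<sigma>}" by (subst analytic_on_analytic_at) auto
  then show ?thesis by (rule analytic_imp_holomorphic)
qed

text \<open>Landau's argument: the Taylor coefficients of the transform at \<open>s\<close> alternate in sign, so at \<open>s - \<rho>\<close> the Taylor series
  of the extension has nonnegative terms, and Tonelli turns its convergence into integrability.\<close>

lemma lap_integrable_extend:
  assumes int: "lap_integrable f \<sigma>" and s: "\<sigma> < s"
    and G: "G holomorphic_on ball (of_real s) r" and r: "\<rho> < r" "\<rho> \<ge> 0"
    and eq: "\<And>z. Re z > \<sigma> \<Longrightarrow> z \<in> ball (of_real s) r \<Longrightarrow> G z = laplace f z"
  shows "lap_integrable f (s - \<rho>)"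
proof -
  define b where "b = laplace_coeff f (of_real s)"
  define F where "F = Abs_fps b"
  have r0: "r > 0" using r by simp
  define d where "d = min (s - \<sigma>) r"
  have d: "d > 0" "d \<le> s - \<sigma>" "d \<le> r" using s r0 by (auto simp: d_def)
  have ser: "(\<lambda>k. b k * w ^ k) sums G (of_real s + w)" if "norm w < d" for w
  proof -
    have "\<bar>Re w\<bar> < d" using that abs_Re_le_cmod[of w] by simp
    then have "G (of_real s + w) = laplace f (of_real s + w)" using that d by (intro eq) (auto simp: dist_norm)
    then show ?thesis using laplace_power_series[OF int, of "of_real s + w" "of_real s"] that d by (simp add: b_def)
  qed
  have "(\<lambda>w. G (of_real s + w)) has_fps_expansion F"
    unfolding has_fps_expansion_def
  proof
    have "norm (complex_of_real (d/2)) \<le> conv_radius b"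
      using ser[of "of_real (d/2)"] d by (intro conv_radius_geI) (auto simp: sums_iff)
    then show "fps_conv_radius F > 0" using d by (auto simp: F_def fps_conv_radius_def less_le_trans[rotated])
    have "eventually (\<lambda>w. w \<in> ball 0 d) (nhds (0::complex))"
      by (rule eventually_nhds_in_open) (use d in auto)
    then show "eventually (\<lambda>w. eval_fps F w = G (of_real s + w)) (nhds 0)"
      by eventually_elim (use ser in \<open>auto simp: eval_fps_def F_def sums_iff\<close>)
  qed
  moreover have "(\<lambda>w. G (of_real s + w)) holomorphic_on eball 0 (ereal r)"
  proof -
    have "(\<lambda>w. complex_of_real s + w) holomorphic_on ball 0 r" by (intro holomorphic_intros)
    moreover have "(\<lambda>w. complex_of_real s + w) ` ball 0 r \<subseteq> ball (of_real s) r" by (auto simp: dist_norm norm_minus_commute)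
    ultimately have "(G \<circ> (\<lambda>w. of_real s + w)) holomorphic_on ball 0 r" by (rule holomorphic_on_compose_gen[OF _ G])
    then show ?thesis by (simp add: o_def)
  qed
  \<comment> \<open>The Taylor series, identified with the transform only near the centre, converges
    on the whole disc where \<open>G\<close> is holomorphic, hence also at \<open>- \<rho>\<close>,
    possibly left of \<open>\<sigma>\<close>.\<close>
  ultimately have "(\<lambda>n. fps_nth F n * (- of_real \<rho>) ^ n) sums G (of_real s + (- of_real \<rho>))"
    by (rule has_fps_expansion_imp_sums_complex) (use r in auto)
  then have cs: "summable (\<lambda>n. b n * (- of_real \<rho>) ^ n)" by (simp add: F_def sums_iff)
  let ?h = "\<lambda>k t. exp (-(s * t)) * ((\<rho> * t) ^ k / fact k) * lap_kernel f t"
  have h0: "?h k t \<ge> 0" for k t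
    using r lap_kernel_nonneg[of t] by (cases "t \<ge> 0") (auto simp: lap_kernel_neg)
  have bc: "b n * (- of_real \<rho>) ^ n = of_real (\<integral>t. ?h n t \<partial>lborel)" for n
  proof -
    have "b n * (- of_real \<rho>) ^ n = (\<integral>t. exp (-(of_real s * of_real t)) * ((- of_real t) ^ n / fact n) * of_real (lap_kernel f t) * (- of_real \<rho>) ^ n \<partial>lborel)"
      unfolding b_def laplace_coeff_def by (rule integral_mult_left_zero[symmetric])
    also have "\<dots> = (\<integral>t. complex_of_real (?h n t) \<partial>lborel)"
      by (intro Bochner_Integration.integral_cong refl)
         (simp add: exp_of_real[symmetric] power_minus[of "of_real _"] power_mult_distrib mult_ac)
    also have "\<dots> = of_real (\<integral>t. ?h n t \<partial>lborel)" by (rule integral_complex_of_real)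
    finally show ?thesis .
  qed
  have sm: "summable (\<lambda>n. \<integral>t. ?h n t \<partial>lborel)" using cs unfolding bc by (simp only: summable_of_real_iff)
  \<comment> \<open>A single moment is integrable already at radius \<open>e = s - \<sigma>\<close>;
    multiplying by \<open>(\<rho> / e) ^ k\<close> adapts it. Only the sum over \<open>k\<close>
    depends on the extension \<open>G\<close>.\<close>
  have ih: "integrable lborel (?h k)" for k
  proof (cases "\<rho> = 0")
    case True
    have "integrable lborel (?h k)" if "k = 0"
      using lap_integrable_mono[OF int, of s] s that by (simp add: lap_integrable_def)
    then show ?thesis using True by (cases k) auto
  next
    case False
    define e where "e = s - \<sigma>"
    have e: "e > 0" "e \<le> s - \<sigma>" using s by (auto simp: e_def)
    have "integrable lborel (\<lambda>t. exp (-(s * t)) * ((e * t) ^ k / fact k) * lap_kernel f t)"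
    proof (rule Bochner_Integration.integrable_bound[OF int[unfolded lap_integrable_def]])
      show "AE t in lborel. norm (exp (-(s * t)) * ((e * t) ^ k / fact k) * lap_kernel f t) \<le> norm (exp (-(\<sigma> * t)) * lap_kernel f t)"
      proof (intro AE_I2)
        fix t :: real
        let ?q = "\<lambda>k. exp (-(s * t)) * ((e * t) ^ k / fact k) * lap_kernel f t"
        have q0: "?q k \<ge> 0" for k
          using e lap_kernel_nonneg[of t] by (cases "t \<ge> 0") (auto simp: lap_kernel_neg)
        have "?q k \<le> (\<Sum>j<Suc k. ?q j)" using q0 by (intro member_le_sum[of k "{..<Suc k}" ?q]) auto
        also have "\<dots> \<le> exp (-(\<sigma> * t)) * lap_kernel f t" using e by (intro laplace_partial_bound) auto
        finally show "norm (?q k) \<le> norm (exp (-(\<sigma> * t)) * lap_kernel f t)"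
          using q0[of k] unfolding real_norm_def by linarith
      qed
    qed measurable
    then have "integrable lborel (\<lambda>t. (\<rho> / e) ^ k * (exp (-(s * t)) * ((e * t) ^ k / fact k) * lap_kernel f t))"
      by (rule integrable_mult_right)
    moreover have "(\<rho> / e) ^ k * (exp (-(s * t)) * ((e * t) ^ k / fact k) * lap_kernel f t) = ?h k t" for t
      using e by (simp add: power_mult_distrib power_divide)
    ultimately show ?thesis by (simp only:)
  qed
  have nn: "(\<integral>\<^sup>+t. ennreal (?h k t) \<partial>lborel) = ennreal (\<integral>t. ?h k t \<partial>lborel)" for k
    by (rule nn_integral_eq_integral[OF ih]) (intro AE_I2 h0)
  have "(\<integral>\<^sup>+t. ennreal (exp (-((s - \<rho>) * t)) * lap_kernel f t) \<partial>lborel) = (\<integral>\<^sup>+t. (\<Sum>k. ennreal (?h k t)) \<partial>lborel)"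
  proof (intro nn_integral_cong)
    fix t :: real
    have "(\<lambda>k. (\<rho> * t) ^ k / fact k) sums exp (\<rho> * t)"
      using exp_converges[of "\<rho> * t"] by (simp add: field_simps)
    then have "(\<lambda>k. ?h k t) sums (exp (-(s * t)) * exp (\<rho> * t) * lap_kernel f t)" by (intro sums_mult sums_mult2)
    also have "exp (-(s * t)) * exp (\<rho> * t) = exp (-((s - \<rho>) * t))" by (simp add: exp_add[symmetric] algebra_simps)
    finally show "ennreal (exp (-((s - \<rho>) * t)) * lap_kernel f t) = (\<Sum>k. ennreal (?h k t))"
      using suminf_ennreal_sums[of "\<lambda>k. ?h k t", OF h0] by simp
  qed
  also have "\<dots> = (\<Sum>k. ennreal (\<integral>t. ?h k t \<partial>lborel))"
  proof (subst nn_integral_suminf)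
    show "(\<Sum>k. \<integral>\<^sup>+t. ennreal (?h k t) \<partial>lborel) = (\<Sum>k. ennreal (\<integral>t. ?h k t \<partial>lborel))"
      by (simp only: nn)
  qed measurable
  also have "\<dots> = ennreal (\<Sum>k. \<integral>t. ?h k t \<partial>lborel)"
    by (rule suminf_ennreal2[OF _ sm]) (intro integral_nonneg_AE AE_I2 h0)
  finally have fin: "(\<integral>\<^sup>+t. ennreal (exp (-((s - \<rho>) * t)) * lap_kernel f t) \<partial>lborel) = ennreal (\<Sum>k. \<integral>t. ?h k t \<partial>lborel)" .
  show ?thesis unfolding lap_integrable_def
    by (rule integrableI_nn_integral_finite[OF _ _ fin]) (use lap_kernel_nonneg in auto)
qed

end

section \<open>Continuation of the transform when Psi is nonnegative\<close>

lemma Psi_measurable: "(\<lambda>t. indicator {0..} t * Psi t) \<in> borel_measurable borel"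
proof -
  have "(\<lambda>t. indicator {0..} t * (exp (-(1 * t)) * Psi t)) \<in> borel_measurable lborel"
    using has_laplace_Psi[of 1] unfolding has_laplace_def has_bochner_integral_iff by auto
  then have [measurable]: "(\<lambda>t. indicator {0..} t * (exp (-(1 * t)) * Psi t)) \<in> borel_measurable borel" by simp
  have "(\<lambda>t. exp t * (indicator {0..} t * (exp (-(1 * t)) * Psi t))) \<in> borel_measurable borel" by measurable
  moreover have "exp t * (indicator {0..} t * (exp (-(1 * t)) * Psi t)) = indicator {0..} t * Psi t" for t
    by (simp add: exp_minus)
  ultimately show ?thesis by (simp only:)
qed

lemma islimpt_of_real_interval:
  fixes a b c :: real
  assumes "a < c" "c < b"
  shows "complex_of_real c islimpt (complex_of_real ` {a<..<b})"
proof -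
  have "c islimpt {a<..<b}" by (rule interior_limit_point) (use assms in \<open>auto simp: interior_open\<close>)
  then obtain f where f: "\<And>n. f n \<in> {a<..<b} - {c}" "f \<longlonglongrightarrow> c" by (auto simp: islimpt_sequential)
  show ?thesis unfolding islimpt_sequential
    by (rule exI[of _ "\<lambda>n. complex_of_real (f n)"]) (use f in \<open>auto intro!: tendsto_of_real simp: image_iff\<close>)
qed

lemma holomorphic_on_shift:
  assumes "f holomorphic_on UNIV" shows "(\<lambda>s. f (a + s)) holomorphic_on T"
proof -
  have "(\<lambda>s. a + s) holomorphic_on T" by (intro holomorphic_intros)
  from holomorphic_on_compose_gen[OF this assms] show ?thesis by (simp add: o_def)
qed

lemma holomorphic_deriv_xi_fun: "deriv xi_fun holomorphic_on UNIV"
  by (rule holomorphic_deriv[OF holomorphic_xi_fun]) simp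

text \<open>If \<open>P' = H\<close>, then \<open>\<xi>(1/2 + s) exp (- P(s))\<close> is constant.\<close>

lemma xi_fun_not_zero_half_plane:
  assumes H: "H holomorphic_on {s. Re s > 0}"
    and eq: "\<And>s. Re s > 0 \<Longrightarrow> xi_fun (1/2 + s) * H s = deriv xi_fun (1/2 + s)"
    and s: "Re s > 0"
  shows "xi_fun (1/2 + s) \<noteq> 0"
proof
  assume zero: "xi_fun (1/2 + s) = 0"
  let ?S = "{s::complex. Re s > 0}"
  have S: "convex ?S" "open ?S" by (auto intro: convex_halfspace_Re_gt open_halfspace_Re_gt)
  obtain P where P: "\<And>x. x \<in> ?S \<Longrightarrow> (P has_field_derivative H x) (at x within ?S)"
    using holomorphic_convex_primitive'[OF S H] by blast
  have P': "(P has_field_derivative H x) (at x)" if "x \<in> ?S" for x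
    using P[OF that] at_within_open[OF that S(2)] by simp
  let ?h = "\<lambda>x. xi_fun (1/2 + x) * exp (- P x)"
  have "(?h has_field_derivative 0) (at x within ?S)" if x: "x \<in> ?S" for x
  proof -
    have "(xi_fun has_field_derivative deriv xi_fun (1/2 + x)) (at (1/2 + x))"
      by (rule holomorphic_derivI[OF holomorphic_xi_fun[of UNIV]]) auto
    then have "((\<lambda>x. xi_fun (1/2 + x)) has_field_derivative deriv xi_fun (1/2 + x) * 1) (at x)"
      by (rule DERIV_chain2) (auto intro!: derivative_eq_intros)
    then have "(?h has_field_derivative deriv xi_fun (1/2 + x) * exp (- P x) + (exp (- P x) * - H x) * xi_fun (1/2 + x)) (at x)"
      using P'[OF x] by (auto intro!: derivative_eq_intros)
    also have "deriv xi_fun (1/2 + x) * exp (- P x) + (exp (- P x) * - H x) * xi_fun (1/2 + x) = 0"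
      using eq[of x] x by (simp add: algebra_simps)
    finally show ?thesis by (rule has_field_derivative_at_within)
  qed
  then have "\<exists>c. \<forall>x\<in>?S. ?h x = c"
    by (rule has_field_derivative_zero_constant[OF S(1)])
  then obtain c where "\<forall>x\<in>?S. ?h x = c" ..
  then have c: "?h x = c" if "x \<in> ?S" for x using that by (rule bspec)
  have "c = 0" using c[of s] zero s by simp
  then have "xi_fun (1/2 + 1) = 0" using c[of 1] by simp
  moreover have "xi_fun (1/2 + 1) \<noteq> 0" using xi_fun_nonzero_real[of "3/2"] by simp
  ultimately show False by contradiction
qed

text \<open>The relation is multiplied out by \<open>\<xi>\<close>, so that it continues across
  zeros of \<open>\<xi>\<close> that are not yet excluded. It is known on the real interval (1, 3),
  which lies in the half plane because \<open>c \<le> 1/2\<close>.\<close>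

lemma Psi_nonneg_imp_laplace_eq:
  assumes nn: "\<And>t. Psi t \<ge> 0" and c: "0 \<le> c" "c \<le> 1/2"
    and int: "\<And>\<sigma>. \<sigma> > c \<Longrightarrow> lap_integrable Psi' \<sigma>"
    and Psi': "Psi' = (\<lambda>t. indicator {0..} t * Psi t)"
  shows "laplace Psi' holomorphic_on {s. Re s > c}"
    and "\<And>s. Re s > c \<Longrightarrow> xi_fun (1/2 + s) * (s\<^sup>2 * laplace Psi' s) = deriv xi_fun (1/2 + s)"
proof -
  have m: "Psi' \<in> borel_measurable borel" "\<And>t. t \<ge> 0 \<Longrightarrow> Psi' t \<ge> 0"
    using Psi_measurable nn by (auto simp: Psi')
  have "laplace Psi' analytic_on {s}" if "Re s > c" for s
  proof -
    define \<sigma> where "\<sigma> = (c + Re s) / 2"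
    have \<sigma>: "c < \<sigma>" "\<sigma> < Re s" using that by (auto simp: \<sigma>_def)
    have "laplace Psi' analytic_on {s. Re s > \<sigma>}"
      using holomorphic_laplace[OF m int[OF \<sigma>(1)]] by (simp add: analytic_on_open open_halfspace_Re_gt)
    then show ?thesis by (rule analytic_on_subset) (use \<sigma> in auto)
  qed
  then have "laplace Psi' analytic_on {s. Re s > c}" by (subst analytic_on_analytic_at) auto
  then show hol: "laplace Psi' holomorphic_on {s. Re s > c}" by (rule analytic_imp_holomorphic)
  fix s assume s: "Re s > c"
  let ?F = "\<lambda>s. xi_fun (1/2 + s) * (s\<^sup>2 * laplace Psi' s) - deriv xi_fun (1/2 + s)"
  have "?F s = 0"
  proof (rule analytic_continuation[of ?F "{s. Re s > c}" "of_real ` {1<..<3}" "of_real 2"])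
    have "(\<lambda>s. xi_fun (1/2 + s)) holomorphic_on {s. Re s > c}"
      by (rule holomorphic_on_shift[OF holomorphic_xi_fun])
    moreover have "(\<lambda>s. deriv xi_fun (1/2 + s)) holomorphic_on {s. Re s > c}"
      by (rule holomorphic_on_shift[OF holomorphic_deriv_xi_fun])
    ultimately show "?F holomorphic_on {s. Re s > c}" using hol by (intro holomorphic_intros)
    show "complex_of_real 2 islimpt of_real ` {1<..<3}" by (rule islimpt_of_real_interval) auto
    show "connected {s. c < Re s}" by (intro convex_connected convex_halfspace_Re_gt)
    fix z :: complex assume "z \<in> of_real ` {1<..<3}"
    then obtain x where x: "z = of_real x" "x > 1" by auto
    have "has_laplace Psi' x (psi_transform x / x\<^sup>2)"
      using has_laplace_Psi[of x] x by (subst has_laplace_cong[where g = Psi]) (auto simp: Psi')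
    then have "laplace Psi' z = of_real (psi_transform x / x\<^sup>2)" unfolding x(1) by (rule has_laplace_imp_laplace)
    moreover have "deriv xi_fun (1/2 + z) = of_real (psi_transform x) * xi_fun (1/2 + z)"
      unfolding x(1) using x by (intro DERIV_imp_deriv xi_fun_has_derivative_real) auto
    ultimately show "?F z = 0" using x by simp
  qed (use s c in \<open>auto simp: open_halfspace_Re_gt\<close>)
  then show "xi_fun (1/2 + s) * (s\<^sup>2 * laplace Psi' s) = deriv xi_fun (1/2 + s)" by simp
qed

text \<open>At the infimum \<open>c\<close> of the admissible exponents, \<open>\<xi>'/\<xi>\<close> is regular because \<open>\<xi>\<close> does not vanish on the real axis;
  \<open>lap_integrable_extend\<close> then contradicts minimality unless \<open>c = 0\<close>.\<close>

lemma Psi_nonneg_imp_lap_integrable: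
  assumes nn: "\<And>t. Psi t \<ge> 0" and Psi': "Psi' = (\<lambda>t. indicator {0..} t * Psi t)" and \<sigma>: "\<sigma> > 0"
  shows "lap_integrable Psi' \<sigma>"
proof -
  have m: "Psi' \<in> borel_measurable borel" "\<And>t. t \<ge> 0 \<Longrightarrow> Psi' t \<ge> 0"
    using Psi_measurable nn by (auto simp: Psi')
  have base: "lap_integrable Psi' x" if "x > 1/2" for x
    by (rule has_laplace_imp_integrable[of _ _ "psi_transform x / x\<^sup>2"], subst has_laplace_cong[where g = Psi])
       (use has_laplace_Psi[OF that] in \<open>auto simp: Psi'\<close>)
  define A where "A = {x. x > 0 \<and> lap_integrable Psi' x}"
  define c where "c = Inf A"
  have A1: "1 \<in> A" using base[of 1] by (simp add: A_def)
  have bdd: "bdd_below A" by (rule bdd_belowI[of _ 0]) (auto simp: A_def)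
  have c0: "c \<ge> 0" unfolding c_def by (rule cInf_greatest) (use A1 in blast, simp add: A_def)
  have chalf: "c \<le> 1/2"
  proof (rule field_le_epsilon)
    fix e :: real assume "e > 0"
    then have "1/2 + e \<in> A" using base[of "1/2 + e"] by (simp add: A_def)
    then show "c \<le> 1/2 + e" unfolding c_def by (rule cInf_lower[OF _ bdd])
  qed
  have int: "lap_integrable Psi' x" if x: "x > c" for x
  proof -
    obtain y where "y \<in> A" "y < x" using x cInf_lessD[of A x] A1 by (auto simp: c_def)
    then show ?thesis using lap_integrable_mono[OF m, of y x] by (auto simp: A_def)
  qed
  have "c = 0"
  proof (rule ccontr)
    assume "c \<noteq> 0"
    then have c: "c > 0" using c0 by simp
    have L1: "laplace Psi' holomorphic_on {s. Re s > c}"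
      by (rule Psi_nonneg_imp_laplace_eq(1)[OF nn c0 chalf _ Psi']) (rule int)
    have L2: "xi_fun (1/2 + s) * (s\<^sup>2 * laplace Psi' s) = deriv xi_fun (1/2 + s)" if "Re s > c" for s
      by (rule Psi_nonneg_imp_laplace_eq(2)[OF nn c0 chalf _ Psi' that]) (rule int)
    let ?X = "\<lambda>s. xi_fun (1/2 + s)"
    have X0: "?X (of_real c) \<noteq> 0" using xi_fun_nonzero_real[of "1/2 + c"] c by simp
    have holX: "?X holomorphic_on T" for T
      by (rule holomorphic_on_shift[OF holomorphic_xi_fun])
    have holdX: "(\<lambda>s. deriv xi_fun (1/2 + s)) holomorphic_on T" for T
      by (rule holomorphic_on_shift[OF holomorphic_deriv_xi_fun])
    have "continuous (at (of_real c)) ?X"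
      using holomorphic_on_imp_continuous_on[OF holX[of UNIV]] by (simp add: continuous_on_eq_continuous_at)
    then obtain e where e: "e > 0" "\<And>z. dist (of_real c) z < e \<Longrightarrow> ?X z \<noteq> 0"
      using continuous_at_avoid[of "of_real c" ?X 0] X0 by blast
    define \<eta> where "\<eta> = min e c"
    have \<eta>: "\<eta> > 0" "\<eta> \<le> e" "\<eta> \<le> c" using e c by (auto simp: \<eta>_def)
    define B where "B = ball (complex_of_real c) \<eta>"
    define q where "q = (\<lambda>s. deriv xi_fun (1/2 + s) / (?X s * s\<^sup>2))"
    have Bnz: "?X s \<noteq> 0" "s \<noteq> 0" if "s \<in> B" for s
    proof -
      show "?X s \<noteq> 0" using that \<eta> by (intro e) (auto simp: B_def)
      show "s \<noteq> 0" using that \<eta> c by (auto simp: B_def dist_norm)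
    qed
    define G where "G = (\<lambda>s. if Re s > c then laplace Psi' s else q s)"
    have qL: "q s = laplace Psi' s" if "s \<in> B" "Re s > c" for s
      using L2[OF that(2)] Bnz[OF that(1)] by (simp add: q_def divide_simps) (simp add: mult_ac)
    have G1: "G holomorphic_on {s. Re s > c}"
      using L1 by (rule holomorphic_transform) (auto simp: G_def)
    have "q holomorphic_on B" unfolding q_def
      using Bnz by (intro holomorphic_intros holX holdX) auto
    then have G2: "G holomorphic_on B" by (rule holomorphic_transform) (auto simp: G_def qL)
    have G: "G holomorphic_on ({s. Re s > c} \<union> B)"
      by (rule holomorphic_on_Un[OF G1 G2]) (auto simp: B_def open_halfspace_Re_gt)
    \<comment> \<open>With \<open>x = Re z - c \<le> 0\<close>, the inequality
      \<open>(x - \<eta>)^2 + y^2 < 1.69 \<eta>^2\<close> gives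
      \<open>x^2 + y^2 < 0.69 \<eta>^2\<close>, so the part left of \<open>c\<close> lies in
      \<open>B\<close>. Any factor strictly between 1 and the square root of 2 has this effect while
      reaching beyond \<open>c\<close>.\<close>
    have sub: "ball (of_real (c + \<eta>)) (13/10 * \<eta>) \<subseteq> {s. Re s > c} \<union> B"
    proof
      fix z :: complex assume z: "z \<in> ball (of_real (c + \<eta>)) (13/10 * \<eta>)"
      show "z \<in> {s. Re s > c} \<union> B"
      proof (cases "Re z > c")
        case False
        define x where "x = Re z - c"
        have "norm (z - of_real (c + \<eta>)) < 13/10 * \<eta>" using z by (simp add: dist_norm norm_minus_commute)
        then have "(norm (z - of_real (c + \<eta>)))\<^sup>2 < (13/10 * \<eta>)\<^sup>2" using \<eta> by (intro power_strict_mono) auto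
        then have 1: "(x - \<eta>)\<^sup>2 + (Im z)\<^sup>2 < (13/10 * \<eta>)\<^sup>2" by (simp add: cmod_power2 x_def algebra_simps)
        have "x * \<eta> \<le> 0" using False \<eta> by (intro mult_nonpos_nonneg) (auto simp: x_def)
        then have "x\<^sup>2 + (Im z)\<^sup>2 < 69/100 * \<eta>\<^sup>2" using 1 by (simp add: power2_eq_square algebra_simps)
        also have "\<dots> \<le> \<eta>\<^sup>2" by simp
        finally have "(norm (z - of_real c))\<^sup>2 < \<eta>\<^sup>2" by (simp add: cmod_power2 x_def)
        then have "norm (z - of_real c) < \<eta>" using \<eta> by (meson less_imp_le power2_less_imp_less)
        then show ?thesis by (simp add: B_def dist_norm norm_minus_commute)
      qed auto
    qed
    \<comment> \<open>The new exponent is \<open>c - \<eta> / 5\<close>: smaller than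
      \<open>c\<close>, yet positive since \<open>\<eta> \<le> c\<close>, and thus a member of
      \<open>A\<close> below its infimum.\<close>
    have "lap_integrable Psi' (c + \<eta> - 12/10 * \<eta>)"
    proof (rule lap_integrable_extend[OF m, where G = G and r = "13/10 * \<eta>" and \<sigma> = "c + \<eta>/2"])
      show "lap_integrable Psi' (c + \<eta>/2)" using \<eta> by (intro int) auto
      show "G holomorphic_on ball (complex_of_real (c + \<eta>)) (13/10 * \<eta>)" by (rule holomorphic_on_subset[OF G sub])
      show "G z = laplace Psi' z" if "Re z > c + \<eta>/2" for z using that \<eta> by (auto simp: G_def)
    qed (use \<eta> in auto)
    then have "c + \<eta> - 12/10 * \<eta> \<in> A" using \<eta> c by (auto simp: A_def)
    then have "c \<le> c + \<eta> - 12/10 * \<eta>" unfolding c_def by (rule cInf_lower[OF _ bdd])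
    then show False using \<eta> by simp
  qed
  then show ?thesis using int \<sigma> by simp
qed

theorem Psi_nonneg_imp_RH:
  assumes nn: "\<And>t. Psi t \<ge> 0"
  shows riemann_hypothesis
proof -
  define Psi' where "Psi' = (\<lambda>t. indicator {0..} t * Psi t)"
  have int: "lap_integrable Psi' \<sigma>" if "\<sigma> > 0" for \<sigma>
    by (rule Psi_nonneg_imp_lap_integrable[OF nn Psi'_def that])
  have L1: "laplace Psi' holomorphic_on {s. Re s > 0}"
    by (rule Psi_nonneg_imp_laplace_eq(1)[OF nn _ _ _ Psi'_def]) (use int in auto)
  have L2: "xi_fun (1/2 + s) * (s\<^sup>2 * laplace Psi' s) = deriv xi_fun (1/2 + s)" if "Re s > 0" for s
    by (rule Psi_nonneg_imp_laplace_eq(2)[OF nn _ _ _ Psi'_def that]) (use int in auto)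
  have "(\<lambda>s. s\<^sup>2 * laplace Psi' s) holomorphic_on {s. Re s > 0}" using L1 by (intro holomorphic_intros) auto
  then have nz: "xi_fun (1/2 + s) \<noteq> 0" if "Re s > 0" for s
    by (rule xi_fun_not_zero_half_plane) (use L2 that in auto)
  have "Re s = 1/2" if z: "xi_fun s = 0" for s
  proof (rule ccontr)
    assume "Re s \<noteq> 1/2"
    then consider "Re s > 1/2" | "Re s < 1/2" by linarith
    then show False
    proof cases
      case 1 then show False using nz[of "s - 1/2"] z by simp
    next
      case 2 then show False using nz[of "1/2 - s"] z xi_fun_reflect[of s] by simp
    qed
  qed
  then show ?thesis by (simp add: riemann_hypothesis_def xi_eq)
qed

section \<open>Growth of the zeta function under the Riemann hypothesis\<close>

text \<open>\<open>Re f < M\<close> says that \<open>f\<close> lies closer to 0 than to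
  \<open>2 M\<close>, so \<open>f / (2 M - f)\<close> maps into the unit disc and fixes the origin
  after rescaling. Schwarz's lemma, solved for \<open>norm (f z)\<close>, is the claim.\<close>

lemma Borel_Caratheodory:
  assumes f: "f holomorphic_on ball z0 R" and f0: "f z0 = 0" and M: "M > 0"
    and le: "\<And>z. z \<in> ball z0 R \<Longrightarrow> Re (f z) < M" and z: "norm (z - z0) \<le> r" "r < R"
  shows "norm (f z) \<le> 2 * M * r / (R - r)"
proof -
  have R: "R > 0" "r \<ge> 0" using z norm_ge_zero[of "z - z0"] by linarith+
  define g where "g = (\<lambda>w. f (z0 + of_real R * w) / (2 * of_real M - f (z0 + of_real R * w)))"
  have inb: "z0 + of_real R * w \<in> ball z0 R" if "norm w < 1" for w
    using that R by (simp add: dist_norm norm_mult)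
  have nz: "2 * of_real M - f (z0 + of_real R * w) \<noteq> 0" if "norm w < 1" for w
  proof
    assume "2 * of_real M - f (z0 + of_real R * w) = 0"
    then have "Re (f (z0 + of_real R * w)) = 2 * M" by (simp add: complex_eq_iff)
    then show False using le[OF inb[OF that]] M by simp
  qed
  have lt: "norm (f x) < norm (2 * of_real M - f x)" if "x \<in> ball z0 R" for x
  proof (rule power2_less_imp_less)
    have "4 * M * (M - Re (f x)) > 0" using le[OF that] M by simp
    then show "(norm (f x))\<^sup>2 < (norm (2 * of_real M - f x))\<^sup>2"
      unfolding cmod_power2 by (simp add: power2_eq_square algebra_simps)
  qed simp
  have holf: "(\<lambda>w. f (z0 + of_real R * w)) holomorphic_on ball 0 1"
  proof -
    have a: "(\<lambda>w. z0 + of_real R * w) holomorphic_on ball 0 1" by (intro holomorphic_intros)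
    have b: "(\<lambda>w. z0 + of_real R * w) ` ball 0 1 \<subseteq> ball z0 R" using inb by auto
    from holomorphic_on_compose_gen[OF a f b] show ?thesis by (simp add: o_def)
  qed
  have g: "g holomorphic_on ball 0 1" unfolding g_def using nz by (intro holomorphic_intros holf) auto
  have g0: "g 0 = 0" by (simp add: g_def f0)
  have g1: "norm (g w) < 1" if "norm w < 1" for w
    using lt[OF inb[OF that]] nz[OF that] by (simp add: g_def norm_divide divide_simps)
  define w where "w = (z - z0) / of_real R"
  have w: "norm w \<le> r / R" "z = z0 + of_real R * w"
    using R z by (auto simp: w_def norm_divide divide_right_mono)
  have "r / R < 1" using z R by simp
  then have w1: "norm w < 1" using w(1) by linarith
  have "norm (g w) \<le> norm w" by (rule Schwarz_Lemma(1)[OF g g0 g1 w1])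
  moreover have "norm (2 * of_real M - f z) > 0" using nz[OF w1] unfolding w(2)[symmetric] by simp
  moreover have "norm (g w) = norm (f z) / norm (2 * of_real M - f z)"
    unfolding g_def w(2)[symmetric] by (rule norm_divide)
  ultimately have "norm (f z) \<le> norm w * norm (2 * of_real M - f z)" by (simp add: divide_le_eq)
  also have "\<dots> \<le> r / R * (2 * M + norm (f z))"
    using w(1) norm_triangle_ineq4[of "2 * of_real M" "f z"] M R z by (intro mult_mono) auto
  finally have "norm (f z) * R \<le> r * (2 * M + norm (f z))" using R by (simp add: pos_le_divide_eq)
  then have "norm (f z) * (R - r) \<le> 2 * M * r" by (simp add: algebra_simps)
  then show ?thesis using z by (simp add: pos_le_divide_eq)
qed

text \<open>Anchors the logarithm of \<open>zeta_num\<close> at a point far enough to the right,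
  from which Borel--Caratheodory starts.\<close>

lemma norm_dzeta_ge:
  assumes w: "Re w \<ge> 2" shows "norm (dzeta w) \<ge> 1/4"
proof -
  let ?f = "\<lambda>n. of_nat (Suc n) powr (- w) :: complex"
  have s: "?f sums dzeta w" using w by (intro sums_dzeta) auto
  then have s1: "(\<lambda>n. ?f (Suc n)) sums (dzeta w - 1)" by (subst sums_Suc_iff) simp
  define u where "u = (\<lambda>n. inverse (real (Suc n)) - inverse (real (Suc (Suc n))))"
  have u: "u sums (inverse (real (Suc 0)) - 0)"
    unfolding u_def by (rule telescope_sums') (rule LIMSEQ_inverse_real_of_nat)
  \<comment> \<open>The telescoping majorant sums to 1, which would leave no room. Lowering its
    first term from 1/2 to the exact value 1/4 brings the total down to 3/4.\<close>
  define v where "v = (\<lambda>n. u n - (if n = 0 then 1/4 else 0))"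
  have v: "v sums (3/4)"
    using sums_diff[OF u sums_single[of 0 "\<lambda>_. 1/4::real"]] by (simp add: v_def)
  have b: "norm (?f (Suc n)) \<le> v n" for n
  proof -
    have "norm (?f (Suc n)) = real (Suc (Suc n)) powr (- Re w)" by (simp only: norm_Suc_powr) simp
    also have "\<dots> \<le> real (Suc (Suc n)) powr (-2)" using w by (intro powr_mono) auto
    also have "\<dots> = 1 / (real n + 2)\<^sup>2" by (simp add: powr_minus powr_numeral divide_simps add_ac)
    also have "\<dots> \<le> v n"
      by (cases "n = 0") (auto simp: v_def u_def divide_simps power2_eq_square, simp add: algebra_simps)
    finally show ?thesis .
  qed
  have "norm (\<Sum>n. ?f (Suc n)) \<le> suminf v"
    by (rule norm_suminf_le[OF b sums_summable[OF v]])
  then have "norm (dzeta w - 1) \<le> 3/4" using sums_unique[OF s1] sums_unique[OF v] by simp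
  then show ?thesis using norm_triangle_ineq2[of 1 "dzeta w"] by (simp add: norm_minus_commute)
qed

context
  assumes RH: riemann_hypothesis
begin

lemma zeta_num_nonzero:
  assumes "Re w > 1/2" shows "zeta_num w \<noteq> 0"
proof
  assume "zeta_num w = 0"
  then have "xi_fun w = 0" using assms by (simp add: xi_fun_def xi_right_def)
  then show False using RH assms by (auto simp: riemann_hypothesis_def xi_eq)
qed

text \<open>The exponent \<open>1/4\<close> has no significance: the bounds are in fact logarithmic, and any power below \<open>1/2\<close> suffices for
  \<open>Phragmen_Lindelof_half_plane\<close>, where \<open>exp (- \<epsilon> sqrt (1 + s))\<close> is the damping factor.\<close>

lemma zeta_num_bounds_RH:
  assumes \<delta>: "0 < \<delta>" "\<delta> \<le> 1/2"
  shows "\<exists>C>0. \<forall>w. Re w \<ge> 1/2 + \<delta> \<longrightarrow>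
     norm (zeta_num w) \<ge> exp (- (C * (1 + norm w) powr (1/4))) \<and>
     norm (deriv zeta_num w / zeta_num w) \<le> C * (1 + norm w) powr (1/4)"
proof -
  let ?S = "{w::complex. Re w > 1/2}"
  have S: "open ?S" "convex ?S" by (rule open_halfspace_Re_gt convex_halfspace_Re_gt)+
  have holE: "zeta_num holomorphic_on ?S" by (rule holomorphic_on_subset[OF holomorphic_zeta_num]) auto
  \<comment> \<open>A holomorphic logarithm exists because the hypothesis makes
    \<open>zeta_num\<close> zero-free on this convex half plane.\<close>
  obtain L where L: "L holomorphic_on ?S" "\<And>z. z \<in> ?S \<Longrightarrow> zeta_num z = exp (L z)"
    using contractible_imp_holomorphic_log[OF holE convex_imp_contractible[OF S(2)]] zeta_num_nonzero by blast
  have ReL: "Re (L z) = ln (norm (zeta_num z))" if "z \<in> ?S" for z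
    using L(2)[OF that] by simp
  obtain A where A: "A > 0" "\<And>s. Re s \<ge> 0 \<Longrightarrow> norm (zeta_num s) \<le> A * (1 + norm s) ^ 3"
    using norm_zeta_num_le by blast
  \<comment> \<open>The parts of \<open>K\<close> come from the constant \<open>A\<close>, the cube
    with \<open>1 + norm z \<le> 5 * (1 + norm w)\<close>, the lower bound 1/4 at \<open>w0\<close>,
    and \<open>3 * ln (1 + norm w) \<le> 12 * p\<close>; one more unit makes the bound
    strict.\<close>
  define K where "K = \<bar>ln A\<bar> + 3 * ln 5 + ln 4 + 13"
  have K: "K > 0" unfolding K_def by (intro add_nonneg_pos) auto
  define C where "C = (12 * K / \<delta>) / (\<delta> / 8) + 12 * K / \<delta> + 2"
  have C: "C > 0" using \<delta> K by (simp add: C_def add_pos_pos)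
  have main: "norm (zeta_num w) \<ge> exp (- (C * (1 + norm w) powr (1/4))) \<and>
     norm (deriv zeta_num w / zeta_num w) \<le> C * (1 + norm w) powr (1/4)" if w: "Re w \<ge> 1/2 + \<delta>" for w
  proof -
    define p where "p = (1 + norm w) powr (1/4)"
    have p: "p \<ge> 1" unfolding p_def by (rule ge_one_powr_ge_zero) auto
    \<comment> \<open>The centre has the height of \<open>w\<close> but real part at least 2, where
      \<open>norm_dzeta_ge\<close> applies.\<close>
    define w0 where "w0 = Complex (max 2 (Re w)) (Im w)"
    \<comment> \<open>This disc stays right of \<open>1/2 + \<delta>/2\<close>, and its radius
      exceeds the distance from \<open>w0\<close> to \<open>w\<close> by at least
      \<open>\<delta>/2\<close>.\<close>
    define R where "R = 3/2 - \<delta>/2"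
    have R: "R > 0" using \<delta> by (simp add: R_def)
    have ww: "w - w0 = of_real (Re w - max 2 (Re w))" by (simp add: w0_def complex_eq_iff)
    have dw: "norm (w - w0) \<le> 3/2 - \<delta>" unfolding ww norm_of_real using w \<delta> by (auto simp: max_def)
    have Rew0: "Re w0 \<ge> 2" by (simp add: w0_def)
    have ballS: "Re z > 1/2 + \<delta>/2" if "z \<in> ball w0 R" for z
    proof -
      have "\<bar>Re (z - w0)\<bar> < R" using that abs_Re_le_cmod[of "z - w0"] by (simp add: dist_norm norm_minus_commute)
      then have "Re z > Re w0 - R" by (simp add: abs_less_iff)
      then show ?thesis using Rew0 by (simp add: R_def)
    qed
    then have sub: "ball w0 R \<subseteq> ?S" using \<delta> by force
    have w0S: "w0 \<in> ?S" using Rew0 by simp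
    have lower0: "norm (zeta_num w0) \<ge> 1/4"
    proof -
      have "norm (w0 - 1) \<ge> 1" using abs_Re_le_cmod[of "w0 - 1"] Rew0 by simp
      then have "1 * (1/4) \<le> norm (w0 - 1) * norm (dzeta w0)" using norm_dzeta_ge[OF Rew0] by (intro mult_mono) auto
      then show ?thesis using zeta_num_eq_dzeta[of w0] Rew0 by (simp add: norm_mult)
    qed
    have lnw: "ln (1 + norm w) \<le> 4 * p" using ln_powr_bound[of "1 + norm w" "1/4"] by (simp add: p_def)
    define M where "M = K * p"
    have M: "M > 0" using K p by (simp add: M_def)
    have upper: "Re (L z - L w0) < M" if z: "z \<in> ball w0 R" for z
    proof -
      have zS: "z \<in> ?S" using z sub by blast
      have "norm (z - w) \<le> norm (z - w0) + norm (w0 - w)" using norm_triangle_ineq[of "z - w0" "w0 - w"] by simp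
      also have "\<dots> \<le> 4" using z dw \<delta> by (simp add: dist_norm norm_minus_commute R_def)
      finally have "norm z \<le> norm w + 4" using norm_triangle_ineq2[of z w] by simp
      then have n: "1 + norm z \<le> 5 * (1 + norm w)" using norm_ge_zero[of w] unfolding distrib_left by linarith
      have "norm (zeta_num z) \<le> A * (1 + norm z) ^ 3" using zS by (intro A) auto
      also have "\<dots> \<le> A * (5 * (1 + norm w)) ^ 3" using n A(1) by (intro mult_left_mono power_mono) auto
      finally have "ln (norm (zeta_num z)) \<le> ln (A * (5 * (1 + norm w)) ^ 3)"
        using zeta_num_nonzero[of z] zS A(1) by (intro ln_mono) auto
      also have "ln (A * (5 * (1 + norm w)) ^ 3) = ln A + 3 * (ln 5 + ln (1 + norm w))"
      proof -
        have "ln (A * (a * q) ^ 3) = ln A + 3 * (ln a + ln q)" if "a > 0" "q > 0" for a q :: real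
          using that A(1) by (simp add: ln_mult ln_realpow)
        from this[of 5 "1 + norm w"] show ?thesis using norm_ge_zero[of w] by linarith
      qed
      also have "\<dots> \<le> \<bar>ln A\<bar> + 3 * ln 5 + 12 * p" using lnw by simp
      finally have 1: "ln (norm (zeta_num z)) \<le> \<bar>ln A\<bar> + 3 * ln 5 + 12 * p" .
      have "ln (1/4) \<le> ln (norm (zeta_num w0))" using lower0 by (intro ln_mono) auto
      then have "- ln 4 \<le> ln (norm (zeta_num w0))" by (simp add: ln_div)
      then have "Re (L z - L w0) \<le> \<bar>ln A\<bar> + 3 * ln 5 + ln 4 + 12 * p"
        using 1 ReL[OF zS] ReL[OF w0S] by simp
      also have "\<dots> \<le> (\<bar>ln A\<bar> + 3 * ln 5 + ln 4) * p + 12 * p"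
        using mult_left_mono[OF p, of "\<bar>ln A\<bar> + 3 * ln 5 + ln 4"] by simp
      also have "\<dots> < M" using p by (simp add: M_def K_def algebra_simps)
      finally show ?thesis .
    qed
    have hol: "(\<lambda>z. L z - L w0) holomorphic_on ball w0 R"
      by (intro holomorphic_intros holomorphic_on_subset[OF L(1) sub])
    \<comment> \<open>The bound is proved on a neighbourhood of \<open>w\<close>, not just at
      \<open>w\<close>, so that a Cauchy estimate on radius \<open>\<delta>/8\<close> also controls
      the derivative. The gap \<open>R - r = \<delta>/4\<close> produces the factor
      \<open>12 / \<delta>\<close>.\<close>
    have BC: "norm (L z - L w0) \<le> 12 * M / \<delta>" if z: "norm (z - w) < \<delta>/4" for z
    proof -
      have "norm (z - w0) \<le> norm (z - w) + norm (w - w0)" using norm_triangle_ineq[of "z - w" "w - w0"] by simp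
      also have "\<dots> \<le> 3/2 - 3 * \<delta> / 4" using z dw by simp
      finally have zr: "norm (z - w0) \<le> 3/2 - 3 * \<delta> / 4" .
      have "norm (L z - L w0) \<le> 2 * M * (3/2 - 3 * \<delta> / 4) / (R - (3/2 - 3 * \<delta> / 4))"
        by (rule Borel_Caratheodory[OF hol _ M upper zr]) (use \<delta> in \<open>auto simp: R_def\<close>)
      also have "R - (3/2 - 3 * \<delta> / 4) = \<delta> / 4" by (simp add: R_def)
      also have "2 * M * (3/2 - 3 * \<delta> / 4) / (\<delta> / 4) \<le> 2 * M * (3/2) / (\<delta> / 4)"
        using M \<delta> by (intro divide_right_mono mult_left_mono) auto
      also have "\<dots> = 12 * M / \<delta>" by simp
      finally show ?thesis .
    qed
    have wS: "w \<in> ?S" using w \<delta> by simp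
    have "norm (L w - L w0) \<le> 12 * M / \<delta>" using \<delta> by (intro BC) auto
    then have "Re (L w) \<ge> Re (L w0) - 12 * M / \<delta>"
      using abs_Re_le_cmod[of "L w - L w0"] by (simp add: abs_le_iff)
    moreover have "Re (L w0) \<ge> -2"
    proof -
      have "ln (1/4) \<le> ln (norm (zeta_num w0))" using lower0 by (intro ln_mono) auto
      moreover have "ln (4::real) \<le> 2" using ln_le_minus_one[of "2::real"] ln_realpow[of 2 2] by simp
      ultimately show ?thesis using ReL[OF w0S] by (simp add: ln_div)
    qed
    ultimately have "Re (L w) \<ge> - (12 * M / \<delta> + 2 * p)" using p by simp
    also have "- (12 * M / \<delta> + 2 * p) \<ge> - (C * p)"
    proof -
      have "12 * M / \<delta> + 2 * p = (12 * K / \<delta> + 2) * p" by (simp add: M_def algebra_simps)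
      also have "\<dots> \<le> C * p" using p \<delta> K by (intro mult_right_mono) (auto simp: C_def)
      finally show ?thesis by simp
    qed
    finally have 1: "norm (zeta_num w) \<ge> exp (- (C * p))" using L(2)[OF wS] by simp
    have bs: "cball w (\<delta>/8) \<subseteq> ?S"
    proof
      fix z assume "z \<in> cball w (\<delta>/8)"
      then have "\<bar>Re (z - w)\<bar> \<le> \<delta>/8" using abs_Re_le_cmod[of "z - w"] by (simp add: dist_norm norm_minus_commute)
      then have "Re z \<ge> Re w - \<delta>/8" unfolding minus_complex.sel by linarith
      then show "z \<in> ?S" using w \<delta> by simp
    qed
    have "norm ((deriv ^^ 1) (\<lambda>z. L z - L w0) w) \<le> fact 1 * (12 * M / \<delta>) / (\<delta>/8) ^ 1"
    proof (rule Cauchy_inequality)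
      show "(\<lambda>z. L z - L w0) holomorphic_on ball w (\<delta>/8)"
        by (intro holomorphic_intros holomorphic_on_subset[OF L(1)]) (use bs ball_subset_cball in blast)
      show "continuous_on (cball w (\<delta>/8)) (\<lambda>z. L z - L w0)"
        by (intro continuous_intros holomorphic_on_imp_continuous_on holomorphic_on_subset[OF L(1) bs])
      show "norm (L x - L w0) \<le> 12 * M / \<delta>" if "norm (w - x) = \<delta>/8" for x
        using that \<delta> by (intro BC) (simp add: norm_minus_commute)
    qed (use \<delta> in auto)
    moreover have dL: "(L has_field_derivative deriv L w) (at w)"
      by (rule holomorphic_derivI[OF L(1) S(1) wS])
    then have "deriv (\<lambda>z. L z - L w0) w = deriv L w"
      by (intro DERIV_imp_deriv) (auto intro!: derivative_eq_intros)
    ultimately have "norm (deriv L w) \<le> (12 * M / \<delta>) / (\<delta>/8)" by simp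
    moreover have "deriv zeta_num w = exp (L w) * deriv L w"
    proof (rule DERIV_imp_deriv)
      have "((\<lambda>z. exp (L z)) has_field_derivative exp (L w) * deriv L w) (at w)"
        by (rule DERIV_chain2[OF DERIV_exp dL])
      then show "(zeta_num has_field_derivative exp (L w) * deriv L w) (at w)"
        by (rule has_field_derivative_transform_within_open[OF _ S(1) wS]) (use L(2) in auto)
    qed
    ultimately have "norm (deriv zeta_num w / zeta_num w) \<le> (12 * M / \<delta>) / (\<delta>/8)" using L(2)[OF wS] by simp
    also have "\<dots> = ((12 * K / \<delta>) / (\<delta>/8)) * p" by (simp add: M_def)
    also have "\<dots> \<le> C * p" using p \<delta> K by (intro mult_right_mono) (auto simp: C_def)
    finally show ?thesis using 1 by (simp add: p_def)
  qed
  show ?thesis using C main by blast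
qed

end

section \<open>Phragmen--Lindelof and a comparison of Gamma factors\<close>

lemma Re_csqrt_ge:
  assumes "Re z \<ge> 0" shows "Re (csqrt z) \<ge> sqrt (norm z) / 2"
proof -
  have "sqrt (norm z) / 2 = sqrt (norm z / 4)" by (simp add: real_sqrt_divide)
  also have "\<dots> \<le> sqrt ((norm z + Re z) / 2)" using assms by (intro real_sqrt_le_mono) auto
  finally show ?thesis by simp
qed

text \<open>After damping by \<open>exp (- (\<epsilon> * csqrt (1 + s)))\<close>, the decay
  \<open>exp (- (\<epsilon> / 2 * sqrt R))\<close> beats the growth on a large arc, and the maximum
  principle holds on the half disc. Adding 1 under the root keeps its branch cut away from the
  boundary line. Finally \<open>\<epsilon> \<rightarrow> 0\<close> at fixed
  \<open>s\<close>.\<close>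

lemma Phragmen_Lindelof_half_plane:
  assumes f: "f holomorphic_on {s. Re s > -\<eta>}" and \<eta>: "\<eta> > 0"
    and bd: "\<And>s. Re s = 0 \<Longrightarrow> norm (f s) \<le> 1"
    and gr: "\<And>s. Re s \<ge> 0 \<Longrightarrow> norm (f s) \<le> C * exp (C * (1 + norm s) powr (1/4))" and C: "C > 0"
    and s: "Re s \<ge> 0"
  shows "norm (f s) \<le> 1"
proof -
  have small: "norm (f s) \<le> exp (\<epsilon> * norm (csqrt (1 + s)))" if \<epsilon>: "\<epsilon> > 0" for \<epsilon>
  proof -
    define g where "g = (\<lambda>z. f z * exp (- (of_real \<epsilon> * csqrt (1 + z))))"
    have ng: "norm (g z) = norm (f z) * exp (- (\<epsilon> * Re (csqrt (1 + z))))" for z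
      by (simp add: g_def norm_mult)
    have ev: "eventually (\<lambda>R. C * exp (C * (1 + R) powr (1/4)) * exp (- (\<epsilon> / 2 * sqrt R)) \<le> 1) at_top"
      using C \<epsilon> by real_asymp
    then obtain R0 where R0: "\<And>R. R \<ge> R0 \<Longrightarrow> C * exp (C * (1 + R) powr (1/4)) * exp (- (\<epsilon> / 2 * sqrt R)) \<le> 1"
      by (auto simp: eventually_at_top_linorder)
    define R where "R = max R0 (norm s + 1)"
    have R: "R \<ge> R0" "norm s < R" "R > 0" by (auto simp: R_def intro: add_nonneg_pos simp: less_max_iff_disj)
    define S where "S = ball (0::complex) R \<inter> {z. Re z \<ge> 0}"
    have clS: "closure S \<subseteq> cball 0 R \<inter> {z. Re z \<ge> 0}"
      unfolding S_def by (rule closure_minimal) (auto intro: closed_halfspace_Re_ge)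
    have hol: "g holomorphic_on {z. Re z > - min \<eta> 1}"
      unfolding g_def
    proof (intro holomorphic_intros holomorphic_on_subset[OF f])
      show "1 + z \<notin> \<real>\<^sub>\<le>\<^sub>0" if "z \<in> {z. Re z > - min \<eta> 1}" for z
        using that by (auto simp: complex_nonpos_Reals_iff)
    qed auto
    have sub: "{z. Re z \<ge> 0} \<subseteq> {z. Re z > - min \<eta> 1}" using \<eta> by auto
    have "norm (g s) \<le> 1"
    proof (rule maximum_modulus_frontier[of g S])
      show "g holomorphic_on interior S"
        by (rule holomorphic_on_subset[OF hol]) (use interior_subset[of S] sub in \<open>auto simp: S_def\<close>)
      show "continuous_on (closure S) g"
        by (rule holomorphic_on_imp_continuous_on[OF holomorphic_on_subset[OF hol]]) (use clS sub in auto)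
      show "bounded S" unfolding S_def by (rule bounded_Int) simp
      show "s \<in> S" using R s by (simp add: S_def)
      fix z assume z: "z \<in> frontier S"
      then have z1: "norm z \<le> R" "Re z \<ge> 0" using clS by (auto simp: frontier_def)
      have z2: "Re z = 0 \<or> norm z = R"
      proof (rule ccontr)
        assume n: "\<not> (Re z = 0 \<or> norm z = R)"
        have "ball 0 R \<inter> {z. Re z > 0} \<subseteq> interior S"
          unfolding S_def by (rule interior_maximal) (auto intro: open_halfspace_Re_gt)
        moreover have "z \<in> ball 0 R \<inter> {z. Re z > 0}" using z1 n by (auto simp: less_le)
        ultimately have "z \<in> interior S" by blast
        then show False using z by (simp add: frontier_def)
      qed
      show "norm (g z) \<le> 1"
      proof (cases "Re z = 0")
        case True
        have "norm (f z) * exp (- (\<epsilon> * Re (csqrt (1 + z)))) \<le> 1 * 1"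
          using bd[OF True] \<epsilon> Re_csqrt[of "1 + z"] by (intro mult_mono) auto
        then show ?thesis unfolding ng by simp
      next
        case False
        then have nz: "norm z = R" using z2 by simp
        have "R = norm z" using nz by simp
        also have "norm z \<le> norm (1 + z)"
        proof (rule power2_le_imp_le)
          show "(norm z)\<^sup>2 \<le> (norm (1 + z))\<^sup>2"
            unfolding cmod_power2 using z1 by (simp add: power2_eq_square algebra_simps)
        qed simp
        finally have "sqrt R \<le> sqrt (norm (1 + z))" by (rule real_sqrt_le_mono)
        moreover have "Re (csqrt (1 + z)) \<ge> sqrt (norm (1 + z)) / 2" using z1 by (intro Re_csqrt_ge) simp
        ultimately have "Re (csqrt (1 + z)) \<ge> sqrt R / 2" by linarith
        then have "exp (- (\<epsilon> * Re (csqrt (1 + z)))) \<le> exp (- (\<epsilon> / 2 * sqrt R))"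
          using mult_left_mono[of "sqrt R / 2" "Re (csqrt (1 + z))" \<epsilon>] \<epsilon> by simp
        then have "norm (g z) \<le> C * exp (C * (1 + R) powr (1/4)) * exp (- (\<epsilon> / 2 * sqrt R))"
          unfolding ng using gr[OF z1(2)] nz C by (intro mult_mono) auto
        also have "\<dots> \<le> 1" by (rule R0[OF R(1)])
        finally show ?thesis .
      qed
    qed
    then have "norm (f s) \<le> exp (\<epsilon> * Re (csqrt (1 + s)))" unfolding ng by (simp add: exp_minus divide_simps)
    also have "\<dots> \<le> exp (\<epsilon> * norm (csqrt (1 + s)))" using \<epsilon> complex_Re_le_cmod[of "csqrt (1 + s)"]
      by (simp del: csqrt.sel norm_csqrt)
    finally show ?thesis .
  qed
  have "((\<lambda>\<epsilon>. exp (\<epsilon> * norm (csqrt (1 + s)))) \<longlongrightarrow> exp (0 * norm (csqrt (1 + s)))) (at_right 0)"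
    by (intro tendsto_intros)
  moreover have "eventually (\<lambda>\<epsilon>. norm (f s) \<le> exp (\<epsilon> * norm (csqrt (1 + s)))) (at_right 0)"
    using eventually_at_right_less[of "0::real"] by eventually_elim (rule small)
  ultimately have "norm (f s) \<le> exp (0 * norm (csqrt (1 + s)))"
    by (rule tendsto_lowerbound) simp
  then show ?thesis by simp
qed

text \<open>Euler's products are compared factor by factor. Since
  \<open>norm (z + m) \<ge> 1 + m\<close>, a shift by \<open>h\<close> changes
  \<open>norm (z + m)\<close> by a factor of at most \<open>(1 + h + m) / (1 + m)\<close>, the ratio
  for real argument 1. This bounds the quotient uniformly in \<open>Im z\<close> without
  asymptotics.\<close>

lemma norm_Gamma_ratio_le:
  assumes z: "Re z \<ge> 1" and h: "h \<ge> 0"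
  shows "norm (Gamma z) \<le> Gamma 1 / Gamma (1 + h) * norm (Gamma (z + of_real h))"
proof -
  have nn: "z \<notin> \<int>\<^sub>\<le>\<^sub>0" "z + of_real h \<notin> \<int>\<^sub>\<le>\<^sub>0" using z h by (auto simp: nonpos_Ints_def complex_eq_iff)
  have le: "norm (Gamma_series z n) * norm (Gamma_series (1 + h) n) \<le> norm (Gamma_series (1::real) n) * norm (Gamma_series (z + of_real h) n)"
    for n :: nat
  proof -
    have pz: "norm (pochhammer z (n+1)) > 0" "norm (pochhammer (z + of_real h) (n+1)) > 0"
      using nn by (auto simp: pochhammer_eq_0_iff)
    have p1: "pochhammer (1 + h) (n+1) > 0" "pochhammer (1::real) (n+1) > 0" using h by (auto intro!: pochhammer_pos)
    have key: "norm (pochhammer (z + of_real h) (n+1)) * pochhammer 1 (n+1) \<le> norm (pochhammer z (n+1)) * pochhammer (1 + h) (n+1)"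
    proof (induction n)
      case 0
      have "norm (z + of_real h) \<le> norm z + h * 1" using norm_triangle_ineq[of z "of_real h"] h by simp
      also have "\<dots> \<le> norm z + h * norm z" using complex_Re_le_cmod[of z] z h by (intro add_left_mono mult_left_mono) auto
      finally show ?case by (simp add: algebra_simps)
    next
      case (Suc n)
      let ?m = "real (n + 1)"
      have a: "norm (z + of_real h + of_nat (n+1)) * (1 + ?m) \<le> norm (z + of_nat (n+1)) * (1 + h + ?m)"
      proof -
        have "norm (z + of_real h + of_nat (n+1)) \<le> norm (z + of_nat (n+1)) + h"
          using norm_triangle_ineq[of "z + of_nat (n+1)" "of_real h"] h by (simp add: add_ac)
        moreover have "1 + ?m \<le> norm (z + of_nat (n+1))" using complex_Re_le_cmod[of "z + of_nat (n+1)"] z by simp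
        ultimately have "norm (z + of_real h + of_nat (n+1)) * (1 + ?m) \<le> (norm (z + of_nat (n+1)) + h) * (1 + ?m)"
          "h * (1 + ?m) \<le> h * norm (z + of_nat (n+1))" using h by (auto intro!: mult_right_mono mult_left_mono)
        then show ?thesis by (simp add: algebra_simps)
      qed
      have b: "0 \<le> norm (pochhammer z (n+1)) * pochhammer (1 + h) (n+1)"
        using h pochhammer_pos[of "1 + h" "n+1"] by simp
      have "norm (pochhammer (z + of_real h) (n+1)) * pochhammer 1 (n+1) * (norm (z + of_real h + of_nat (n+1)) * (1 + ?m))
          \<le> norm (pochhammer z (n+1)) * pochhammer (1 + h) (n+1) * (norm (z + of_nat (n+1)) * (1 + h + ?m))"
        by (rule mult_mono[OF Suc.IH a b]) simp
      then show ?case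
        by (simp add: pochhammer_Suc[of _ "Suc n"] norm_mult mult_ac add_ac del: of_nat_Suc)
    qed
    have "n > 0 \<or> n = 0" by auto
    let ?l = "ln (real n)"
    have e: "norm (exp (z * of_real ?l)) * exp ((1 + h) * ?l) = exp ?l * norm (exp ((z + of_real h) * of_real ?l))"
      by (simp add: exp_add[symmetric] algebra_simps)
    have "norm (Gamma_series z n) * norm (Gamma_series (1 + h) n) =
       (fact n * fact n * (exp ?l * norm (exp ((z + of_real h) * of_real ?l)))) / (norm (pochhammer z (n+1)) * pochhammer (1 + h) (n+1))"
      unfolding Gamma_series_def e[symmetric] using p1 by (simp add: norm_divide norm_mult)
    also have "\<dots> \<le> (fact n * fact n * (exp ?l * norm (exp ((z + of_real h) * of_real ?l)))) / (norm (pochhammer (z + of_real h) (n+1)) * pochhammer 1 (n+1))"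
      using key pz p1 by (intro divide_left_mono mult_pos_pos) auto
    also have "\<dots> = norm (Gamma_series (1::real) n) * norm (Gamma_series (z + of_real h) n)"
      unfolding Gamma_series_def using p1 by (simp add: norm_divide norm_mult mult_ac)
    finally show ?thesis .
  qed
  have "(\<lambda>n. norm (Gamma_series z n) * norm (Gamma_series (1 + h) n)) \<longlonglongrightarrow> norm (Gamma z) * norm (Gamma (1 + h))"
    by (intro tendsto_intros Gamma_series_LIMSEQ)
  moreover have "(\<lambda>n. norm (Gamma_series (1::real) n) * norm (Gamma_series (z + of_real h) n)) \<longlonglongrightarrow> norm (Gamma (1::real)) * norm (Gamma (z + of_real h))"
    by (intro tendsto_intros Gamma_series_LIMSEQ)
  ultimately have "norm (Gamma z) * norm (Gamma (1 + h)) \<le> norm (Gamma (1::real)) * norm (Gamma (z + of_real h))"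
    by (rule LIMSEQ_le) (use le in auto)
  moreover have "Gamma (1 + h) > 0" using h by (intro Gamma_real_pos) auto
  ultimately show ?thesis by (simp add: field_simps)
qed

section \<open>Positivity of the logarithmic derivative\<close>

definition xi_logderiv :: "complex \<Rightarrow> complex" where
  "xi_logderiv s = deriv xi_fun (1/2 + s) / xi_fun (1/2 + s)"

text \<open>The two points are mirror images in the critical line, and that reflection is
  \<open>s \<mapsto> 1 - s\<close> followed by conjugation; both preserve the modulus of
  \<open>\<xi>\<close>.\<close>

lemma xi_fun_boundary:
  assumes "Re s = 0" "0 < h" "h < 1/2"
  shows "norm (xi_fun (1/2 + s - of_real h)) = norm (xi_fun (1/2 + s + of_real h))"
proof -
  have "xi_fun (1/2 + s - of_real h) = xi_fun (1 - (1/2 + s - of_real h))" by (rule xi_fun_reflect[symmetric])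
  also have "1 - (1/2 + s - of_real h) = cnj (1/2 + s + of_real h)"
    using assms by (simp add: complex_eq_iff)
  also have "xi_fun (cnj (1/2 + s + of_real h)) = cnj (xi_fun (1/2 + s + of_real h))"
    using assms cnj_xi_right[of "1/2 + s + of_real h"] by (simp add: xi_fun_def)
  finally show ?thesis by simp
qed

lemma ln_le_powr_quarter: "x \<ge> 1 \<Longrightarrow> ln x \<le> 4 * x powr (1/4)" for x :: real
  using ln_powr_bound[of x "1/4"] by simp

text \<open>The estimate \<open>norm (z + n) \<ge> sqrt ((n + 1) * norm z)\<close> turns the Digamma
  series into \<open>sqrt (norm z)\<close> times a convergent series with exponent -3/2. Growth like
  a square root is still integrable against the Poisson kernel.\<close>

lemma Digamma_bound:
  "\<exists>C>0. \<forall>z::complex. Re z \<ge> 1 \<longrightarrow> norm (Digamma z) \<le> C * sqrt (norm z)"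
proof -
  have sm: "summable (\<lambda>n. real (Suc n) powr (-3/2))" by (rule summable_Suc_powr) simp
  define T where "T = (\<Sum>n. real (Suc n) powr (-3/2))"
  have T0: "T \<ge> 0" unfolding T_def by (rule suminf_nonneg[OF sm]) simp
  define K where "K = norm (euler_mascheroni :: complex)"
  have K0: "K \<ge> 0" by (simp add: K_def)
  have bd: "norm (Digamma z) \<le> (2 * T + K) * sqrt (norm z)" if z: "Re z \<ge> 1" for z :: complex
  proof -
    have nz: "norm z \<ge> 1" using complex_Re_le_cmod[of z] z by linarith
    have b: "norm (inverse (of_nat (Suc n)) - inverse (z + of_nat n)) \<le> 2 * sqrt (norm z) * real (Suc n) powr (-3/2)" for n
    proof -
      define m where "m = real (Suc n)"
      have m: "m \<ge> 1" by (simp add: m_def)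
      have zn: "norm (z + of_nat n) \<ge> sqrt (m * norm z)"
      proof -
        \<comment> \<open>Since \<open>Re z \<ge> 1\<close>, the right side is at least
          \<open>norm z ^ 2 + m^2 - 1\<close>, hence at least \<open>2 * m * norm z - 1\<close>, and
          \<open>m * norm z \<ge> 1\<close>.\<close>
        have "m * norm z \<le> (norm (z + of_nat n))\<^sup>2"
        proof -
          have "(m - norm z)\<^sup>2 \<ge> 0" by simp
          then have "2 * (m * norm z) \<le> m\<^sup>2 + (norm z)\<^sup>2" by (simp add: power2_eq_square algebra_simps)
          moreover have "1 * 1 \<le> m * norm z" using m nz by (intro mult_mono) auto
          moreover have "(norm (z + of_nat n))\<^sup>2 = (norm z)\<^sup>2 + 2 * Re z * (m - 1) + (m - 1)\<^sup>2"
            unfolding cmod_power2 m_def by (simp add: power2_eq_square algebra_simps)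
          moreover have "2 * 1 * (m - 1) \<le> 2 * Re z * (m - 1)" using z m by (intro mult_right_mono) auto
          ultimately show ?thesis by (simp add: power2_eq_square algebra_simps)
        qed
        then show ?thesis by (intro real_le_lsqrt) (use m in auto)
      qed
      have "m * norm z > 0" using m nz by (intro mult_pos_pos) linarith+
      then have pos: "sqrt (m * norm z) > 0" by simp
      have z0: "z + of_nat n \<noteq> 0" using zn pos by auto
      have mc: "of_nat (Suc n) = complex_of_real m" by (simp add: m_def)
      have "inverse (of_nat (Suc n)) - inverse (z + of_nat n) = (z - 1) / (of_real m * (z + of_nat n))"
        using z0 m unfolding mc by (simp add: divide_simps) (simp add: m_def)
      then have "norm (inverse (of_nat (Suc n)) - inverse (z + of_nat n)) = norm (z - 1) / (m * norm (z + of_nat n))"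
        using m by (simp add: norm_divide norm_mult)
      also have "\<dots> \<le> (2 * norm z) / (m * sqrt (m * norm z))"
        using norm_triangle_ineq4[of z 1] nz zn pos m by (intro frac_le mult_left_mono) auto
      also have "\<dots> = 2 * sqrt (norm z) * (1 / (m * sqrt m))"
      proof -
        define q where "q = sqrt (norm z)"
        have q: "norm z = q * q" "q > 0" using nz by (auto simp: q_def)
        have "2 * (q * q) / (m * (sqrt m * q)) = 2 * q * (1 / (m * sqrt m))" using q(2) by simp
        then show ?thesis unfolding q_def[symmetric] real_sqrt_mult by (simp only: q(1)[symmetric])
      qed
      also have "1 / (m * sqrt m) = m powr (-3/2)"
      proof -
        have "m powr (-3/2) = 1 / m powr (1 + 1/2)" by (simp add: powr_minus_divide)
        also have "m powr (1 + 1/2) = m * sqrt m" using m by (subst powr_add) (simp add: powr_half_sqrt)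
        finally show ?thesis by simp
      qed
      finally show ?thesis by (simp add: m_def)
    qed
    have s2: "summable (\<lambda>n. 2 * sqrt (norm z) * real (Suc n) powr (-3/2))" by (rule summable_mult[OF sm])
    have "norm (\<Sum>n. inverse (of_nat (Suc n)) - inverse (z + of_nat n)) \<le> (\<Sum>n. 2 * sqrt (norm z) * real (Suc n) powr (-3/2))"
      by (rule norm_suminf_le[OF b s2])
    also have "\<dots> = 2 * sqrt (norm z) * T" unfolding T_def by (rule suminf_mult[OF sm])
    finally have 1: "norm (\<Sum>n. inverse (of_nat (Suc n)) - inverse (z + of_nat n)) \<le> 2 * sqrt (norm z) * T" .
    have "norm (Digamma z) \<le> 2 * sqrt (norm z) * T + K"
      unfolding Digamma_def K_def by (rule order_trans[OF norm_triangle_ineq4 add_right_mono[OF 1]])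
    also have "K \<le> K * sqrt (norm z)" using mult_left_mono[of 1 "sqrt (norm z)" K] nz by (simp add: K_def)
    finally show ?thesis by (simp add: algebra_simps)
  qed
  show ?thesis
  proof (intro exI conjI allI impI)
    show "2 * T + K + 1 > 0" using T0 K0 by simp
    fix z :: complex assume "Re z \<ge> 1"
    then have "norm (Digamma z) \<le> (2 * T + K) * sqrt (norm z)" by (rule bd)
    also have "\<dots> \<le> (2 * T + K + 1) * sqrt (norm z)" by (intro mult_right_mono) auto
    finally show "norm (Digamma z) \<le> (2 * T + K + 1) * sqrt (norm z)" .
  qed
qed

context
  assumes RH: riemann_hypothesis
begin

lemma xi_fun_nonzero_RH: "Re w \<noteq> 1/2 \<Longrightarrow> xi_fun w \<noteq> 0"
  using RH by (auto simp: riemann_hypothesis_def xi_eq)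

text \<open>For fixed \<open>h\<close> the denominator is evaluated at distance at least
  \<open>h\<close> to the right of the critical line, where the hypothesis gives a lower bound for
  \<open>zeta_num\<close>; the Gamma factors cancel up to a constant by
  \<open>norm_Gamma_ratio_le\<close>. Constants may depend on \<open>h\<close>, because
  Phragmen--Lindelof returns the bound 1 regardless.\<close>

lemma xi_fun_mono:
  assumes h: "0 < h" "h < 1/2" and s: "Re s \<ge> 0"
  shows "norm (xi_fun (1/2 + s - of_real h)) \<le> norm (xi_fun (1/2 + s + of_real h))"
proof -
  define f where "f = (\<lambda>s. xi_fun (1/2 + s - of_real h) / xi_fun (1/2 + s + of_real h))"
  have nz: "xi_fun (1/2 + s + of_real h) \<noteq> 0" if "Re s > -h" for s
    using that by (intro xi_fun_nonzero_RH) auto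
  have hol: "f holomorphic_on {s. Re s > -h}"
  proof -
    have "(\<lambda>s. xi_fun ((1/2 - of_real h) + s)) holomorphic_on {s. Re s > -h}" "(\<lambda>s. xi_fun ((1/2 + of_real h) + s)) holomorphic_on {s. Re s > -h}"
      by (rule holomorphic_on_shift[OF holomorphic_xi_fun])+
    then have "(\<lambda>s. xi_fun (1/2 + s - of_real h)) holomorphic_on {s. Re s > -h}" "(\<lambda>s. xi_fun (1/2 + s + of_real h)) holomorphic_on {s. Re s > -h}"
      by (simp_all add: algebra_simps)
    then show ?thesis unfolding f_def using nz by (intro holomorphic_intros) auto
  qed
  obtain A where A: "A > 0" "\<And>s. Re s \<ge> 0 \<Longrightarrow> norm (zeta_num s) \<le> A * (1 + norm s) ^ 3"
    using norm_zeta_num_le by blast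
  obtain C where C: "C > 0" "\<And>w. Re w \<ge> 1/2 + h \<Longrightarrow> norm (zeta_num w) \<ge> exp (- (C * (1 + norm w) powr (1/4)))"
    using zeta_num_bounds_RH[OF RH, of h] h by auto
  \<comment> \<open>The factor 8 is the cube of 2 in
    \<open>1 + norm w1 \<le> 2 * (1 + norm s)\<close>.\<close>
  define g where "g = pi powr h * (1 / Gamma (1 + h)) * (A * 8)"
  have Gh: "Gamma (1 + h) > 0" using h by (intro Gamma_real_pos) auto
  have g0: "g > 0" using Gh A by (simp add: g_def)
  define B where "B = max g (12 + 2 * C)"
  have gr: "norm (f s) \<le> B * exp (B * (1 + norm s) powr (1/4))" if s: "Re s \<ge> 0" for s
  proof -
    define w1 where "w1 = 1/2 + s - of_real h"
    define w2 where "w2 = 1/2 + s + of_real h"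
    define p where "p = (1 + norm s) powr (1/4)"
    have R: "Re w1 > 0" "Re w2 \<ge> 1/2 + h" "Re w1 \<ge> 0" using h s by (auto simp: w1_def w2_def)
    have n1: "norm w1 \<le> norm s + 1"
    proof -
      have "w1 = s + of_real (1/2 - h)" by (simp add: w1_def)
      then have "norm w1 \<le> norm s + norm (complex_of_real (1/2 - h))" by (simp only: norm_triangle_ineq)
      then show ?thesis using h unfolding norm_of_real by simp
    qed
    have n2: "norm w2 \<le> norm s + 1"
    proof -
      have "w2 = s + of_real (1/2 + h)" by (simp add: w2_def)
      then have "norm w2 \<le> norm s + norm (complex_of_real (1/2 + h))" by (simp only: norm_triangle_ineq)
      then show ?thesis using h unfolding norm_of_real by simp
    qed
    have "norm (zeta_num w1) \<le> A * (1 + norm w1) ^ 3" by (rule A(2)[OF R(3)])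
    also have "1 + norm w1 \<le> 2 * (1 + norm s)" using n1 norm_ge_zero[of s] unfolding distrib_left by linarith
    then have "A * (1 + norm w1) ^ 3 \<le> A * (2 * (1 + norm s)) ^ 3" using A(1) by (intro mult_left_mono power_mono) auto
    also have "\<dots> = A * 8 * (1 + norm s) ^ 3" by (simp only: power_mult_distrib) simp
    also have "(1 + norm s) ^ 3 \<le> exp (12 * p)"
    proof -
      have "(1 + norm s) ^ 3 = exp (3 * ln (1 + norm s))"
        by (simp add: exp_of_nat_mult[of 3, simplified] add_pos_nonneg)
      also have "\<dots> \<le> exp (12 * p)" using ln_le_powr_quarter[of "1 + norm s"] by (simp add: p_def)
      finally show ?thesis .
    qed
    finally have E1: "norm (zeta_num w1) \<le> A * 8 * exp (12 * p)" using A(1) by simp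
    have p2: "(1 + norm w2) powr (1/4) \<le> 2 * p"
    proof -
      have "1 + norm w2 \<le> 2 * (1 + norm s)" using n2 norm_ge_zero[of s] unfolding distrib_left by linarith
      then have "(1 + norm w2) powr (1/4) \<le> (2 * (1 + norm s)) powr (1/4)" by (intro powr_mono2) auto
      also have "\<dots> = 2 powr (1/4) * p" unfolding p_def by (rule powr_mult)
      also have "\<dots> \<le> 2 powr 1 * p" by (intro mult_right_mono powr_mono) (auto simp: p_def)
      finally show ?thesis by simp
    qed
    have "exp (- (2 * C * p)) \<le> exp (- (C * (1 + norm w2) powr (1/4)))"
      using mult_left_mono[OF p2, of C] C(1) by simp
    also have "\<dots> \<le> norm (zeta_num w2)" by (rule C(2)[OF R(2)])
    finally have E2: "norm (zeta_num w2) \<ge> exp (- (2 * C * p))" .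
    have G2: "w2 / 2 + 1 = (w1 / 2 + 1) + of_real h" by (simp add: w1_def w2_def field_simps)
    have G: "norm (Gamma (w1 / 2 + 1)) \<le> 1 / Gamma (1 + h) * norm (Gamma (w2 / 2 + 1))"
      unfolding G2 using norm_Gamma_ratio_le[of "w1 / 2 + 1" h] R h by simp
    have "w2 / 2 + 1 \<notin> \<int>\<^sub>\<le>\<^sub>0" using R h by (auto simp: nonpos_Ints_def complex_eq_iff)
    then have "Gamma (w2 / 2 + 1) \<noteq> 0" by (simp add: Gamma_eq_zero_iff)
    then have Gpos: "norm (Gamma (w2 / 2 + 1)) > 0" by simp
    have P: "norm (of_real pi powr (- w1 / 2) :: complex) = pi powr h * norm (of_real pi powr (- w2 / 2) :: complex)"
    proof -
      have "Re (- w1 / 2) = h + Re (- w2 / 2)" by (simp add: w1_def w2_def field_simps)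
      moreover have "norm (of_real pi powr z :: complex) = pi powr Re z" for z by (subst norm_powr_real_powr) auto
      ultimately show ?thesis by (simp only: powr_add)
    qed
    define P2 where "P2 = norm (of_real pi powr (- w2 / 2) :: complex)"
    have P2: "P2 > 0" by (simp add: P2_def)
    have "norm (xi_fun w1) = pi powr h * P2 * norm (Gamma (w1 / 2 + 1)) * norm (zeta_num w1)"
      using R unfolding P2_def P[symmetric] by (simp add: xi_fun_def xi_right_def norm_mult)
    also have "\<dots> \<le> pi powr h * P2 * (1 / Gamma (1 + h) * norm (Gamma (w2 / 2 + 1))) * (A * 8 * exp (12 * p))"
      using G E1 P2 A(1) Gh by (intro mult_mono mult_left_mono) auto
    also have "\<dots> = g * exp (12 * p) * (P2 * norm (Gamma (w2 / 2 + 1)))" by (simp add: g_def)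
    finally have X1: "norm (xi_fun w1) \<le> g * exp (12 * p) * (P2 * norm (Gamma (w2 / 2 + 1)))" .
    have "norm (xi_fun w2) = P2 * norm (Gamma (w2 / 2 + 1)) * norm (zeta_num w2)"
      using R h by (simp add: xi_fun_def xi_right_def norm_mult P2_def)
    also have "\<dots> \<ge> P2 * norm (Gamma (w2 / 2 + 1)) * exp (- (2 * C * p))"
      using E2 P2 by (intro mult_left_mono) auto
    finally have X2: "norm (xi_fun w2) \<ge> P2 * norm (Gamma (w2 / 2 + 1)) * exp (- (2 * C * p))" .
    have "norm (f s) = norm (xi_fun w1) / norm (xi_fun w2)" by (simp add: f_def w1_def w2_def norm_divide)
    also have "\<dots> \<le> (g * exp (12 * p) * (P2 * norm (Gamma (w2 / 2 + 1)))) / (P2 * norm (Gamma (w2 / 2 + 1)) * exp (- (2 * C * p)))"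
      using X1 X2 P2 Gpos g0 by (intro frac_le) auto
    also have "\<dots> = g * (exp (12 * p) * exp (2 * C * p))" using P2 Gpos by (simp add: exp_minus field_simps)
    also have "exp (12 * p) * exp (2 * C * p) = exp ((12 + 2 * C) * p)" by (simp add: exp_add[symmetric] algebra_simps)
    also have "g * exp ((12 + 2 * C) * p) \<le> B * exp (B * p)"
      using g0 by (intro mult_mono) (auto simp: B_def p_def intro!: mult_right_mono)
    finally show ?thesis by (simp add: p_def)
  qed
  have B: "B > 0" using g0 by (simp add: B_def)
  have bd: "norm (f s) \<le> 1" if "Re s = 0" for s
    using xi_fun_boundary[OF that h] by (simp add: f_def norm_divide)
  have "norm (f s) \<le> 1" by (rule Phragmen_Lindelof_half_plane[OF hol h(1) bd gr B s])
  then show ?thesis using nz[of s] h s by (simp add: f_def norm_divide divide_simps split: if_splits)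
qed

text \<open>The quotient \<open>\<xi>(w + h) / \<xi>(w - h) = 1 + h q(h)\<close> has modulus at
  least 1, and \<open>q(h)\<close> tends to twice the logarithmic derivative. Expanding the squared
  modulus and dividing by \<open>h\<close> gives \<open>2 Re q + h |q|^2 \<ge> 0\<close>, whose
  limit is the claim.\<close>

lemma Re_xi_logderiv_nonneg:
  assumes s: "Re s > 0" shows "Re (xi_logderiv s) \<ge> 0"
proof -
  define w where "w = 1/2 + s"
  have w: "xi_fun w \<noteq> 0" using s by (intro xi_fun_nonzero_RH) (simp add: w_def)
  define g where "g = (\<lambda>h. xi_fun (w + h) / xi_fun (w - h))"
  define q where "q = (\<lambda>h::real. (g (of_real h) - 1) / of_real h)"
  have dx: "(xi_fun has_field_derivative deriv xi_fun w) (at w)"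
    by (rule holomorphic_derivI[OF holomorphic_xi_fun[of UNIV]]) auto
  have d1: "((\<lambda>h. xi_fun (w + h)) has_field_derivative deriv xi_fun w * 1) (at 0)"
    using dx by (intro DERIV_chain2[where f = xi_fun]) (auto intro!: derivative_eq_intros)
  have d2: "((\<lambda>h. xi_fun (w - h)) has_field_derivative deriv xi_fun w * (-1)) (at 0)"
    using dx by (intro DERIV_chain2[where f = xi_fun]) (auto intro!: derivative_eq_intros)
  have "(g has_field_derivative (deriv xi_fun w * 1 * xi_fun (w - 0) - xi_fun (w + 0) * (deriv xi_fun w * (-1))) / (xi_fun (w - 0) * xi_fun (w - 0))) (at 0)"
    unfolding g_def by (rule DERIV_divide[OF d1 d2]) (use w in simp)
  also have "(deriv xi_fun w * 1 * xi_fun (w - 0) - xi_fun (w + 0) * (deriv xi_fun w * (-1))) / (xi_fun (w - 0) * xi_fun (w - 0)) = 2 * xi_logderiv s"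
    unfolding xi_logderiv_def w_def[symmetric] using w by (simp add: field_simps)
  finally have "(\<lambda>h. (g h - 1) / h) \<midarrow>0\<rightarrow> 2 * xi_logderiv s"
    using w by (simp add: has_field_derivative_iff g_def)
  moreover have "filterlim (\<lambda>h::real. complex_of_real h) (at 0) (at_right 0)"
    by (auto simp: filterlim_at intro!: tendsto_eq_intros eventually_at_right_less[THEN eventually_mono])
  ultimately have lim: "(q \<longlongrightarrow> 2 * xi_logderiv s) (at_right 0)"
    unfolding q_def by (rule filterlim_compose)
  have ev: "eventually (\<lambda>h. 2 * Re (q h) + h * (norm (q h))\<^sup>2 \<ge> 0) (at_right (0::real))"
  proof -
    have "eventually (\<lambda>h. h \<in> {0<..<min (1/2) (Re s)}) (at_right (0::real))" by (rule eventually_at_right_real) (use s in simp)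
    then show ?thesis
    proof eventually_elim
      case (elim h)
      then have h: "0 < h" "h < 1/2" "h < Re s" by auto
      have le: "norm (xi_fun (w - of_real h)) \<le> norm (xi_fun (w + of_real h))"
        using xi_fun_mono[OF h(1,2), of s] s by (simp add: w_def)
      have "xi_fun (w - of_real h) \<noteq> 0" using h by (intro xi_fun_nonzero_RH) (simp add: w_def)
      then have "1 \<le> norm (g (of_real h))" using le by (simp add: g_def norm_divide divide_simps)
      moreover have "g (of_real h) = 1 + of_real h * q h" using h by (simp add: q_def)
      ultimately have "1\<^sup>2 \<le> (norm (1 + of_real h * q h))\<^sup>2" by (intro power_mono) auto
      then have "0 \<le> h * (2 * Re (q h) + h * (norm (q h))\<^sup>2)"
        unfolding cmod_power2 by (simp add: power2_eq_square algebra_simps)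
      then show ?case using h by (simp add: zero_le_mult_iff)
    qed
  qed
  have "((\<lambda>h. 2 * Re (q h) + h * (norm (q h))\<^sup>2) \<longlongrightarrow> 2 * Re (2 * xi_logderiv s) + 0 * (norm (2 * xi_logderiv s))\<^sup>2) (at_right 0)"
    by (intro tendsto_intros lim)
  then have "0 \<le> 2 * Re (2 * xi_logderiv s) + 0 * (norm (2 * xi_logderiv s))\<^sup>2"
    by (rule tendsto_lowerbound[OF _ ev]) simp
  then show ?thesis by simp
qed

lemma xi_logderiv_eq:
  assumes s: "Re s > 0"
  shows "xi_logderiv s = - of_real (ln pi) / 2 + Digamma ((1/2 + s) / 2 + 1) / 2 + deriv zeta_num (1/2 + s) / zeta_num (1/2 + s)"
proof -
  define w where "w = 1/2 + s"
  have w: "Re w > 1/2" using s by (simp add: w_def)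
  have nz: "zeta_num w \<noteq> 0" by (rule zeta_num_nonzero[OF RH w])
  have nn: "w / 2 + 1 \<notin> (\<int>\<^sub>\<le>\<^sub>0 :: complex set)" using w by (auto simp: nonpos_Ints_def complex_eq_iff)
  have Lnpi: "Ln (of_real pi) = of_real (ln pi)" by (rule Ln_of_real) simp
  define P where "P = of_real pi powr (- w / 2)"
  define G where "G = Gamma (w / 2 + 1)"
  have P0: "P \<noteq> 0" "G \<noteq> 0" using nn by (auto simp: P_def G_def Gamma_eq_zero_iff)
  have d1: "((\<lambda>z. of_real pi powr (- z / 2)) has_field_derivative (of_real (ln pi) * P) * (-1/2)) (at w)"
    unfolding P_def using has_field_derivative_powr_right[of "of_real pi" "- w / 2"] Lnpi
    by (intro DERIV_chain2[where f = "\<lambda>s. of_real pi powr s" and g = "\<lambda>z. -z/2"]) (auto intro!: derivative_eq_intros)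
  have d2: "((\<lambda>z. Gamma (z / 2 + 1)) has_field_derivative (G * Digamma (w / 2 + 1)) * (1/2)) (at w)"
    unfolding G_def using nn
    by (intro DERIV_chain2[where f = Gamma and g = "\<lambda>z. z/2+1"]) (auto intro!: derivative_eq_intros)
  have d3: "(zeta_num has_field_derivative deriv zeta_num w) (at w)"
    by (rule holomorphic_derivI[OF holomorphic_zeta_num open_halfspace_Re_gt]) (use w in simp)
  have "(xi_right has_field_derivative ((of_real (ln pi) * P) * (-1/2) * G + (G * Digamma (w / 2 + 1)) * (1/2) * P) * zeta_num w
     + deriv zeta_num w * (P * G)) (at w)"
    unfolding xi_right_def[abs_def] P_def G_def by (rule DERIV_mult[OF DERIV_mult[OF d1[unfolded P_def] d2[unfolded G_def]] d3])
  then have "(xi_fun has_field_derivative ((of_real (ln pi) * P) * (-1/2) * G + (G * Digamma (w / 2 + 1)) * (1/2) * P) * zeta_num w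
     + deriv zeta_num w * (P * G)) (at w)"
    by (rule has_field_derivative_transform_within_open[OF _ open_halfspace_Re_gt[of "-1"]]) (use w in \<open>auto simp: xi_fun_def\<close>)
  then have "deriv xi_fun w = ((of_real (ln pi) * P) * (-1/2) * G + (G * Digamma (w / 2 + 1)) * (1/2) * P) * zeta_num w
     + deriv zeta_num w * (P * G)" by (rule DERIV_imp_deriv)
  moreover have "xi_fun w = P * G * zeta_num w" using w by (simp add: xi_fun_def xi_right_def P_def G_def)
  ultimately show ?thesis unfolding xi_logderiv_def w_def[symmetric] using P0 nz by (simp add: field_simps)
qed

lemma holomorphic_xi_logderiv: "xi_logderiv holomorphic_on {s. Re s > 0}"
  unfolding xi_logderiv_def
  by (intro holomorphic_intros holomorphic_on_shift holomorphic_deriv_xi_fun holomorphic_xi_fun)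
     (use xi_fun_nonzero_RH in auto)

text \<open>Supplies the growth condition of \<open>Poisson_half_plane\<close> on the shifted half
  plane. The Digamma term dictates the square root; the zeta term is smaller.\<close>

lemma xi_logderiv_bound:
  assumes a: "0 < a" "a \<le> 1/2"
  shows "\<exists>C>0. \<forall>z. Re z \<ge> 0 \<longrightarrow> norm (xi_logderiv (of_real a + z)) \<le> C * sqrt (1 + norm z)"
proof -
  obtain C1 where C1: "C1 > 0" "\<And>z::complex. Re z \<ge> 1 \<Longrightarrow> norm (Digamma z) \<le> C1 * sqrt (norm z)"
    using Digamma_bound by blast
  obtain C2 where C2: "C2 > 0" "\<And>w. Re w \<ge> 1/2 + a \<Longrightarrow> norm (deriv zeta_num w / zeta_num w) \<le> C2 * (1 + norm w) powr (1/4)"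
    using zeta_num_bounds_RH[OF RH a] by blast
  define C where "C = \<bar>ln pi\<bar> / 2 + C1 + 2 * C2"
  have "norm (xi_logderiv (of_real a + z)) \<le> C * sqrt (1 + norm z)" if z: "Re z \<ge> 0" for z
  proof -
    define w where "w = 1/2 + (of_real a + z)"
    define r where "r = sqrt (1 + norm z)"
    have r: "r \<ge> 1" by (simp add: r_def)
    have wn: "norm w \<le> norm z + 1"
    proof -
      have "w = z + of_real (1/2 + a)" by (simp add: w_def)
      then have "norm w \<le> norm z + norm (complex_of_real (1/2 + a))" by (simp only: norm_triangle_ineq)
      then show ?thesis using a unfolding norm_of_real by simp
    qed
    have Rw: "Re w \<ge> 1/2 + a" using z by (simp add: w_def)
    have "norm (Digamma (w / 2 + 1)) \<le> C1 * sqrt (norm (w / 2 + 1))" using Rw a by (intro C1) auto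
    also have "norm (w / 2 + 1) \<le> 4 * (1 + norm z)"
    proof -
      have "norm (w / 2 + 1) \<le> norm w / 2 + 1" using norm_triangle_ineq[of "w/2" 1] by (simp add: norm_divide)
      then show ?thesis using wn norm_ge_zero[of z] unfolding distrib_left by linarith
    qed
    then have "sqrt (norm (w / 2 + 1)) \<le> sqrt (4 * (1 + norm z))" by (rule real_sqrt_le_mono)
    then have "sqrt (norm (w / 2 + 1)) \<le> 2 * r" by (simp only: real_sqrt_mult real_sqrt_four r_def)
    then have "C1 * sqrt (norm (w / 2 + 1)) \<le> C1 * (2 * r)" using C1 by (intro mult_left_mono) auto
    finally have 1: "norm (Digamma (w / 2 + 1)) \<le> C1 * (2 * r)" .
    have "norm (deriv zeta_num w / zeta_num w) \<le> C2 * (1 + norm w) powr (1/4)" by (rule C2(2)[OF Rw])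
    also have "(1 + norm w) powr (1/4) \<le> (1 + norm w) powr (1/2)" by (rule powr_mono) auto
    also have "1 + norm w \<le> 4 * (1 + norm z)" using wn norm_ge_zero[of z] unfolding distrib_left by linarith
    then have "(1 + norm w) powr (1/2) \<le> (4 * (1 + norm z)) powr (1/2)" by (intro powr_mono2) auto
    also have "(4 * (1 + norm z)) powr (1/2) = sqrt (4 * (1 + norm z))" by (rule powr_half_sqrt) simp
    also have "sqrt (4 * (1 + norm z)) = 2 * r" by (simp only: real_sqrt_mult real_sqrt_four r_def)
    finally have 2: "norm (deriv zeta_num w / zeta_num w) \<le> C2 * (2 * r)" using C2(1) by simp
    have "xi_logderiv (of_real a + z) = (- of_real (ln pi) / 2 + Digamma (w / 2 + 1) / 2) + deriv zeta_num w / zeta_num w"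
      unfolding w_def using a z by (intro xi_logderiv_eq) simp
    then have "norm (xi_logderiv (of_real a + z)) \<le> norm (- of_real (ln pi) / 2 :: complex) + norm (Digamma (w / 2 + 1) / 2) + norm (deriv zeta_num w / zeta_num w)"
      by (simp only:) (intro order_trans[OF norm_triangle_ineq] add_mono norm_triangle_ineq order_refl)
    also have "\<dots> \<le> \<bar>ln pi\<bar> / 2 * r + C1 * r + C2 * (2 * r)"
    proof (intro add_mono 2)
      have "norm (- of_real (ln pi) / 2 :: complex) = \<bar>ln pi\<bar> / 2" by (simp add: norm_divide)
      also have "\<dots> \<le> \<bar>ln pi\<bar> / 2 * r" using mult_left_mono[OF r, of "\<bar>ln pi\<bar> / 2"] by simp
      finally show "norm (- of_real (ln pi) / 2 :: complex) \<le> \<bar>ln pi\<bar> / 2 * r" .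
      show "norm (Digamma (w / 2 + 1) / 2) \<le> C1 * r" using 1 by (simp add: norm_divide)
    qed
    also have "\<dots> = C * r" by (simp add: C_def algebra_simps)
    finally show ?thesis by (simp add: r_def)
  qed
  moreover have "C > 0" using C1 C2 by (simp add: C_def add_nonneg_pos add_pos_pos)
  ultimately show ?thesis by blast
qed

end

section \<open>The Poisson formula on a half plane\<close>

lemma has_bochner_integral_even:
  fixes f :: "real \<Rightarrow> real"
  assumes "has_bochner_integral lborel (\<lambda>x. indicator {0..} x * f x) v" and even: "\<And>x. f (-x) = f x"
  shows "has_bochner_integral lborel f (2 * v)"
proof -
  have "has_bochner_integral lborel (\<lambda>x. indicator {0..} (0 + (-1) * x) * f (0 + (-1) * x)) (v /\<^sub>R \<bar>-1\<bar>)"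
    using assms(1) by (subst lborel_has_bochner_integral_real_affine_iff[symmetric]) auto
  then have "has_bochner_integral lborel (\<lambda>x. indicator {..0} x * f x) v"
    by (simp add: even indicator_def)
  from has_bochner_integral_add[OF assms(1) this]
  have 1: "has_bochner_integral lborel (\<lambda>x. indicator {0..} x * f x + indicator {..0} x * f x) (2 * v)" by simp
  have "(\<lambda>x. indicator {0..} x * f x + indicator {..0} x * f x) \<in> borel_measurable lborel"
    using 1 by (auto simp: has_bochner_integral_iff)
  \<comment> \<open>The origin is counted in both halves. Subtracting it once recovers
    \<open>f\<close> exactly, which gives its measurability and not only equality almost
    everywhere.\<close>
  then have m: "(\<lambda>x. (indicator {0..} x * f x + indicator {..0} x * f x) - indicator {0} x * f 0) \<in> borel_measurable borel"
    by measurable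
  have "(indicator {0..} x * f x + indicator {..0} x * f x) - indicator {0} x * f 0 = f x" for x
    by (auto simp: indicator_def)
  with m have fm: "f \<in> borel_measurable lborel" by simp
  have "AE x in lborel. x \<noteq> (0::real)" by (rule AE_lborel_singleton)
  then have "AE x in lborel. indicator {0..} x * f x + indicator {..0} x * f x = f x"
    by eventually_elim (auto simp: indicator_def)
  then show ?thesis
    using has_bochner_integral_cong_AE[of "\<lambda>x. indicator {0..} x * f x + indicator {..0} x * f x" lborel f "2 * v"] 1 fm
    by (auto simp: has_bochner_integral_iff)
qed

lemma has_bochner_integral_Cauchy_kernel:
  fixes s :: real
  assumes s: "s > 0"
  shows "has_bochner_integral lborel (\<lambda>y. s / (s\<^sup>2 + y\<^sup>2)) pi"
proof -
  have pos: "s\<^sup>2 + y\<^sup>2 > 0" for y :: real using s by (simp add: add_pos_nonneg)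
  have "(\<integral>\<^sup>+y. ennreal (s / (s\<^sup>2 + y\<^sup>2)) * indicator {0..} y \<partial>lborel) = ennreal (pi / 2 - arctan (0 / s))"
  proof (rule nn_integral_FTC_atLeast)
    show "((\<lambda>y. arctan (y / s)) has_real_derivative s / (s\<^sup>2 + y\<^sup>2)) (at y)" for y
    proof -
      have "((\<lambda>y. arctan (y / s)) has_real_derivative inverse (1 + (y / s)\<^sup>2) * (1 / s)) (at y)"
        by (rule DERIV_chain2[OF DERIV_arctan]) (use s in \<open>auto intro!: derivative_eq_intros\<close>)
      also have "inverse (1 + (y / s)\<^sup>2) * (1 / s) = s / (s\<^sup>2 + y\<^sup>2)"
        using s pos[of y] by (simp add: field_simps power2_eq_square)
      finally show ?thesis .
    qed
    show "0 \<le> s / (s\<^sup>2 + y\<^sup>2)" for y using s pos[of y] by simp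
    have "filterlim (\<lambda>y. y / s) at_top at_top" using s by real_asymp
    then show "((\<lambda>y. arctan (y / s)) \<longlongrightarrow> pi / 2) at_top"
      by (rule filterlim_compose[OF tendsto_arctan_at_top])
  qed measurable
  also have "(\<integral>\<^sup>+y. ennreal (s / (s\<^sup>2 + y\<^sup>2)) * indicator {0..} y \<partial>lborel) = (\<integral>\<^sup>+y. ennreal (indicator {0..} y * (s / (s\<^sup>2 + y\<^sup>2))) \<partial>lborel)"
    by (intro nn_integral_cong) (auto simp: indicator_def)
  finally have "(\<integral>\<^sup>+y. ennreal (indicator {0..} y * (s / (s\<^sup>2 + y\<^sup>2))) \<partial>lborel) = ennreal (pi / 2)" by simp
  then have "has_bochner_integral lborel (\<lambda>y. indicator {0..} y * (s / (s\<^sup>2 + y\<^sup>2))) (pi / 2)"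
    by (intro has_bochner_integral_nn_integral) (use s pos in \<open>auto simp: indicator_def less_imp_le\<close>)
  from has_bochner_integral_even[OF this] show ?thesis by simp
qed

lemma integrable_sqrt_Cauchy:
  fixes s :: real
  assumes s: "s > 0"
  shows "integrable lborel (\<lambda>y. sqrt (1 + \<bar>y\<bar>) / (s\<^sup>2 + y\<^sup>2))"
proof -
  have "(\<integral>\<^sup>+y. ennreal ((1 + y) powr (-3/2)) * indicator {0..} y \<partial>lborel) = ennreal (0 - (- 2 * (1 + 0) powr (-1/2)))"
  proof (rule nn_integral_FTC_atLeast)
    show "((\<lambda>y. - 2 * (1 + y) powr (-1/2)) has_real_derivative (1 + y) powr (-3/2)) (at y)" if "0 \<le> y" for y :: real
      using that by (auto intro!: derivative_eq_intros)
    show "((\<lambda>y::real. - 2 * (1 + y) powr (-1/2)) \<longlongrightarrow> 0) at_top" by real_asymp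
  qed auto
  also have "(\<integral>\<^sup>+y. ennreal ((1 + y) powr (-3/2)) * indicator {0..} y \<partial>lborel) = (\<integral>\<^sup>+y. ennreal (indicator {0..} y * (1 + \<bar>y\<bar>) powr (-3/2)) \<partial>lborel)"
    by (intro nn_integral_cong) (auto simp: indicator_def)
  finally have "(\<integral>\<^sup>+y. ennreal (indicator {0..} y * (1 + \<bar>y\<bar>) powr (-3/2)) \<partial>lborel) = ennreal 2" by simp
  then have "has_bochner_integral lborel (\<lambda>y::real. indicator {0..} y * (1 + \<bar>y\<bar>) powr (-3/2)) 2"
    by (intro has_bochner_integral_nn_integral) (auto simp: indicator_def)
  from has_bochner_integral_even[OF this] have I: "integrable lborel (\<lambda>y::real. (1 + \<bar>y\<bar>) powr (-3/2))"
    by (simp add: has_bochner_integral_iff)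
  \<comment> \<open>From \<open>(1 + |y|)^2 \<le> 2 * (1 + y^2)\<close> and
    \<open>(min 1 s)^2 * (1 + y^2) \<le> s^2 + y^2\<close>.\<close>
  define c where "c = 2 / (min 1 s)\<^sup>2"
  have mp: "min 1 s > 0" using s by simp
  have "integrable lborel (\<lambda>y::real. c * (1 + \<bar>y\<bar>) powr (-3/2))" using I by (rule integrable_mult_right)
  then show ?thesis
  proof (rule Bochner_Integration.integrable_bound)
    show "AE y in lborel. norm (sqrt (1 + \<bar>y\<bar>) / (s\<^sup>2 + y\<^sup>2)) \<le> norm (c * (1 + \<bar>y\<bar>) powr (-3/2))"
    proof (intro AE_I2)
      fix y :: real
      define q where "q = 1 + \<bar>y\<bar>"
      have q: "q \<ge> 1" by (simp add: q_def)
      have "(min 1 s)\<^sup>2 * q\<^sup>2 \<le> 2 * (s\<^sup>2 + y\<^sup>2)"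
      proof -
        have "(1 - \<bar>y\<bar>)\<^sup>2 \<ge> 0" by simp
        then have "q\<^sup>2 \<le> 2 * (1 + y\<^sup>2)" by (simp add: q_def power2_eq_square algebra_simps)
        then have "(min 1 s)\<^sup>2 * q\<^sup>2 \<le> (min 1 s)\<^sup>2 * (2 * (1 + y\<^sup>2))" by (intro mult_left_mono) auto
        also have "\<dots> = 2 * ((min 1 s)\<^sup>2 + (min 1 s)\<^sup>2 * y\<^sup>2)" by (simp add: algebra_simps)
        also have "\<dots> \<le> 2 * (s\<^sup>2 + 1\<^sup>2 * y\<^sup>2)"
          using mp by (intro mult_left_mono add_mono mult_right_mono power_mono) auto
        finally show ?thesis by simp
      qed
      moreover have p: "s\<^sup>2 + y\<^sup>2 > 0" using s by (simp add: add_pos_nonneg)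
      ultimately have "1 / (s\<^sup>2 + y\<^sup>2) \<le> c / q\<^sup>2" using mp q by (simp add: c_def field_simps)
      then have "sqrt q * (1 / (s\<^sup>2 + y\<^sup>2)) \<le> sqrt q * (c / q\<^sup>2)" using q by (intro mult_left_mono) auto
      also have "\<dots> = c * (q powr (1/2) * q powr (-2))" using q by (simp add: powr_half_sqrt powr_minus powr_numeral divide_simps)
      also have "q powr (1/2) * q powr (-2) = q powr (-3/2)" by (simp add: powr_add[symmetric])
      finally have "sqrt q / (s\<^sup>2 + y\<^sup>2) \<le> c * q powr (-3/2)" by simp
      moreover have "0 \<le> sqrt q / (s\<^sup>2 + y\<^sup>2)" using p q by simp
      ultimately show "norm (sqrt (1 + \<bar>y\<bar>) / (s\<^sup>2 + y\<^sup>2)) \<le> norm (c * (1 + \<bar>y\<bar>) powr (-3/2))"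
        unfolding q_def[symmetric] real_norm_def by linarith
    qed
  qed measurable
qed

text \<open>Cauchy's theorem on half discs, applied to \<open>(G(z) - G(s)) 2s / (z\<^sup>2 - s\<^sup>2)\<close>: subtracting \<open>G(s)\<close> removes the pole.\<close>

lemma Poisson_half_plane:
  fixes G :: "complex \<Rightarrow> complex"
  assumes G: "G holomorphic_on {z. Re z > -\<eta>}" and \<eta>: "\<eta> > 0"
    and bd: "\<And>z. Re z \<ge> 0 \<Longrightarrow> norm (G z) \<le> C * sqrt (1 + norm z)" and C: "C > 0"
    and s: "s > 0"
  shows "has_bochner_integral lborel (\<lambda>y. of_real (s / (s\<^sup>2 + y\<^sup>2)) * G (\<i> * of_real y)) (of_real pi * G (of_real s))"
proof -
  define Gs where "Gs = G (of_real s)"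
  \<comment> \<open>The difference quotient is completed at \<open>s\<close> by the derivative and
    is therefore holomorphic there. On the imaginary axis \<open>z^2 - s^2 = - (s^2 + y^2)\<close>,
    whence the sign in \<open>kg\<close>.\<close>
  define k where "k = (\<lambda>z. (if z = of_real s then deriv G (of_real s) else (G z - Gs) / (z - of_real s)) * (2 * of_real s / (z + of_real s)))"
  define D where "D = {z::complex. Re z > - min \<eta> s}"
  have D: "open D" "convex D" unfolding D_def by (rule open_halfspace_Re_gt convex_halfspace_Re_gt)+
  have GD: "G holomorphic_on D" by (rule holomorphic_on_subset[OF G]) (auto simp: D_def)
  have kD: "k holomorphic_on D"
    unfolding k_def Gs_def
    by (intro holomorphic_intros pole_lemma_open[OF GD D(1)]) (use s in \<open>auto simp: D_def complex_eq_iff\<close>)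
  define g where "g = (\<lambda>y. (G (\<i> * of_real y) - Gs) * of_real (2 * s / (s\<^sup>2 + y\<^sup>2)))"
  have spos: "s\<^sup>2 + y\<^sup>2 > 0" for y :: real using s by (simp add: add_pos_nonneg)
  have kg: "k (\<i> * of_real y) = - g y" for y
  proof -
    have n1: "\<i> * of_real y - complex_of_real s \<noteq> 0" "\<i> * of_real y + complex_of_real s \<noteq> 0" "\<i> * of_real y \<noteq> complex_of_real s"
      using s by (auto simp: complex_eq_iff)
    define W where "W = complex_of_real (s\<^sup>2 + y\<^sup>2)"
    have W: "(\<i> * of_real y - of_real s) * (\<i> * of_real y + of_real s) = - W"
      by (simp add: algebra_simps power2_eq_square W_def)
    have "k (\<i> * of_real y) = (G (\<i> * of_real y) - Gs) * (2 * of_real s) / ((\<i> * of_real y - of_real s) * (\<i> * of_real y + of_real s))"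
      using n1 by (simp add: k_def)
    moreover have "g y = (G (\<i> * of_real y) - Gs) * (2 * of_real s / W)" by (simp add: g_def W_def)
    ultimately show ?thesis unfolding W by simp
  qed
  have contG: "continuous_on UNIV (\<lambda>y::real. G (\<i> * of_real y))"
    by (rule continuous_on_compose2[OF holomorphic_on_imp_continuous_on[OF GD]])
       (use \<eta> s in \<open>auto intro!: continuous_intros simp: D_def\<close>)
  have [measurable]: "(\<lambda>y::real. G (\<i> * of_real y)) \<in> borel_measurable borel"
    by (rule borel_measurable_continuous_onI[OF contG])
  have gm [measurable]: "g \<in> borel_measurable borel" unfolding g_def by measurable
  have ig: "integrable lborel (\<lambda>y. of_real (s / (s\<^sup>2 + y\<^sup>2)) * G (\<i> * of_real y))"
  proof (rule Bochner_Integration.integrable_bound[OF integrable_mult_right[OF integrable_sqrt_Cauchy[OF s], of "s * C"]])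
    show "AE y in lborel. norm (of_real (s / (s\<^sup>2 + y\<^sup>2)) * G (\<i> * of_real y)) \<le> norm (s * C * (sqrt (1 + \<bar>y\<bar>) / (s\<^sup>2 + y\<^sup>2)))"
    proof (intro AE_I2)
      fix y :: real
      have "norm (of_real (s / (s\<^sup>2 + y\<^sup>2)) * G (\<i> * of_real y)) = (s / (s\<^sup>2 + y\<^sup>2)) * norm (G (\<i> * of_real y))"
        using s spos[of y] by (simp add: norm_mult del: of_real_divide)
      also have "\<dots> \<le> (s / (s\<^sup>2 + y\<^sup>2)) * (C * sqrt (1 + \<bar>y\<bar>))"
        using bd[of "\<i> * of_real y"] s spos[of y] by (intro mult_left_mono) (auto simp: norm_mult)
      also have "\<dots> = s * C * (sqrt (1 + \<bar>y\<bar>) / (s\<^sup>2 + y\<^sup>2))" by simp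
      also have "\<dots> \<le> norm \<dots>" unfolding real_norm_def by (rule abs_ge_self)
      finally show "norm (of_real (s / (s\<^sup>2 + y\<^sup>2)) * G (\<i> * of_real y)) \<le> norm (s * C * (sqrt (1 + \<bar>y\<bar>) / (s\<^sup>2 + y\<^sup>2)))" .
    qed
  qed measurable
  have ic: "has_bochner_integral lborel (\<lambda>y. complex_of_real (s / (s\<^sup>2 + y\<^sup>2)) * Gs) (of_real pi * Gs)"
    by (intro has_bochner_integral_mult_left has_bochner_integral_of_real has_bochner_integral_Cauchy_kernel s)
  have g2: "g y = 2 * (of_real (s / (s\<^sup>2 + y\<^sup>2)) * G (\<i> * of_real y) - of_real (s / (s\<^sup>2 + y\<^sup>2)) * Gs)" for y
  proof -
    have "complex_of_real (2 * s / (s\<^sup>2 + y\<^sup>2)) = 2 * of_real (s / (s\<^sup>2 + y\<^sup>2))" by simp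
    then show ?thesis unfolding g_def by (simp only:) (simp add: algebra_simps del: of_real_divide)
  qed
  have igg: "integrable lborel g"
    unfolding g2[abs_def] using ig ic by (intro integrable_mult_right Bochner_Integration.integrable_diff) (auto simp: has_bochner_integral_iff)
  have lim1: "(\<lambda>n. \<integral>y. indicator {-real n..real n} y *\<^sub>R g y \<partial>lborel) \<longlonglongrightarrow> (\<integral>y. g y \<partial>lborel)"
  proof (rule integral_dominated_convergence[where w = "\<lambda>y. norm (g y)"])
    show "AE y in lborel. (\<lambda>n. indicator {-real n..real n} y *\<^sub>R g y) \<longlonglongrightarrow> g y"
    proof (intro AE_I2 tendsto_eventually)
      fix y :: real
      obtain N :: nat where "\<bar>y\<bar> \<le> real N" using real_arch_simple by blast
      then show "eventually (\<lambda>n. indicator {-real n..real n} y *\<^sub>R g y = g y) sequentially"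
        by (intro eventually_sequentiallyI[of N]) (auto simp: indicator_def abs_le_iff)
    qed
    show "AE y in lborel. norm (indicator {-real n..real n} y *\<^sub>R g y) \<le> norm (g y)" for n
      by (intro AE_I2) (auto simp: indicator_def)
  qed (use igg in auto)
  \<comment> \<open>The integral over the segment equals that over the right half circle of radius
    \<open>R\<close>. There the numerator grows like \<open>sqrt R\<close>, the denominator like
    \<open>R^2\<close> and the length like \<open>R\<close>, so the bound decays like
    \<open>1 / sqrt R\<close>.\<close>
  have bnd: "norm (\<integral>y. indicator {-R..R} y *\<^sub>R g y \<partial>lborel) \<le> (C * sqrt (1 + R) + norm Gs) * (2 * s) / ((R - s) * R) * R * pi"
    if R: "R > s" for R
  proof -
    define l where "l = linepath (-\<i> * of_real R) (\<i> * of_real R)"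
    define c where "c = part_circlepath 0 R (-pi/2) (pi/2)"
    have R0: "R > 0" using R s by simp
    have ends: "pathstart c = pathstart l" "pathfinish c = pathfinish l"
      by (simp_all add: l_def c_def exp_eq_polar cis_conv_exp[symmetric] complex_eq_iff)
    have valid: "valid_path l" "valid_path c" by (simp_all add: l_def c_def)
    have Rec: "Re z \<ge> 0 \<and> norm z = R" if zc: "z \<in> path_image c" for z
    proof -
      obtain t where t: "-pi/2 \<le> t" "t \<le> pi/2" "z = of_real R * exp (\<i> * of_real t)"
        using zc R0 by (auto simp: path_image_part_circlepath c_def)
      then have "Re z = R * cos t" by (simp add: exp_eq_polar cis_conv_exp[symmetric] Re_exp)
      moreover have "cos t \<ge> 0" using t by (intro cos_ge_zero) auto
      moreover have "norm z = R" using t R0 by (simp add: norm_mult)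
      ultimately show ?thesis using R0 by simp
    qed
    have Rel: "Re z = 0" if "z \<in> path_image l" for z
      using that by (auto simp: l_def closed_segment_def)
    have ld: "path_image l \<subseteq> D" using Rel \<eta> s by (force simp: D_def)
    have cd: "path_image c \<subseteq> D" using Rec \<eta> s by (force simp: D_def)
    have cl: "path_image (l +++ reversepath c) \<subseteq> D"
      using path_image_join_subset[of l "reversepath c"] ld cd by (simp add: path_image_reversepath) blast
    have "(k has_contour_integral 0) (l +++ reversepath c)"
      by (rule Cauchy_theorem_convex_simple[OF kD D(2) _ cl]) (use ends valid in auto)
    then have "contour_integral (l +++ reversepath c) k = 0" by (rule contour_integral_unique)
    moreover have kl: "k contour_integrable_on l"
      unfolding l_def by (rule contour_integrable_continuous_linepath, rule continuous_on_subset[OF holomorphic_on_imp_continuous_on[OF kD]])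
         (use ld in \<open>simp add: l_def\<close>)
    moreover have kc: "k contour_integrable_on c"
      unfolding c_def by (rule contour_integrable_continuous_part_circlepath, rule continuous_on_subset[OF holomorphic_on_imp_continuous_on[OF kD]])
         (use cd in \<open>simp add: c_def\<close>)
    ultimately have eq: "contour_integral l k = contour_integral c k"
      using ends valid by (simp add: contour_integral_join contour_integrable_reversepath contour_integral_reversepath valid_path_reversepath)
    have kb: "norm (k z) \<le> (C * sqrt (1 + R) + norm Gs) * (2 * s) / ((R - s) * R)" if "z \<in> path_image c" for z
    proof -
      have z: "Re z \<ge> 0" "norm z = R" using Rec[OF that] by auto
      have n1: "norm (z - of_real s) \<ge> R - s" using norm_triangle_ineq2[of z "of_real s"] z s by simp
      have n2: "norm (z + of_real s) \<ge> R"
      proof -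
        have "norm z \<le> norm (z + of_real s)"
        proof (rule power2_le_imp_le)
          show "(norm z)\<^sup>2 \<le> (norm (z + of_real s))\<^sup>2"
            unfolding cmod_power2 using z s by (simp add: power2_eq_square algebra_simps)
        qed simp
        then show ?thesis using z by simp
      qed
      have zs: "z \<noteq> of_real s" using z R s by auto
      have "norm (k z) = norm (G z - Gs) * (2 * s) / (norm (z - of_real s) * norm (z + of_real s))"
        using zs s by (simp add: k_def norm_mult norm_divide)
      also have "\<dots> \<le> (C * sqrt (1 + R) + norm Gs) * (2 * s) / ((R - s) * R)"
      proof (intro frac_le mult_right_mono mult_mono mult_pos_pos mult_nonneg_nonneg)
        show "norm (G z - Gs) \<le> C * sqrt (1 + R) + norm Gs"
          using norm_triangle_ineq4[of "G z" Gs] bd[OF z(1)] z by simp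
      qed (use n1 n2 R R0 s C in auto)
      finally show ?thesis .
    qed
    have "norm (contour_integral c k) \<le> (C * sqrt (1 + R) + norm Gs) * (2 * s) / ((R - s) * R) * R * (pi/2 - (-pi/2))"
      by (rule has_contour_integral_bound_part_circlepath[OF has_contour_integral_integral[OF kc, unfolded c_def], folded c_def])
         (use kb R R0 s C in \<open>auto simp: c_def\<close>)
    then have b1: "norm (contour_integral l k) \<le> (C * sqrt (1 + R) + norm Gs) * (2 * s) / ((R - s) * R) * R * pi"
      unfolding eq by simp
    have "(k has_contour_integral contour_integral l k) l" by (rule has_contour_integral_integral[OF kl])
    then have "((\<lambda>y. k (\<i> * of_real y)) has_integral (-\<i> * contour_integral l k)) {-R..R}"
      using R0 has_contour_integral_linepath_same_Re_iff[where z = "-\<i> * of_real R" and z' = "\<i> * of_real R" and c = 0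
        and a = "-R" and b = R and f = k and I = "contour_integral l k"]
      by (simp add: Complex_eq l_def)
    then have "((\<lambda>y. - g y) has_integral (-\<i> * contour_integral l k)) {-R..R}" by (simp add: kg)
    from has_integral_neg[OF this] have h1: "(g has_integral (\<i> * contour_integral l k)) {-R..R}" by simp
    have ii: "integrable lborel (\<lambda>y. indicator {-R..R} y *\<^sub>R g y)"
      by (rule integrable_mult_indicator[of _ lborel g, simplified, OF _ igg]) auto
    have "((\<lambda>y. indicator {-R..R} y *\<^sub>R g y) has_integral (\<integral>y. indicator {-R..R} y *\<^sub>R g y \<partial>lborel)) UNIV"
      by (rule has_integral_integral_lborel[OF ii])
    moreover have "(\<lambda>y. indicator {-R..R} y *\<^sub>R g y) = (\<lambda>y. if y \<in> {-R..R} then g y else 0)" by (auto simp: indicator_def)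
    ultimately have h2: "(g has_integral (\<integral>y. indicator {-R..R} y *\<^sub>R g y \<partial>lborel)) {-R..R}"
      by (simp only: has_integral_restrict_UNIV)
    have "(\<integral>y. indicator {-R..R} y *\<^sub>R g y \<partial>lborel) = \<i> * contour_integral l k" by (rule has_integral_unique[OF h2 h1])
    then show ?thesis using b1 by (simp add: norm_mult)
  qed
  have "(\<lambda>n. norm (\<integral>y. indicator {-real n..real n} y *\<^sub>R g y \<partial>lborel)) \<longlonglongrightarrow> 0"
  proof (rule tendsto_sandwich[OF _ _ tendsto_const])
    show "eventually (\<lambda>n. norm (\<integral>y. indicator {-real n..real n} y *\<^sub>R g y \<partial>lborel) \<le>
       (C * sqrt (1 + real n) + norm Gs) * (2 * s) / ((real n - s) * real n) * real n * pi) sequentially"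
    proof -
      have "eventually (\<lambda>n. real n > s) sequentially"
        using filterlim_real_sequentially by (simp add: filterlim_at_top_dense)
      then show ?thesis by eventually_elim (rule bnd)
    qed
    show "(\<lambda>n. (C * sqrt (1 + real n) + norm Gs) * (2 * s) / ((real n - s) * real n) * real n * pi) \<longlonglongrightarrow> 0"
      using C s by real_asymp
  qed auto
  then have "(\<integral>y. g y \<partial>lborel) = 0"
    using LIMSEQ_unique[OF tendsto_norm[OF lim1]] by fastforce
  moreover have "(\<integral>y. g y \<partial>lborel) = 2 * ((\<integral>y. of_real (s / (s\<^sup>2 + y\<^sup>2)) * G (\<i> * of_real y) \<partial>lborel) - of_real pi * Gs)"
    unfolding g2[abs_def] using ig ic by (simp add: has_bochner_integral_iff del: of_real_divide)
  ultimately show ?thesis using ig by (simp add: has_bochner_integral_iff Gs_def)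
qed

section \<open>Positivity from transforms on the integers\<close>

lemma has_laplace_dilate:
  assumes "has_laplace f (s / c) v" and c: "c > 0"
  shows "has_laplace (\<lambda>t. f (c * t)) s (v / c)"
proof -
  have "has_bochner_integral lborel (\<lambda>t. indicator {0..} (0 + c * t) * (exp (-(s / c * (0 + c * t))) * f (0 + c * t))) (v /\<^sub>R \<bar>c\<bar>)"
    using assms(1) c unfolding has_laplace_def by (subst lborel_has_bochner_integral_real_affine_iff[symmetric]) auto
  moreover have "indicator {0..} (0 + c * t) * (exp (-(s / c * (0 + c * t))) * f (0 + c * t)) = indicator {0..} t * (exp (-(s * t)) * f (c * t))" for t
    using c by (auto simp: indicator_def zero_le_mult_iff)
  ultimately have "has_bochner_integral lborel (\<lambda>t. indicator {0..} t * (exp (-(s * t)) * f (c * t))) (v /\<^sub>R \<bar>c\<bar>)"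
    by (simp only:)
  moreover have "v /\<^sub>R \<bar>c\<bar> = v / c" using c by (simp add: divide_inverse mult.commute)
  ultimately show ?thesis by (simp only: has_laplace_def)
qed

text \<open>In the variable \<open>x = exp (- t)\<close> this integrates
  \<open>x^k (1 - x)^m\<close>, the shape of a Bernstein basis polynomial, against the weighted
  \<open>f\<close>.\<close>

definition laplace_moment :: "(real \<Rightarrow> real) \<Rightarrow> nat \<Rightarrow> nat \<Rightarrow> nat \<Rightarrow> real \<Rightarrow> bool" where
  "laplace_moment f N k m v \<longleftrightarrow>
     has_bochner_integral lborel (\<lambda>t. indicator {0..} t * (exp (-(real N * t)) * f t) * (exp (-t) ^ k * (1 - exp (-t)) ^ m)) v"

lemma laplace_moment_0:
  assumes "has_laplace f (real (N + k)) v" shows "laplace_moment f N k 0 v"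
proof -
  have "indicator {0..} t * (exp (-(real N * t)) * f t) * (exp (-t) ^ k * (1 - exp (-t)) ^ 0) = indicator {0..} t * (exp (-(real (N + k) * t)) * f t)" for t :: real
  proof -
    have "exp (-(real (N + k) * t)) = exp (-(real N * t)) * exp (-t) ^ k"
      by (simp add: exp_of_nat_mult[symmetric] exp_add[symmetric] algebra_simps)
    then show ?thesis by simp
  qed
  then show ?thesis using assms by (simp only: laplace_moment_def has_laplace_def)
qed

lemma laplace_moment_Suc:
  assumes "laplace_moment f N k m v" "laplace_moment f N (Suc k) m w"
  shows "laplace_moment f N k (Suc m) (v - w)"
  using has_bochner_integral_diff[OF assms[unfolded laplace_moment_def]] unfolding laplace_moment_def
  by (simp add: algebra_simps)

text \<open>Iterated differences, as in Hausdorff's moment problem: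
  \<open>(1 - x)^(m+1) = (1 - x)^m - x (1 - x)^m\<close> expresses each moment through the
  transforms at integers from \<open>N + k\<close> on.\<close>

fun moment_value :: "(nat \<Rightarrow> real) \<Rightarrow> nat \<Rightarrow> nat \<Rightarrow> nat \<Rightarrow> real" where
  "moment_value v N k 0 = v (N + k)"
| "moment_value v N k (Suc m) = moment_value v N k m - moment_value v N (Suc k) m"

lemma laplace_moment_value:
  assumes "\<And>n. n \<ge> N \<Longrightarrow> has_laplace f (real n) (v n)"
  shows "laplace_moment f N k m (moment_value v N k m)"
proof (induction m arbitrary: k)
  case 0
  have "has_laplace f (real (N + k)) (v (N + k))" by (rule assms) simp
  from laplace_moment_0[OF this] show ?case by simp
next
  case (Suc m)
  show ?case using laplace_moment_Suc[OF Suc.IH Suc.IH] by simp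
qed

text \<open>The transforms of \<open>T j\<close> at the integers are the moments of a nonnegative measure in \<open>x = exp (- t)\<close>, so the limiting
  moments are nonnegative on Bernstein polynomials, hence on a bump around \<open>exp (- t0)\<close>. No pointwise
  convergence of \<open>T j\<close> is needed.\<close>

lemma nonneg_of_laplace_limit:
  fixes f :: "real \<Rightarrow> real" and T :: "nat \<Rightarrow> real \<Rightarrow> real"
  assumes cont: "continuous_on {0..} f"
    and f: "\<And>n. n \<ge> N \<Longrightarrow> has_laplace f (real n) (v n)"
    and T: "\<And>j n. n \<ge> N \<Longrightarrow> has_laplace (T j) (real n) (u j n)"
    and nonneg: "\<And>j t. t \<ge> 0 \<Longrightarrow> T j t \<ge> 0"
    and lim: "\<And>n. n \<ge> N \<Longrightarrow> (\<lambda>j. u j n) \<longlonglongrightarrow> v n"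
    and t0: "t0 > 0"
  shows "f t0 \<ge> 0"
proof (rule ccontr)
  assume "\<not> f t0 \<ge> 0"
  then have neg: "f t0 < 0" by simp
  have mv_lim: "(\<lambda>j. moment_value (u j) N k m) \<longlonglongrightarrow> moment_value v N k m" for k m
    by (induction m arbitrary: k) (auto intro!: tendsto_diff lim)
  have "moment_value (u j) N k m \<ge> 0" for j k m
  proof -
    have "laplace_moment (T j) N k m (moment_value (u j) N k m)" by (rule laplace_moment_value[OF T])
    then have "moment_value (u j) N k m = (\<integral>t. indicator {0..} t * (exp (-(real N * t)) * T j t) * (exp (-t) ^ k * (1 - exp (-t)) ^ m) \<partial>lborel)"
      by (simp add: laplace_moment_def has_bochner_integral_iff)
    also have "\<dots> \<ge> 0" using nonneg by (intro integral_nonneg_AE AE_I2) (auto simp: indicator_def)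
    finally show ?thesis .
  qed
  then have mv0: "moment_value v N k m \<ge> 0" for k m
    using LIMSEQ_le_const[OF mv_lim] by blast
  define w where "w = (\<lambda>t. indicator {0..} t * (exp (-(real N * t)) * f t))"
  have iw: "integrable lborel w"
    using f[of N] by (simp add: w_def has_laplace_def has_bochner_integral_iff)
  define I where "I = (\<integral>t. \<bar>w t\<bar> \<partial>lborel)"
  have I0: "I \<ge> 0" unfolding I_def by (intro integral_nonneg_AE AE_I2) auto
  have mom: "has_bochner_integral lborel (\<lambda>t. w t * (exp (-t) ^ k * (1 - exp (-t)) ^ m)) (moment_value v N k m)" for k m
    using laplace_moment_value[OF f] by (simp add: laplace_moment_def w_def)
  define x0 where "x0 = exp (-t0)"
  have x0: "0 < x0" "x0 < 1" "ln x0 = - t0" using t0 by (auto simp: x0_def)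
  have "continuous (at t0) f"
    using cont t0 by (intro continuous_on_interior[OF cont]) (auto simp: interior_Ici)
  then have "continuous (at x0) (\<lambda>x. f (- ln x))"
    using x0 by (intro continuous_at_compose[of x0 "\<lambda>x. - ln x" f, unfolded o_def]) (auto intro!: continuous_intros)
  then have "((\<lambda>x. f (- ln x)) \<longlongrightarrow> f (- ln x0)) (nhds x0)"
    using tendsto_at_iff_tendsto_nhds[of "\<lambda>x. f (- ln x)" x0] by (simp add: isCont_def)
  then have "eventually (\<lambda>x. f (- ln x) < 0) (nhds x0)"
    by (rule order_tendstoD) (use neg x0 in simp)
  then obtain d where d: "d > 0" "\<And>x. dist x x0 < d \<Longrightarrow> f (- ln x) < 0"
    by (auto simp: eventually_nhds_metric)
  \<comment> \<open>A tent over \<open>x0\<close>, supported where \<open>f\<close> is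
    negative.\<close>
  define \<phi> where "\<phi> = (\<lambda>x. max 0 (d - \<bar>x - x0\<bar>))"
  have \<phi>c: "continuous_on {0..1} \<phi>" unfolding \<phi>_def by (intro continuous_intros)
  have \<phi>0: "\<phi> x \<ge> 0" "\<phi> x \<le> d" for x using d by (auto simp: \<phi>_def)
  have i\<phi>: "integrable lborel (\<lambda>t. w t * \<phi> (exp (-t)))"
  proof (rule Bochner_Integration.integrable_bound[OF integrable_mult_right[OF iw, of d]])
    have [measurable]: "w \<in> borel_measurable borel" using iw by (auto dest: borel_measurable_integrable)
    show "(\<lambda>t. w t * \<phi> (exp (-t))) \<in> borel_measurable lborel" unfolding \<phi>_def by measurable
    show "AE t in lborel. norm (w t * \<phi> (exp (-t))) \<le> norm (d * w t)"
    proof (intro AE_I2)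
      fix t :: real
      have "norm (w t * \<phi> (exp (-t))) = \<bar>w t\<bar> * \<phi> (exp (-t))" using \<phi>0 by (simp add: abs_mult)
      also have "\<dots> \<le> \<bar>w t\<bar> * d" using \<phi>0 by (intro mult_left_mono) auto
      finally show "norm (w t * \<phi> (exp (-t))) \<le> norm (d * w t)" using d by (simp add: abs_mult mult.commute)
    qed
  qed
  \<comment> \<open>The Bernstein polynomial of the nonnegative \<open>\<phi>\<close> has
    nonnegative coefficients, so it integrates to at least 0; replacing it by \<open>\<phi>\<close>
    costs at most \<open>e\<close> times the total mass of \<open>w\<close>.\<close>
  have "(\<integral>t. w t * \<phi> (exp (-t)) \<partial>lborel) \<ge> - e * I" if e: "e > 0" for e
  proof -
    obtain M where M: "\<And>n x. M \<le> n \<Longrightarrow> x \<in> {0..1} \<Longrightarrow> \<bar>\<phi> x - (\<Sum>k\<le>n. \<phi> (real k / real n) * Bernstein n k x)\<bar> < e"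
      using Bernstein_Weierstrass[OF \<phi>c e] by blast
    define P where "P = (\<lambda>x. \<Sum>k\<le>M. \<phi> (real k / real M) * Bernstein M k x)"
    have hP: "has_bochner_integral lborel (\<lambda>t. \<Sum>k\<le>M. (\<phi> (real k / real M) * real (M choose k)) * (w t * (exp (-t) ^ k * (1 - exp (-t)) ^ (M - k))))
       (\<Sum>k\<le>M. (\<phi> (real k / real M) * real (M choose k)) * moment_value v N k (M - k))"
      by (intro has_bochner_integral_sum has_bochner_integral_mult_right mom)
    have eqP: "(\<Sum>k\<le>M. (\<phi> (real k / real M) * real (M choose k)) * (w t * (exp (-t) ^ k * (1 - exp (-t)) ^ (M - k)))) = w t * P (exp (-t))" for t
      by (simp add: P_def Bernstein_def sum_distrib_left mult_ac)
    have iP: "integrable lborel (\<lambda>t. w t * P (exp (-t)))" and vP: "(\<integral>t. w t * P (exp (-t)) \<partial>lborel) \<ge> 0"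
      using hP \<phi>0 mv0 unfolding eqP by (auto simp: has_bochner_integral_iff intro!: sum_nonneg)
    have "(\<integral>t. w t * P (exp (-t)) \<partial>lborel) - (\<integral>t. w t * \<phi> (exp (-t)) \<partial>lborel) = (\<integral>t. w t * P (exp (-t)) - w t * \<phi> (exp (-t)) \<partial>lborel)"
      by (rule Bochner_Integration.integral_diff[OF iP i\<phi>, symmetric])
    also have "\<dots> \<le> (\<integral>t. e * \<bar>w t\<bar> \<partial>lborel)"
    proof (rule integral_mono)
      show "integrable lborel (\<lambda>t. w t * P (exp (-t)) - w t * \<phi> (exp (-t)))" by (intro Bochner_Integration.integrable_diff iP i\<phi>)
      show "integrable lborel (\<lambda>t. e * \<bar>w t\<bar>)" using iw by (intro integrable_mult_right integrable_abs)
      fix t :: real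
      show "w t * P (exp (-t)) - w t * \<phi> (exp (-t)) \<le> e * \<bar>w t\<bar>"
      proof (cases "t \<ge> 0")
        case True
        then have "\<bar>\<phi> (exp (-t)) - P (exp (-t))\<bar> \<le> e" using M[of M "exp (-t)"] by (simp add: P_def)
        then have "\<bar>w t\<bar> * \<bar>P (exp (-t)) - \<phi> (exp (-t))\<bar> \<le> \<bar>w t\<bar> * e" by (intro mult_left_mono) auto
        moreover have "w t * P (exp (-t)) - w t * \<phi> (exp (-t)) \<le> \<bar>w t * (P (exp (-t)) - \<phi> (exp (-t)))\<bar>" by (simp add: algebra_simps)
        ultimately show ?thesis by (simp add: abs_mult mult.commute)
      qed (simp add: w_def)
    qed
    also have "\<dots> = e * I" by (simp add: I_def)
    finally show ?thesis using vP by simp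
  qed
  note low = this
  have int0: "(\<integral>t. w t * \<phi> (exp (-t)) \<partial>lborel) \<ge> 0"
  proof (rule ccontr)
    assume "\<not> ?thesis"
    then have lt: "(\<integral>t. w t * \<phi> (exp (-t)) \<partial>lborel) < 0" by simp
    \<comment> \<open>One more than \<open>I\<close>, so that the division below is legitimate even
      if \<open>I = 0\<close>.\<close>
    define J where "J = I + 1"
    have J: "J > 0" "I \<le> J" using I0 by (auto simp: J_def)
    define e where "e = - (\<integral>t. w t * \<phi> (exp (-t)) \<partial>lborel) / (2 * J)"
    have e: "e > 0" using lt J by (simp add: e_def divide_neg_pos)
    have "e * I \<le> e * J" using e J by simp
    also have "\<dots> = - (\<integral>t. w t * \<phi> (exp (-t)) \<partial>lborel) / 2" using J by (simp add: e_def)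
    finally show False using low[OF e] lt by simp
  qed
  have neg\<phi>: "- (w t * \<phi> (exp (-t))) \<ge> 0" for t
  proof (cases "dist (exp (-t)) x0 < d \<and> t \<ge> 0")
    case True
    then have "f t < 0" using d(2)[of "exp (-t)"] by simp
    then have "w t \<le> 0" using True by (simp add: w_def mult_nonneg_nonpos)
    then show ?thesis using \<phi>0[of "exp (-t)"] by (simp add: mult_nonpos_nonneg)
  next
    case False
    then have "w t = 0 \<or> \<phi> (exp (-t)) = 0" by (auto simp: w_def \<phi>_def dist_real_def)
    then show ?thesis by auto
  qed
  \<comment> \<open>An integrand that is nonpositive with nonnegative integral vanishes almost
    everywhere, whereas \<open>w t * \<phi> (exp (-t))\<close> is nonzero on a neighbourhood of
    \<open>t0\<close>.\<close>
  have "(\<integral>t. - (w t * \<phi> (exp (-t))) \<partial>lborel) \<ge> 0" by (intro integral_nonneg_AE AE_I2 neg\<phi>)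
  then have "(\<integral>t. - (w t * \<phi> (exp (-t))) \<partial>lborel) = 0" using int0 by simp
  then have ae: "AE t in lborel. - (w t * \<phi> (exp (-t))) = 0"
    using i\<phi> neg\<phi> by (subst (asm) integral_nonneg_eq_0_iff_AE) auto
  have "eventually (\<lambda>t. dist (exp (-t)) x0 < d) (nhds t0)"
  proof -
    have "((\<lambda>t. exp (-t)) \<longlongrightarrow> x0) (nhds t0)" unfolding x0_def by (auto intro!: tendsto_eq_intros filterlim_ident)
    then show ?thesis using d(1) by (rule tendstoD)
  qed
  moreover have "eventually (\<lambda>t. t > 0) (nhds t0)" using t0 by (rule eventually_nhds_in_open[OF open_greaterThan, simplified])
  ultimately have "eventually (\<lambda>t. w t * \<phi> (exp (-t)) \<noteq> 0) (nhds t0)"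
  proof eventually_elim
    case (elim t)
    have "f t < 0" using d(2)[OF elim(1)] by simp
    then show ?case using elim by (simp add: w_def \<phi>_def dist_real_def)
  qed
  then obtain r where r: "r > 0" "\<And>t. dist t t0 < r \<Longrightarrow> w t * \<phi> (exp (-t)) \<noteq> 0"
    by (auto simp: eventually_nhds_metric)
  have "AE t in lborel. t \<notin> {t0<..<t0 + r}"
    using ae by eventually_elim (use r in \<open>force simp: dist_real_def\<close>)
  then have "{t0<..<t0 + r} \<in> null_sets lborel"
    by (subst (asm) AE_iff_null_sets[symmetric]) auto
  then have "emeasure lborel {t0<..<t0 + r} = 0" by auto
  then show False using r(1) by simp
qed

section \<open>Representation of the regularised Psi\<close>

definition fejer :: "real \<Rightarrow> real \<Rightarrow> real" where
  "fejer t y = (1 - cos (y * t)) / y\<^sup>2"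

lemma one_minus_cos: "1 - cos x = 2 * (sin (x / 2))\<^sup>2" for x :: real
  using cos_double_sin[of "x/2"] by simp

lemma fejer_nonneg: "fejer t y \<ge> 0"
  by (simp add: fejer_def)

text \<open>\<open>1\<^sup>2 + y\<^sup>2\<close> instead of \<open>1 + y\<^sup>2\<close> matches the Poisson kernel at \<open>s = 1\<close>.\<close>

lemma fejer_bound: "fejer t y \<le> (t\<^sup>2 / 2 + 2) * (1 / (1\<^sup>2 + y\<^sup>2))"
proof (cases "y = 0")
  case False
  have "\<bar>sin (y * t / 2)\<bar> \<le> \<bar>y * t / 2\<bar>" by (rule abs_sin_x_le_abs_x)
  then have "(sin (y * t / 2))\<^sup>2 \<le> (y * t / 2)\<^sup>2" by (rule abs_le_square_iff[THEN iffD1])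
  then have "1 - cos (y * t) \<le> y\<^sup>2 * (t\<^sup>2 / 2)"
    unfolding one_minus_cos by (simp add: power_mult_distrib power_divide)
  then have 1: "fejer t y \<le> t\<^sup>2 / 2" using False by (simp add: fejer_def divide_simps mult_ac)
  have 2: "y\<^sup>2 * fejer t y \<le> 2" using False cos_ge_minus_one[of "y * t"] by (simp add: fejer_def)
  have p: "1\<^sup>2 + y\<^sup>2 > 0" by (simp add: add_pos_nonneg)
  have "fejer t y * (1\<^sup>2 + y\<^sup>2) \<le> t\<^sup>2 / 2 + 2" using 1 2 by (simp add: algebra_simps)
  then show ?thesis using p by (simp add: pos_le_divide_eq)
qed (simp add: fejer_def)

text \<open>As \<open>1 - cos x = 2 sin (x/2)^2\<close>, this is
  \<open>|sin (u - v)| \<le> |sin u| + |sin v|\<close> in squared form, the 2 coming from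
  \<open>(a + b)^2 \<le> 2 a^2 + 2 b^2\<close>.\<close>

lemma fejer_quasi_triangle: "fejer h y \<le> 2 * fejer (t + h) y + 2 * fejer t y"
proof -
  define u where "u = y * (t + h) / 2"
  define v where "v = y * t / 2"
  have uv: "y * h / 2 = u - v" by (simp add: u_def v_def field_simps)
  have "(sin (u - v))\<^sup>2 \<le> 2 * (sin u * cos v)\<^sup>2 + 2 * (cos u * sin v)\<^sup>2"
  proof -
    have "0 \<le> (sin u * cos v + cos u * sin v)\<^sup>2" by simp
    then show ?thesis unfolding sin_diff by (simp add: power2_eq_square algebra_simps)
  qed
  also have "\<dots> \<le> 2 * (sin u)\<^sup>2 + 2 * (sin v)\<^sup>2"
  proof -
    have "(cos v)\<^sup>2 \<le> 1" "(cos u)\<^sup>2 \<le> 1" by (simp_all add: abs_square_le_1)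
    then have "(sin u)\<^sup>2 * (cos v)\<^sup>2 \<le> (sin u)\<^sup>2 * 1" "(cos u)\<^sup>2 * (sin v)\<^sup>2 \<le> 1 * (sin v)\<^sup>2"
      by (intro mult_left_mono mult_right_mono; simp)+
    then show ?thesis by (simp add: power_mult_distrib)
  qed
  finally have "1 - cos (y * h) \<le> 2 * (1 - cos (y * (t + h))) + 2 * (1 - cos (y * t))"
    unfolding one_minus_cos uv u_def[symmetric] v_def[symmetric] by simp
  then have "(1 - cos (y * h)) / y\<^sup>2 \<le> (2 * (1 - cos (y * (t + h))) + 2 * (1 - cos (y * t))) / y\<^sup>2"
    by (rule divide_right_mono) simp
  then show ?thesis unfolding fejer_def by (simp only: add_divide_distrib times_divide_eq_right)
qed

text \<open>The value is the Poisson kernel \<open>s / (s^2 + y^2)\<close> divided by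
  \<open>s^2\<close>; this is why the kernel \<open>fejer\<close> reproduces a transform of the form
  \<open>F(a + s) / s^2\<close>.\<close>

lemma has_laplace_fejer:
  assumes s: "s > 0" and y: "y \<noteq> 0"
  shows "has_laplace (\<lambda>t. fejer t y) s (1 / (s * (s\<^sup>2 + y\<^sup>2)))"
proof -
  define q where "q = s\<^sup>2 + y\<^sup>2"
  have q: "q > 0" using s by (simp add: q_def add_pos_nonneg)
  define r where "r = 1 / (q * y\<^sup>2)"
  define p where "p = 1 / (s * y\<^sup>2)"
  define F where "F = (\<lambda>t. exp (-(s * t)) * ((s * cos (y * t) - y * sin (y * t)) * r - p))"
  have y2: "y\<^sup>2 > 0" using y by simp
  have "has_laplace (\<lambda>t. fejer t y) s (0 - F 0)"
  proof (rule has_laplaceI_antideriv[where a = 0 and g = "\<lambda>t. fejer t y" and F = F and T = 0])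
    show "(F has_real_derivative exp (-(s * t)) * fejer t y) (at t)" for t
    proof -
      let ?E = "exp (-(s * t))"
      have "(F has_real_derivative (?E * (-s) * ((s * cos (y * t) - y * sin (y * t)) * r - p) + ?E * ((s * (- sin (y * t) * y) - y * (cos (y * t) * y)) * r))) (at t)"
        unfolding F_def by (auto intro!: derivative_eq_intros)
      also have "?E * (-s) * ((s * cos (y * t) - y * sin (y * t)) * r - p) + ?E * ((s * (- sin (y * t) * y) - y * (cos (y * t) * y)) * r) = ?E * (s * p - cos (y * t) * (q * r))"
        by (simp add: q_def algebra_simps power2_eq_square)
      also have "s * p = 1 / y\<^sup>2" using s by (simp add: p_def)
      also have "q * r = 1 / y\<^sup>2" using q by (simp add: r_def)
      also have "1 / y\<^sup>2 - cos (y * t) * (1 / y\<^sup>2) = fejer t y" by (simp add: fejer_def diff_divide_distrib)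
      finally show ?thesis .
    qed
    show "(F \<longlongrightarrow> 0) at_top"
    proof (rule Lim_null_comparison)
      let ?K = "(\<bar>s\<bar> + \<bar>y\<bar>) * \<bar>r\<bar> + \<bar>p\<bar>"
      show "eventually (\<lambda>t. norm (F t) \<le> ?K * exp (-(s * t))) at_top"
      proof (intro always_eventually allI)
        fix t
        have "\<bar>s * cos (y * t) - y * sin (y * t)\<bar> \<le> \<bar>s\<bar> * \<bar>cos (y * t)\<bar> + \<bar>y\<bar> * \<bar>sin (y * t)\<bar>"
          using abs_triangle_ineq4[of "s * cos (y * t)" "y * sin (y * t)"] by (simp add: abs_mult)
        also have "\<dots> \<le> \<bar>s\<bar> * 1 + \<bar>y\<bar> * 1" by (intro add_mono mult_left_mono) auto
        finally have "\<bar>s * cos (y * t) - y * sin (y * t)\<bar> * \<bar>r\<bar> \<le> (\<bar>s\<bar> + \<bar>y\<bar>) * \<bar>r\<bar>" by (intro mult_right_mono) auto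
        then have "\<bar>(s * cos (y * t) - y * sin (y * t)) * r - p\<bar> \<le> ?K"
          using abs_triangle_ineq4[of "(s * cos (y * t) - y * sin (y * t)) * r" p] by (simp only: abs_mult)
        then have "exp (-(s * t)) * \<bar>(s * cos (y * t) - y * sin (y * t)) * r - p\<bar> \<le> exp (-(s * t)) * ?K"
          by (intro mult_left_mono) auto
        then show "norm (F t) \<le> ?K * exp (-(s * t))" by (simp only: F_def real_norm_def abs_mult abs_exp_cancel mult.commute)
      qed
      have "((\<lambda>t. exp (-(s * t))) \<longlongrightarrow> 0) at_top" using s by real_asymp
      from tendsto_mult_left[OF this, of ?K] show "((\<lambda>t. ?K * exp (-(s * t))) \<longlongrightarrow> 0) at_top" by (simp only: mult_zero_right)
    qed
  qed (auto simp: fejer_nonneg, auto simp: fejer_def)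
  also have "0 - F 0 = p - s * r" by (simp add: F_def)
  also have "\<dots> = (q - s * s) / (s * q * y\<^sup>2)" using s y q by (simp add: p_def r_def divide_simps)
  also have "q - s * s = y\<^sup>2" by (simp add: q_def power2_eq_square)
  also have "y\<^sup>2 / (s * q * y\<^sup>2) = 1 / (s * (s\<^sup>2 + y\<^sup>2))" using y2 unfolding q_def[symmetric] by simp
  finally show ?thesis .
qed

lemma xi_logderiv_real: "s > 1/2 \<Longrightarrow> xi_logderiv (of_real s) = of_real (psi_transform s)"
  using DERIV_imp_deriv[OF xi_fun_has_derivative_real] xi_fun_nonzero_real[of "1/2 + s"] by (simp add: xi_logderiv_def)

text \<open>Boundary density on the line \<open>Re s = a\<close>. At \<open>a = 0\<close> it would
  degenerate into point masses at the zeros.\<close>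

definition herglotz_density :: "real \<Rightarrow> real \<Rightarrow> real" where
  "herglotz_density a y = Re (xi_logderiv (of_real a + \<i> * of_real y))"

text \<open>The value \<open>fejer t 0 = 0\<close> (division by zero) is immaterial here, being taken on a null set.\<close>

definition psi_regular :: "real \<Rightarrow> real \<Rightarrow> real" where
  "psi_regular a t = (\<integral>y. herglotz_density a y * fejer t y \<partial>lborel) / pi"

context
  assumes RH: riemann_hypothesis
begin

lemma herglotz_density_nonneg: "a > 0 \<Longrightarrow> herglotz_density a y \<ge> 0"
  unfolding herglotz_density_def by (rule Re_xi_logderiv_nonneg[OF RH]) simp

lemma herglotz_density_Poisson:
  assumes a: "0 < a" "a \<le> 1/2" and s: "s > 0"
  shows "has_bochner_integral lborel (\<lambda>y. s / (s\<^sup>2 + y\<^sup>2) * herglotz_density a y) (pi * Re (xi_logderiv (of_real (a + s))))"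
proof -
  obtain C where C: "C > 0" "\<And>z. Re z \<ge> 0 \<Longrightarrow> norm (xi_logderiv (of_real a + z)) \<le> C * sqrt (1 + norm z)"
    using xi_logderiv_bound[OF RH a] by blast
  have hol: "(\<lambda>z. xi_logderiv (of_real a + z)) holomorphic_on {z. Re z > -a}"
  proof -
    have 1: "(\<lambda>z. of_real a + z) holomorphic_on {z. Re z > -a}" by (intro holomorphic_intros)
    have 2: "(\<lambda>z. of_real a + z) ` {z. Re z > -a} \<subseteq> {z. Re z > 0}" by auto
    from holomorphic_on_compose_gen[OF 1 holomorphic_xi_logderiv[OF RH] 2] show ?thesis by (simp add: o_def)
  qed
  from has_bochner_integral_bounded_linear[OF bounded_linear_Re Poisson_half_plane[OF hol a(1) C(2) C(1) s]]
  show ?thesis by (simp add: herglotz_density_def del: of_real_divide)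
qed

lemma herglotz_density_measurable [measurable]:
  assumes a: "0 < a" "a \<le> 1/2" shows "herglotz_density a \<in> borel_measurable borel"
proof -
  have "(\<lambda>y. 1 / (1\<^sup>2 + y\<^sup>2) * herglotz_density a y) \<in> borel_measurable borel"
    using herglotz_density_Poisson[OF a zero_less_one] by (auto simp: has_bochner_integral_iff)
  then have "(\<lambda>y. (1\<^sup>2 + y\<^sup>2) * (1 / (1\<^sup>2 + y\<^sup>2) * herglotz_density a y)) \<in> borel_measurable borel" by measurable
  moreover have "(1\<^sup>2 + y\<^sup>2) * (1 / (1\<^sup>2 + y\<^sup>2) * herglotz_density a y) = herglotz_density a y" for y
  proof -
    have "1\<^sup>2 + y\<^sup>2 > 0" by (simp add: add_pos_nonneg)
    then show ?thesis by simp
  qed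
  ultimately show ?thesis by (simp only:)
qed

lemma integrable_herglotz_fejer:
  assumes a: "0 < a" "a \<le> 1/2" shows "integrable lborel (\<lambda>y. herglotz_density a y * fejer t y)"
proof (rule Bochner_Integration.integrable_bound)
  note [measurable] = herglotz_density_measurable[OF a]
  have "integrable lborel (\<lambda>y. 1 / (1\<^sup>2 + y\<^sup>2) * herglotz_density a y)"
    using herglotz_density_Poisson[OF a zero_less_one] by (auto simp: has_bochner_integral_iff)
  then show "integrable lborel (\<lambda>y. (t\<^sup>2 / 2 + 2) * (1 / (1\<^sup>2 + y\<^sup>2) * herglotz_density a y))" by (rule integrable_mult_right)
  show "(\<lambda>y. herglotz_density a y * fejer t y) \<in> borel_measurable lborel" unfolding fejer_def by measurable
  show "AE y in lborel. norm (herglotz_density a y * fejer t y) \<le> norm ((t\<^sup>2 / 2 + 2) * (1 / (1\<^sup>2 + y\<^sup>2) * herglotz_density a y))"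
  proof (intro AE_I2)
    fix y
    have "norm (herglotz_density a y * fejer t y) = herglotz_density a y * fejer t y"
      using herglotz_density_nonneg[OF a(1)] fejer_nonneg by simp
    also have "\<dots> \<le> herglotz_density a y * ((t\<^sup>2 / 2 + 2) * (1 / (1\<^sup>2 + y\<^sup>2)))"
      by (intro mult_left_mono fejer_bound herglotz_density_nonneg a)
    also have "\<dots> = (t\<^sup>2 / 2 + 2) * (1 / (1\<^sup>2 + y\<^sup>2) * herglotz_density a y)" by simp
    also have "\<dots> \<le> norm ((t\<^sup>2 / 2 + 2) * (1 / (1\<^sup>2 + y\<^sup>2) * herglotz_density a y))" unfolding real_norm_def by (rule abs_ge_self)
    finally show "norm (herglotz_density a y * fejer t y) \<le> norm ((t\<^sup>2 / 2 + 2) * (1 / (1\<^sup>2 + y\<^sup>2) * herglotz_density a y))" .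
  qed
qed

lemma psi_regular_nonneg: "0 < a \<Longrightarrow> psi_regular a t \<ge> 0"
  unfolding psi_regular_def
  by (intro divide_nonneg_pos integral_nonneg_AE AE_I2 mult_nonneg_nonneg herglotz_density_nonneg fejer_nonneg) auto

lemma psi_regular_quasi_triangle:
  assumes a: "0 < a" "a \<le> 1/2"
  shows "psi_regular a h \<le> 2 * psi_regular a (t + h) + 2 * psi_regular a t"
proof -
  note I = integrable_herglotz_fejer[OF a]
  have "(\<integral>y. herglotz_density a y * fejer h y \<partial>lborel) \<le> (\<integral>y. 2 * (herglotz_density a y * fejer (t + h) y) + 2 * (herglotz_density a y * fejer t y) \<partial>lborel)"
  proof (rule integral_mono)
    show "integrable lborel (\<lambda>y. 2 * (herglotz_density a y * fejer (t + h) y) + 2 * (herglotz_density a y * fejer t y))"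
      by (intro Bochner_Integration.integrable_add integrable_mult_right I)
    fix y
    have "herglotz_density a y * fejer h y \<le> herglotz_density a y * (2 * fejer (t + h) y + 2 * fejer t y)"
      by (intro mult_left_mono fejer_quasi_triangle herglotz_density_nonneg a)
    then show "herglotz_density a y * fejer h y \<le> 2 * (herglotz_density a y * fejer (t + h) y) + 2 * (herglotz_density a y * fejer t y)"
      by (simp add: algebra_simps)
  qed (rule I)
  also have "\<dots> = 2 * (\<integral>y. herglotz_density a y * fejer (t + h) y \<partial>lborel) + 2 * (\<integral>y. herglotz_density a y * fejer t y \<partial>lborel)"
    using I[of "t + h"] I[of t] by simp
  finally show ?thesis unfolding psi_regular_def times_divide_eq_right add_divide_distrib[symmetric]
    by (rule divide_right_mono) simp
qed

text \<open>By Tonelli the transform in \<open>t\<close> may be taken first. It turns the Fejer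
  kernel into the Poisson kernel for almost every \<open>y\<close>, and the Poisson formula
  evaluates the remaining integral.\<close>

lemma has_laplace_psi_regular:
  assumes a: "0 < a" "a \<le> 1/2" and s: "s > 0"
  shows "has_laplace (psi_regular a) s (Re (xi_logderiv (of_real (a + s))) / s\<^sup>2)"
proof -
  note [measurable] = herglotz_density_measurable[OF a]
  note I = integrable_herglotz_fejer[OF a]
  note H0 = herglotz_density_nonneg[OF a(1)]
  let ?V = "Re (xi_logderiv (of_real (a + s)))"
  have fm [measurable]: "(\<lambda>(t, y). fejer t y) \<in> borel_measurable (borel \<Otimes>\<^sub>M borel)"
    unfolding fejer_def by measurable
  have V: "has_bochner_integral lborel (\<lambda>y. s / (s\<^sup>2 + y\<^sup>2) * herglotz_density a y) (pi * ?V)"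
    by (rule herglotz_density_Poisson[OF a s])
  have V0: "?V \<ge> 0" by (rule Re_xi_logderiv_nonneg[OF RH]) (use a s in simp)
  have psi: "ennreal (psi_regular a t) = (\<integral>\<^sup>+y. ennreal (herglotz_density a y * fejer t y / pi) \<partial>lborel)" for t
  proof -
    have "(\<integral>\<^sup>+y. ennreal (herglotz_density a y * fejer t y / pi) \<partial>lborel) = ennreal (\<integral>y. herglotz_density a y * fejer t y / pi \<partial>lborel)"
      by (rule nn_integral_eq_integral) (use I[of t] H0 fejer_nonneg in \<open>auto intro!: integrable_divide\<close>)
    then show ?thesis by (simp add: psi_regular_def)
  qed
  have pm: "psi_regular a \<in> borel_measurable borel"
    unfolding psi_regular_def by measurable
  have inner: "(\<integral>\<^sup>+t. ennreal (indicator {0..} t * (exp (-(s * t)) * fejer t y)) \<partial>lborel) = ennreal (1 / (s * (s\<^sup>2 + y\<^sup>2)))" if "y \<noteq> 0" for y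
  proof -
    have h: "has_bochner_integral lborel (\<lambda>t. indicator {0..} t * (exp (-(s * t)) * fejer t y)) (1 / (s * (s\<^sup>2 + y\<^sup>2)))"
      using has_laplace_fejer[OF s that] by (simp add: has_laplace_def)
    then show ?thesis using nn_integral_eq_integral[of lborel "\<lambda>t. indicator {0..} t * (exp (-(s * t)) * fejer t y)"] fejer_nonneg
      by (auto simp: has_bochner_integral_iff)
  qed
  have "(\<integral>\<^sup>+t. ennreal (indicator {0..} t * (exp (-(s * t)) * psi_regular a t)) \<partial>lborel)
     = (\<integral>\<^sup>+t. (\<integral>\<^sup>+y. ennreal (indicator {0..} t * (exp (-(s * t)) * fejer t y)) * ennreal (herglotz_density a y / pi) \<partial>lborel) \<partial>lborel)"
  proof (intro nn_integral_cong)
    fix t :: real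
    have "ennreal (indicator {0..} t * (exp (-(s * t)) * psi_regular a t)) = ennreal (indicator {0..} t * exp (-(s * t))) * ennreal (psi_regular a t)"
      by (subst ennreal_mult'[symmetric]) (auto simp: mult_ac)
    also have "\<dots> = (\<integral>\<^sup>+y. ennreal (indicator {0..} t * exp (-(s * t))) * ennreal (herglotz_density a y * fejer t y / pi) \<partial>lborel)"
      unfolding psi by (rule nn_integral_cmult[symmetric]) measurable
    also have "\<dots> = (\<integral>\<^sup>+y. ennreal (indicator {0..} t * (exp (-(s * t)) * fejer t y)) * ennreal (herglotz_density a y / pi) \<partial>lborel)"
    proof (intro nn_integral_cong)
      fix y
      show "ennreal (indicator {0..} t * exp (-(s * t))) * ennreal (herglotz_density a y * fejer t y / pi) = ennreal (indicator {0..} t * (exp (-(s * t)) * fejer t y)) * ennreal (herglotz_density a y / pi)"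
        using H0[of y] fejer_nonneg[of t y] by (subst (1 2) ennreal_mult'[symmetric]) (auto simp: mult_ac)
    qed
    finally show "ennreal (indicator {0..} t * (exp (-(s * t)) * psi_regular a t)) = (\<integral>\<^sup>+y. ennreal (indicator {0..} t * (exp (-(s * t)) * fejer t y)) * ennreal (herglotz_density a y / pi) \<partial>lborel)" .
  qed
  also have "\<dots> = (\<integral>\<^sup>+y. (\<integral>\<^sup>+t. ennreal (indicator {0..} t * (exp (-(s * t)) * fejer t y)) * ennreal (herglotz_density a y / pi) \<partial>lborel) \<partial>lborel)"
    by (rule lborel_pair.Fubini') measurable
  also have "\<dots> = (\<integral>\<^sup>+y. ennreal (1 / (pi * s\<^sup>2)) * ennreal (s / (s\<^sup>2 + y\<^sup>2) * herglotz_density a y) \<partial>lborel)"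
  proof (rule nn_integral_cong_AE)
    have "AE y in lborel. y \<noteq> (0::real)" by (rule AE_lborel_singleton)
    then show "AE y in lborel. (\<integral>\<^sup>+t. ennreal (indicator {0..} t * (exp (-(s * t)) * fejer t y)) * ennreal (herglotz_density a y / pi) \<partial>lborel)
       = ennreal (1 / (pi * s\<^sup>2)) * ennreal (s / (s\<^sup>2 + y\<^sup>2) * herglotz_density a y)"
    proof eventually_elim
      case (elim y)
      have q: "s\<^sup>2 + y\<^sup>2 > 0" using s by (simp add: add_pos_nonneg)
      have "(\<integral>\<^sup>+t. ennreal (indicator {0..} t * (exp (-(s * t)) * fejer t y)) * ennreal (herglotz_density a y / pi) \<partial>lborel)
        = ennreal (1 / (s * (s\<^sup>2 + y\<^sup>2))) * ennreal (herglotz_density a y / pi)"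
        unfolding inner[OF elim, symmetric] by (rule nn_integral_multc) measurable
      also have "\<dots> = ennreal (1 / (s * (s\<^sup>2 + y\<^sup>2)) * (herglotz_density a y / pi))"
        using s q by (intro ennreal_mult'[symmetric]) simp
      also have "1 / (s * (s\<^sup>2 + y\<^sup>2)) * (herglotz_density a y / pi) = 1 / (pi * s\<^sup>2) * (s / (s\<^sup>2 + y\<^sup>2) * herglotz_density a y)"
        using s q by (simp add: divide_simps power2_eq_square)
      also have "ennreal (1 / (pi * s\<^sup>2) * (s / (s\<^sup>2 + y\<^sup>2) * herglotz_density a y)) = ennreal (1 / (pi * s\<^sup>2)) * ennreal (s / (s\<^sup>2 + y\<^sup>2) * herglotz_density a y)"
        using s by (intro ennreal_mult') simp
      finally show ?case .
    qed
  qed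
  also have "\<dots> = ennreal (1 / (pi * s\<^sup>2)) * (\<integral>\<^sup>+y. ennreal (s / (s\<^sup>2 + y\<^sup>2) * herglotz_density a y) \<partial>lborel)"
    by (rule nn_integral_cmult) measurable
  also have "(\<integral>\<^sup>+y. ennreal (s / (s\<^sup>2 + y\<^sup>2) * herglotz_density a y) \<partial>lborel) = ennreal (pi * ?V)"
  proof -
    have "0 \<le> s / (s\<^sup>2 + y\<^sup>2) * herglotz_density a y" for y
      using H0[of y] s by (intro mult_nonneg_nonneg divide_nonneg_nonneg) auto
    then show ?thesis using V nn_integral_eq_integral[of lborel "\<lambda>y. s / (s\<^sup>2 + y\<^sup>2) * herglotz_density a y"]
      unfolding has_bochner_integral_iff by simp
  qed
  also have "ennreal (1 / (pi * s\<^sup>2)) * ennreal (pi * ?V) = ennreal (?V / s\<^sup>2)"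
    using s by (subst ennreal_mult'[symmetric]) auto
  finally have nn: "(\<integral>\<^sup>+t. ennreal (indicator {0..} t * (exp (-(s * t)) * psi_regular a t)) \<partial>lborel) = ennreal (?V / s\<^sup>2)" .
  show ?thesis unfolding has_laplace_def
    by (rule has_bochner_integral_nn_integral[OF _ _ _ nn])
       (use pm V0 psi_regular_nonneg[OF a(1)] in \<open>auto simp: divide_nonneg_nonneg\<close>)
qed

text \<open>The sequence \<open>1 / (j + 2)\<close> stays within \<open>(0, 1/2]\<close>, the range
  of shifts for which the growth bounds are proved.\<close>

lemma psi_regular_limit:
  assumes s: "s > 1/2"
  shows "(\<lambda>j. Re (xi_logderiv (of_real (1 / real (j + 2) + s)))) \<longlonglongrightarrow> psi_transform s"
proof -
  have "isCont xi_logderiv (of_real s)"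
    using holomorphic_on_imp_continuous_on[OF holomorphic_xi_logderiv[OF RH]] s
    by (simp add: continuous_on_eq_continuous_at open_halfspace_Re_gt)
  moreover have "(\<lambda>j. 1 / real (j + 2) + s) \<longlonglongrightarrow> s" by real_asymp
  then have "(\<lambda>j. complex_of_real (1 / real (j + 2) + s)) \<longlonglongrightarrow> of_real s" by (rule tendsto_of_real)
  ultimately have "(\<lambda>j. xi_logderiv (of_real (1 / real (j + 2) + s))) \<longlonglongrightarrow> xi_logderiv (of_real s)"
    by (rule isCont_tendsto_compose)
  from tendsto_Re[OF this] show ?thesis by (simp add: xi_logderiv_real[OF s])
qed

end

section \<open>Strict positivity of Psi\<close>

definition psi_sum :: "real \<Rightarrow> real" where
  "psi_sum t = (\<Sum>n | 1 \<le> n \<and> real n \<le> exp t. mangoldt n / sqrt (real n) * (t - ln (real n)))"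

definition psi_series :: "real \<Rightarrow> real" where
  "psi_series t = (\<Sum>n. (1 - exp (-(2 * (real n + 1/4) * t))) / (real n + 1/4)\<^sup>2)"

lemma psi_series_sums: "t \<ge> 0 \<Longrightarrow> (\<lambda>n. (1 - exp (-(2 * (real n + 1/4) * t))) / (real n + 1/4)\<^sup>2) sums psi_series t"
  unfolding psi_series_def using Psi_lerch_sums by (intro summable_sums sums_summable)

lemma Psi_eq:
  assumes "t \<ge> 0"
  shows "Psi t = 4 * (exp (t / 2) + exp (- t / 2) - 2) - psi_sum t + t / 2 * (Digamma (1/4) - ln pi) + 1/4 * psi_series t"
  using sums_unique[OF Psi_lerch_sums[OF assms]] assms
  by (simp add: Psi_def Psi_nonneg_def psi_sum_def psi_series_def)

lemma psi_sum_sums: "t \<ge> 0 \<Longrightarrow> (\<lambda>n. mangoldt n / sqrt (real n) * max 0 (t - ln (real n))) sums psi_sum t"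
  unfolding psi_sum_def by (rule Psi_mangoldt_sums)

lemma psi_sum_mono:
  assumes "0 \<le> s" "s \<le> t" shows "psi_sum s \<le> psi_sum t"
  by (rule sums_le[OF _ psi_sum_sums psi_sum_sums]) (use assms in \<open>auto intro!: mult_left_mono divide_nonneg_nonneg simp: mangoldt_nonneg simp del: times_divide_eq_left\<close>)

text \<open>Near \<open>t\<close> only the finitely many \<open>n \<le> exp (t + 1)\<close>
  contribute, and written with positive parts each contribution is continuous where it sets
  in.\<close>

lemma continuous_psi_sum: "continuous_on {0..} psi_sum"
proof -
  have "continuous (at t within {0..}) psi_sum" if t: "t \<ge> 0" for t
  proof -
    define A where "A = {n::nat. 1 \<le> n \<and> real n \<le> exp (t + 1)}"
    have fin: "finite A" unfolding A_def by (rule finite_subset[of _ "{..nat \<lfloor>exp (t + 1)\<rfloor>}"]) (auto simp: le_nat_floor)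
    define g where "g = (\<lambda>x. \<Sum>n\<in>A. mangoldt n / sqrt (real n) * max 0 (x - ln (real n)))"
    have eq: "psi_sum x = g x" if x: "0 \<le> x" "x < t + 1" for x
    proof -
      have "(\<lambda>n. mangoldt n / sqrt (real n) * max 0 (x - ln (real n))) sums g x"
        unfolding g_def
      proof (rule sums_finite[OF fin])
        fix n assume n: "n \<notin> A"
        show "mangoldt n / sqrt (real n) * max 0 (x - ln (real n)) = 0"
        proof (cases "n = 0")
          case False
          then have "exp (t + 1) < real n" using n by (auto simp: A_def)
          then have "t + 1 < ln (real n)" using False by (metis exp_less_cancel_iff exp_ln of_nat_0_less_iff not_gr_zero)
          then show ?thesis using x by simp
        qed simp
      qed
      then show ?thesis using psi_sum_sums[OF x(1)] sums_unique2 by blast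
    qed
    have "continuous (at t within {0..}) g" unfolding g_def by (intro continuous_intros)
    moreover have "eventually (\<lambda>x. g x = psi_sum x) (at t within {0..})"
    proof -
      have "eventually (\<lambda>x. x \<in> {..<t+1}) (nhds t)" by (rule eventually_nhds_in_open) auto
      then show ?thesis unfolding eventually_at_filter by eventually_elim (use eq in auto)
    qed
    moreover have "g t = psi_sum t" using eq[of t] t by simp
    ultimately show ?thesis unfolding continuous_within using Lim_transform_eventually[of g "g t" "at t within {0..}" psi_sum] by simp
  qed
  then show ?thesis by (simp add: continuous_on_eq_continuous_within)
qed

lemma continuous_psi_series: "continuous_on {0..} psi_series"
proof -
  have "uniform_limit {0..} (\<lambda>N t. \<Sum>n<N. (1 - exp (-(2 * (real n + 1/4) * t))) / (real n + 1/4)\<^sup>2) psi_series sequentially"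
    unfolding psi_series_def
  proof (rule Weierstrass_m_test)
    show "summable (\<lambda>n. 1 / (real n + 1/4)\<^sup>2)" using const_C_sums by (rule sums_summable)
    show "norm ((1 - exp (-(2 * (real n + 1/4) * t))) / (real n + 1/4)\<^sup>2) \<le> 1 / (real n + 1/4)\<^sup>2" if "t \<in> {0..}" for n t
    proof -
      have "exp (-(2 * (real n + 1/4) * t)) \<le> 1" using that by (simp add: mult_nonneg_nonneg)
      moreover have "exp (-(2 * (real n + 1/4) * t)) > 0" by simp
      ultimately have "\<bar>1 - exp (-(2 * (real n + 1/4) * t))\<bar> \<le> 1" by linarith
      then show ?thesis by (simp add: divide_right_mono)
    qed
  qed
  then show ?thesis by (rule uniform_limit_theorem[rotated]) (auto intro!: continuous_intros always_eventually)
qed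

lemma continuous_Psi: "continuous_on {0..} Psi"
proof -
  have "continuous_on {0..} (\<lambda>t. 4 * (exp (t / 2) + exp (- t / 2) - 2) - psi_sum t + t / 2 * (Digamma (1/4) - ln pi) + 1/4 * psi_series t)"
    by (intro continuous_intros continuous_psi_sum continuous_psi_series) auto
  then show ?thesis by (rule continuous_on_eq) (simp add: Psi_eq)
qed

lemma Psi_0: "Psi 0 = 0"
proof -
  have "psi_series 0 = 0" by (simp add: psi_series_def)
  moreover have "{n::nat. 1 \<le> n \<and> real n \<le> exp 0} = {1}" by auto
  then have "psi_sum 0 = 0" by (simp add: psi_sum_def)
  ultimately show ?thesis by (simp add: Psi_eq)
qed

lemma Psi_upper:
  assumes t: "t > 0" and h: "0 < h" "h \<le> 1"
  shows "Psi (t + h) \<le> Psi t + (4 * exp (t / 2) + \<bar>Digamma (1/4) - ln pi\<bar> / 2 + const_C / (4 * t)) * h"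
proof -
  define K where "K = (Digamma (1/4) - ln pi :: real)"
  have a: "exp ((t + h) / 2) \<le> exp (t / 2) + exp (t / 2) * h"
  proof -
    have "exp (h / 2) \<le> 1 + h / 2 + (h / 2)\<^sup>2" using h by (intro exp_bound) auto
    also have "(h / 2)\<^sup>2 \<le> h / 2 * 1" unfolding power2_eq_square using h by (intro mult_left_mono) auto
    finally have "exp (h / 2) \<le> 1 + h" by simp
    then have "exp (t / 2) * exp (h / 2) \<le> exp (t / 2) * (1 + h)" by simp
    then show ?thesis by (simp add: exp_add[symmetric] add_divide_distrib algebra_simps)
  qed
  have b: "exp (- (t + h) / 2) \<le> exp (- t / 2)" using h by simp
  have c: "psi_sum t \<le> psi_sum (t + h)" using t h by (intro psi_sum_mono) auto
  have d: "psi_series (t + h) - psi_series t \<le> const_C * (h / t)"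
  proof (rule sums_le)
    show "(\<lambda>n. (1 - exp (-(2 * (real n + 1/4) * (t + h)))) / (real n + 1/4)\<^sup>2 - (1 - exp (-(2 * (real n + 1/4) * t))) / (real n + 1/4)\<^sup>2) sums (psi_series (t + h) - psi_series t)"
      using t h by (intro sums_diff psi_series_sums) auto
    show "(\<lambda>n. 1 / (real n + 1/4)\<^sup>2 * (h / t)) sums (const_C * (h / t))" by (rule sums_mult2[OF const_C_sums])
    fix n :: nat
    define q where "q = 2 * (real n + 1/4)"
    have q: "q > 0" by (simp add: q_def)
    have x: "q * t > 0" using q t by simp
    have "exp (-(q * t)) - exp (-(q * (t + h))) = exp (-(q * t)) * (1 - exp (-(q * h)))"
      by (simp add: algebra_simps exp_add[symmetric])
    also have "\<dots> \<le> (1 / (q * t)) * (q * h)"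
    proof (intro mult_mono)
      have "q * t \<le> exp (q * t)" using exp_ge_add_one_self[of "q * t"] by linarith
      then show "exp (-(q * t)) \<le> 1 / (q * t)" using x by (simp add: exp_minus field_simps)
      show "1 - exp (-(q * h)) \<le> q * h" using exp_ge_add_one_self[of "-(q * h)"] by simp
      show "0 \<le> 1 - exp (-(q * h))" using q h by simp
    qed (use x in simp)
    also have "\<dots> = h / t" using q t by simp
    finally have "(exp (-(q * t)) - exp (-(q * (t + h)))) / (real n + 1/4)\<^sup>2 \<le> h / t / (real n + 1/4)\<^sup>2"
      by (rule divide_right_mono) simp
    then show "(1 - exp (-(2 * (real n + 1/4) * (t + h)))) / (real n + 1/4)\<^sup>2 - (1 - exp (-(2 * (real n + 1/4) * t))) / (real n + 1/4)\<^sup>2 \<le> 1 / (real n + 1/4)\<^sup>2 * (h / t)"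
      unfolding q_def[symmetric] by (simp add: diff_divide_distrib[symmetric] mult.commute)
  qed
  have e: "h / 2 * K \<le> \<bar>K\<bar> / 2 * h" using h by (simp add: mult.commute mult_right_mono)
  have "Psi (t + h) - Psi t = 4 * (exp ((t + h) / 2) - exp (t / 2)) + 4 * (exp (- (t + h) / 2) - exp (- t / 2))
     - (psi_sum (t + h) - psi_sum t) + h / 2 * K + 1/4 * (psi_series (t + h) - psi_series t)"
    using t h by (simp add: Psi_eq K_def[symmetric] algebra_simps add_divide_distrib)
  also have "\<dots> \<le> 4 * (exp (t / 2) * h) + 4 * 0 - 0 + \<bar>K\<bar> / 2 * h + 1/4 * (const_C * (h / t))"
    using a b c d e by (intro add_mono diff_mono mult_left_mono) auto
  also have "\<dots> = (4 * exp (t / 2) + \<bar>K\<bar> / 2 + const_C / (4 * t)) * h" using t by (simp add: field_simps)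
  finally show ?thesis unfolding K_def by simp
qed

text \<open>The divergent slope at 0 comes from the Lerch part. As \<open>exp h < 2\<close>, the
  prime sum is empty apart from \<open>n = 1\<close>, and each of the first \<open>N\<close> terms
  of the series is at least \<open>h / (n + 1)\<close>. The condition on \<open>h\<close> keeps
  \<open>2 * (n + 1/4) * h \<le> 1\<close> for \<open>n < N\<close>, where
  \<open>1 - exp (- x) \<ge> x / 2\<close>.\<close>

lemma Psi_lower:
  assumes h: "0 < h" "h \<le> 1 / (2 * (real N + 1))"
  shows "Psi h \<ge> (harm N / 4 - \<bar>Digamma (1/4) - ln pi\<bar> / 2) * h"
proof -
  define K where "K = (Digamma (1/4) - ln pi :: real)"
  have h2: "h \<le> 1 / 2"
  proof -
    have "1 / (2 * (real N + 1)) \<le> 1 / 2" by (intro divide_left_mono) auto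
    then show ?thesis using h by linarith
  qed
  have "exp h \<le> exp (1/2)" using h2 by simp
  also have "exp (1/2 :: real) < 2" using exp_bound[of "1/2::real"] by (simp add: power2_eq_square)
  finally have e2: "exp h < 2" .
  have "{n::nat. 1 \<le> n \<and> real n \<le> exp h} \<subseteq> {1}"
  proof
    fix n :: nat assume "n \<in> {n. 1 \<le> n \<and> real n \<le> exp h}"
    then have "1 \<le> n" "real n < 2" using e2 by auto
    then show "n \<in> {1}" by auto
  qed
  then have "psi_sum h = 0" unfolding psi_sum_def by (intro sum.neutral) auto
  moreover have "exp (h / 2) + exp (- h / 2) - 2 \<ge> 0"
  proof -
    have "(exp (h / 4) - exp (- h / 4))\<^sup>2 \<ge> 0" by simp
    then show ?thesis by (simp add: power2_eq_square algebra_simps exp_add[symmetric])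
  qed
  moreover have "h / 2 * K \<ge> - (\<bar>K\<bar> / 2 * h)"
  proof -
    have "h * (- \<bar>K\<bar>) \<le> h * K" using h by (intro mult_left_mono) auto
    then show ?thesis by (simp add: mult.commute)
  qed
  moreover have "psi_series h \<ge> harm N * h"
  proof -
    have "harm N * h = (\<Sum>n<N. inverse (real (Suc n)) * h)"
      by (simp add: harm_def sum_distrib_right sum.atLeast1_atMost_eq)
    also have "\<dots> \<le> (\<Sum>n<N. (1 - exp (-(2 * (real n + 1/4) * h))) / (real n + 1/4)\<^sup>2)"
    proof (rule sum_mono)
      fix n assume n: "n \<in> {..<N}"
      define a where "a = real n + 1/4"
      have a: "a > 0" "a \<le> real (Suc n)" "a \<le> real N + 1" using n by (auto simp: a_def)
      define x where "x = 2 * a * h"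
      have "x \<le> 2 * (real N + 1) * h" unfolding x_def using a h by (intro mult_right_mono) auto
      also have "\<dots> \<le> 1" using h by (simp add: field_simps)
      finally have x: "0 \<le> x" "x \<le> 1" using a h by (auto simp: x_def)
      have "exp (-x) \<le> 1 / (1 + x)" using exp_ge_add_one_self[of x] x by (simp add: exp_minus field_simps)
      also have "1 / (1 + x) \<le> 1 - x / 2"
      proof -
        have "0 \<le> x * (1 - x)" using x by (intro mult_nonneg_nonneg) auto
        then have "1 \<le> (1 - x / 2) * (1 + x)" by (simp add: algebra_simps)
        then show ?thesis using x by (simp add: pos_divide_le_eq)
      qed
      finally have "1 - exp (- x) \<ge> x / 2" by simp
      then have "(1 - exp (- x)) / a\<^sup>2 \<ge> x / 2 / a\<^sup>2" by (intro divide_right_mono) auto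
      also have "x / 2 / a\<^sup>2 = h / a" using a by (simp add: x_def power2_eq_square)
      also have "h / a \<ge> h / real (Suc n)" using a h by (intro divide_left_mono) auto
      finally show "inverse (real (Suc n)) * h \<le> (1 - exp (-(2 * (real n + 1/4) * h))) / (real n + 1/4)\<^sup>2"
        unfolding a_def[symmetric] x_def by (simp add: divide_inverse mult.commute)
    qed
    also have "\<dots> \<le> psi_series h"
      unfolding psi_series_def
    proof (rule sum_le_suminf)
      show "summable (\<lambda>n. (1 - exp (-(2 * (real n + 1/4) * h))) / (real n + 1/4)\<^sup>2)"
        using psi_series_sums[of h] h by (auto intro: sums_summable)
      show "0 \<le> (1 - exp (-(2 * (real n + 1/4) * h))) / (real n + 1/4)\<^sup>2" for n
        using h by (intro divide_nonneg_nonneg) auto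
    qed simp
    finally show ?thesis .
  qed
  ultimately have "Psi h \<ge> 4 * 0 - 0 - \<bar>K\<bar> / 2 * h + 1/4 * (harm N * h)"
    unfolding Psi_eq[OF less_imp_le[OF h(1)]] K_def[symmetric]
    by (intro add_mono diff_mono mult_left_mono) (auto simp: algebra_simps)
  then show ?thesis unfolding K_def by (simp add: algebra_simps)
qed

context
  assumes RH: riemann_hypothesis
begin

lemma Psi_nonneg_RH_pos:
  assumes "t > 0" shows "Psi t \<ge> 0"
proof (rule nonneg_of_laplace_limit[where N = 1 and T = "\<lambda>j. psi_regular (1 / real (j + 2))", OF continuous_Psi _ _ _ _ assms])
  show "has_laplace Psi (real n) (psi_transform (real n) / (real n)\<^sup>2)" if "n \<ge> 1" for n
    using that by (intro has_laplace_Psi) auto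
  show "has_laplace (psi_regular (1 / real (j + 2))) (real n) (Re (xi_logderiv (of_real (1 / real (j + 2) + real n))) / (real n)\<^sup>2)" if "n \<ge> 1" for j n
    using that by (intro has_laplace_psi_regular RH) (auto simp: divide_simps)
  show "psi_regular (1 / real (j + 2)) t \<ge> 0" for j t by (rule psi_regular_nonneg[OF RH]) simp
  show "(\<lambda>j. Re (xi_logderiv (of_real (1 / real (j + 2) + real n))) / (real n)\<^sup>2) \<longlonglongrightarrow> psi_transform (real n) / (real n)\<^sup>2" if "n \<ge> 1" for n
    using that by (intro tendsto_intros psi_regular_limit RH) auto
qed

text \<open>Both sides are compared through the dilations \<open>x \<mapsto> (1 + e) x\<close>, \<open>x\<close>, \<open>e x\<close> with \<open>e = h / t\<close>, since the positivity
  principle handles functions of a single variable.\<close>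

lemma Psi_quasi_triangle:
  assumes t: "t > 0" and h: "h > 0"
  shows "Psi h \<le> 2 * Psi (t + h) + 2 * Psi t"
proof -
  define e where "e = h / t"
  have e: "e > 0" using t h by (simp add: e_def)
  \<comment> \<open>From this index on, the arguments \<open>n / (1 + e)\<close>, \<open>n\<close>
    and \<open>n / e\<close> of the three transforms are at least 1, inside the range of
    \<open>has_laplace_Psi\<close>.\<close>
  define N where "N = nat \<lceil>1 + e\<rceil>"
  define a where "a = (\<lambda>j::nat. 1 / real (j + 2))"
  have a: "0 < a j" "a j \<le> 1/2" for j by (auto simp: a_def divide_simps)
  define f where "f = (\<lambda>x. 2 * Psi ((1 + e) * x) + 2 * Psi x - Psi (e * x))"
  define T where "T = (\<lambda>j x. 2 * psi_regular (a j) ((1 + e) * x) + 2 * psi_regular (a j) x - psi_regular (a j) (e * x))"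
  \<comment> \<open>Dilation by \<open>c\<close> sends a transform \<open>v(s)\<close> to
    \<open>v(s / c) / c\<close>. Keeping \<open>R\<close> as a parameter describes the regularised
    and the limiting transforms by one formula.\<close>
  define L where "L = (\<lambda>R s. 2 * (R (s / (1 + e)) / (s / (1 + e))\<^sup>2 / (1 + e)) + 2 * (R s / s\<^sup>2) - R (s / e) / (s / e)\<^sup>2 / e :: real)"
  have n: "real n / (1 + e) \<ge> 1" "real n \<ge> 1" "real n / e \<ge> 1" if "n \<ge> N" for n
  proof -
    have "real n \<ge> 1 + e" using that unfolding N_def by linarith
    then show "real n / (1 + e) \<ge> 1" "real n \<ge> 1" "real n / e \<ge> 1" using e by (auto simp: divide_simps)
  qed
  have lim: "(\<lambda>j. Re (xi_logderiv (of_real (a j + s)))) \<longlonglongrightarrow> psi_transform s" if "s \<ge> 1" for s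
    using psi_regular_limit[OF RH, of s] that by (simp add: a_def)
  have "f t \<ge> 0"
  proof (rule nonneg_of_laplace_limit[where f = f and ?t0.0 = t and N = N and T = T and v = "\<lambda>n. L psi_transform (real n)"
        and u = "\<lambda>j n. L (\<lambda>s. Re (xi_logderiv (of_real (a j + s)))) (real n)"])
    show "continuous_on {0..} f"
      unfolding f_def
      by (intro continuous_intros continuous_on_compose2[OF continuous_Psi] continuous_Psi) (use e in auto)
    show "has_laplace f (real n) (L psi_transform (real n))" if "n \<ge> N" for n
      unfolding f_def L_def using n[OF that] e
      by (intro has_laplace_diff has_laplace_add has_laplace_cmult has_laplace_dilate has_laplace_Psi) auto
    show "has_laplace (T j) (real n) (L (\<lambda>s. Re (xi_logderiv (of_real (a j + s)))) (real n))" if "n \<ge> N" for j n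
      unfolding T_def L_def using n[OF that] e a
      by (intro has_laplace_diff has_laplace_add has_laplace_cmult has_laplace_dilate has_laplace_psi_regular[OF RH]) (auto simp: divide_simps)
    show "T j x \<ge> 0" if "x \<ge> 0" for j x
      using psi_regular_quasi_triangle[OF RH a[of j] , of "e * x" x] by (simp add: T_def algebra_simps)
    show "(\<lambda>j. L (\<lambda>s. Re (xi_logderiv (of_real (a j + s)))) (real n)) \<longlonglongrightarrow> L psi_transform (real n)" if "n \<ge> N" for n
      unfolding L_def using n[OF that] e by (intro tendsto_intros lim) auto
    show "t > 0" by (rule t)
  qed
  moreover have "(1 + e) * t = t + h" "e * t = h" using t by (simp_all add: e_def field_simps)
  ultimately show ?thesis by (simp add: f_def)
qed

lemma Psi_pos_RH_pos:
  assumes t: "t > 0" shows "Psi t > 0"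
proof (rule ccontr)
  assume "\<not> Psi t > 0"
  then have 0: "Psi t = 0" using Psi_nonneg_RH_pos[OF t] by simp
  define K where "K = \<bar>Digamma (1/4) - ln pi :: real\<bar> / 2"
  define U where "U = 4 * exp (t / 2) + K + const_C / (4 * t)"
  have "filterlim (\<lambda>n. harm n :: real) at_top sequentially" by (rule harm_at_top)
  then have "eventually (\<lambda>n. harm n > 4 * (2 * U + K)) sequentially" by (simp add: filterlim_at_top_dense)
  \<comment> \<open>This makes the slope \<open>harm N / 4 - K\<close> of the lower bound exceed the
    slope \<open>2 * U\<close> of the upper bound.\<close>
  then obtain N where N: "harm N > 4 * (2 * U + K)" by (auto simp: eventually_sequentially)
  define h where "h = 1 / (2 * (real N + 1))"
  have h: "0 < h" "h \<le> 1" by (auto simp: h_def divide_simps)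
  have "(harm N / 4 - K) * h \<le> Psi h" using Psi_lower[of h N] h by (simp add: h_def K_def)
  also have "\<dots> \<le> 2 * Psi (t + h) + 2 * Psi t" by (rule Psi_quasi_triangle[OF t h(1)])
  also have "\<dots> \<le> 2 * (U * h)" using Psi_upper[OF t h] 0 by (simp add: U_def K_def)
  finally have "(harm N / 4 - K) * h \<le> (2 * U) * h" by simp
  then have "harm N / 4 - K \<le> 2 * U" using h by simp
  then show False using N by simp
qed

end

lemma Psi_even: "Psi (- t) = Psi t"
  by (simp add: Psi_def)

theorem RH_imp_Psi_pos:
  assumes RH: riemann_hypothesis and t: "t \<noteq> 0" shows "Psi t > 0"
proof (cases "t > 0")
  case True
  then show ?thesis by (rule Psi_pos_RH_pos[OF RH])
next
  case False
  then have "Psi (- t) > 0" using t by (intro Psi_pos_RH_pos[OF RH]) auto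
  then show ?thesis by (simp add: Psi_even)
qed

theorem theorem1p7:
  shows "(riemann_hypothesis \<longleftrightarrow> (\<forall>t::real. Psi t \<ge> 0)) \<and>
         (riemann_hypothesis \<longrightarrow> (\<forall>t::real. t \<noteq> 0 \<longrightarrow> Psi t > 0))"
proof (intro conjI iffI impI allI)
  fix t :: real
  assume riemann_hypothesis
  then show "Psi t \<ge> 0" using RH_imp_Psi_pos[of t] Psi_0 by (cases "t = 0") auto
next
  assume "\<forall>t::real. Psi t \<ge> 0"
  then show riemann_hypothesis using Psi_nonneg_imp_RH by blast
next
  fix t :: real
  assume riemann_hypothesis "t \<noteq> 0"
  then show "Psi t > 0" by (rule RH_imp_Psi_pos)
qed

end
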